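(* Let $n\in\{2,3\}$, let $p\ge 0$ be an integer, let $s\in\{1,2,\infty\}$, let $\Omega\subset\mathbb R^n$, and let $u\in W^{p+1}_s(\Omega)$. Let $\{\mathcal T_h\}$ be a quasi-uniform family of meshes on $\Omega$ made of triangles or of quadrilaterals (if $n=2$), or of tetrahedra or of hexahedra (if $n=3$). For each $h$ let $u^R=u^R_h$ be a function whose restriction to each element of $\mathcal T_h$ is a polynomial of total degree at most $p$. If $\|u-u^R\|_{L^s(\Omega)}\le \mathcal O(h^{p+1})$ (i.e. there is a constant $C$ independent of $h$ with $\|u-u^R_h\|_{L^s(\Omega)}\le Ch^{p+1}$ for all $h$), then $u^R$ is $W^{p+1}_s(\Omega)$-smooth of Type A. In particular, if $\|u-u^R\|_{L^\infty(\Omega)}\le\mathcal O(h^{p+1})$ (the case $s=\infty$), then the jumps of all partial derivatives at the points $x_i$ (midpoints of interior edges if $n=2$, barycenters of interior faces if $n=3$) satisfy $$\bigl|[\![\partial^\alpha u^R]\!]_{x_i}\bigr|=\mathcal O(h^{p+1-k}),\qquad |\alpha|=k,\ 0\le k\le p,$$ with a constant independent of $i$ and $h$.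
   Context: $W^{m}_s(\Omega)$ is the Sobolev space of functions with weak derivatives up to order $m$ in $L^s(\Omega)$. $\Omega$ is a bounded domain that is the union of the elements of each mesh $\mathcal T_h$; $h$ is the maximal element diameter and $h_{\min}$ the least edge length of $\mathcal T_h$. An interior edge ($n=2$) or interior face ($n=3$) is an edge/face common to two elements. Regular family: there is $\sigma>0$ independent of $h$ with $h_K/\rho_K\le\sigma$ for all elements $K$, where $h_K$ is the diameter of $K$ and $\rho_K$ is: for a triangle/tetrahedron, the diameter of the inscribed circle/sphere; for a quadrilateral with vertices $\mathbf x_1,\dots,\mathbf x_4$ (cyclically ordered), $2\min_{1\le i\le4}$ of the diameter of the circle inscribed in the triangle with vertices $\mathbf x_{i-1},\mathbf x_i,\mathbf x_{i+1}$; for a hexahedron, analogously, $2\min$ over the vertices of the diameter of the sphere inscribed in the tetrahedron formed by that vertex and its three neighbouring vertices. Quasi-uniform family: regular and $h/h_{\min}$ bounded above uniformly in $h$. Let $x_1,\dots,x_{N^\circ}$ be the midpoints of the interior edges ($n=2$) or the barycenters of the interior faces ($n=3$) of $\mathcal T_h$. For a piecewise polynomial $u_h$ on $\mathcal T_h$, $[\![\partial^\alpha u_h]\!]_{x_i}=(\partial^\alpha u_h)^+(x_i)-(\partial^\alpha u_h)^-(x_i)$ is the jump at $x_i$ between the values from the two elements sharing the edge/face containing $x_i$ (the choice of sides $\pm$ is fixed arbitrarily). Let $D_i$ be the vector with components $$D_i^\alpha=\frac{[\![\partial^\alpha u_h]\!]_{x_i}}{h^{p+1-|\alpha|}},\qquad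 |\alpha|=k,\ 0\le k\le p,$$ ($\alpha$ multi-indices in $\mathbb N_0^n$), and $\|D_i\|$ its Euclidean norm. Type A smoothness: a family $u_h$ of piecewise polynomials of degree $\le p$ on $\mathcal T_h$ is $W^{p+1}_s(\Omega)$-smooth of Type A, $1\le s<\infty$, if there is a constant $C_s$ independent of $h$ and $u_h$ with $\sum_{i=1}^{N^\circ}h^n\|D_i\|^s\le C_s$; it is $W^{p+1}_\infty(\Omega)$-smooth of Type A if there is a constant $C_\infty$ independent of $h$ and $u_h$ with $\max_{1\le i\le N^\circ}\|D_i\|\le C_\infty$. *)

theory Defs
  imports "HOL-Analysis.Analysis" "HOL-Probability.Essential_Supremum"
begin

subsection \<open>Multi-indices and partial derivatives\<close>

type_synonym 'n multi_index = "'n \<Rightarrow> nat"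

definition mi_order :: "'n::finite multi_index \<Rightarrow> nat" where
  "mi_order \<alpha> = (\<Sum>i\<in>UNIV. \<alpha> i)"

definition partial :: "'n::finite \<Rightarrow> (real^'n \<Rightarrow> real) \<Rightarrow> real^'n \<Rightarrow> real" where
  "partial i f x = deriv (\<lambda>t. f (x + t *\<^sub>R axis i 1)) 0"

text \<open>The index type carries no order, so an arbitrary enumeration of the coordinates fixes the
  order of differentiation. Multi-index derivatives are only taken of functions that are smooth near
  the point in question, where this order is immaterial.\<close>

definition coords :: "'n::finite list" where
  "coords = (SOME xs. distinct xs \<and> set xs = UNIV)"

definition mderiv :: "'n::finite multi_index \<Rightarrow> (real^'n \<Rightarrow> real) \<Rightarrow> real^'n \<Rightarrow> real" where
  "mderiv \<alpha> f = foldr (\<lambda>i. partial i ^^ \<alpha> i) coords f"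

primrec C_k :: "nat \<Rightarrow> (real^'n::finite \<Rightarrow> real) \<Rightarrow> bool" where
  "C_k 0 f \<longleftrightarrow> continuous_on UNIV f"
| "C_k (Suc k) f \<longleftrightarrow> (\<forall>x. f differentiable (at x)) \<and> (\<forall>i. C_k k (partial i f))"

definition test_function :: "(real^'n::finite) set \<Rightarrow> (real^'n \<Rightarrow> real) \<Rightarrow> bool" where
  "test_function \<Omega> \<phi> \<longleftrightarrow>
     (\<forall>k. C_k k \<phi>) \<and> compact (closure {x. \<phi> x \<noteq> 0}) \<and> closure {x. \<phi> x \<noteq> 0} \<subseteq> \<Omega>"

subsection \<open>Lebesgue and Sobolev spaces\<close>

definition in_Lp :: "ennreal \<Rightarrow> (real^'n::finite) set \<Rightarrow> (real^'n \<Rightarrow> real) \<Rightarrow> bool" where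
  "in_Lp s \<Omega> f \<longleftrightarrow> f \<in> borel_measurable (lebesgue_on \<Omega>) \<and>
     (if s = \<infinity> then esssup (lebesgue_on \<Omega>) (\<lambda>x. ereal \<bar>f x\<bar>) < \<infinity>
      else integrable (lebesgue_on \<Omega>) (\<lambda>x. \<bar>f x\<bar> powr enn2real s))"

definition Lp_norm :: "ennreal \<Rightarrow> (real^'n::finite) set \<Rightarrow> (real^'n \<Rightarrow> real) \<Rightarrow> real" where
  "Lp_norm s \<Omega> f =
     (if s = \<infinity> then real_of_ereal (esssup (lebesgue_on \<Omega>) (\<lambda>x. ereal \<bar>f x\<bar>))
      else (LINT x|lebesgue_on \<Omega>. \<bar>f x\<bar> powr enn2real s) powr (1 / enn2real s))"

definition weak_derivative ::
  "'n::finite multi_index \<Rightarrow> (real^'n) set \<Rightarrow> (real^'n \<Rightarrow> real) \<Rightarrow> (real^'n \<Rightarrow> real) \<Rightarrow> bool" where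
  "weak_derivative \<alpha> \<Omega> u v \<longleftrightarrow>
     (\<forall>\<phi>. test_function \<Omega> \<phi> \<longrightarrow>
        (LINT x|lebesgue_on \<Omega>. u x * mderiv \<alpha> \<phi> x)
          = (-1) ^ mi_order \<alpha> * (LINT x|lebesgue_on \<Omega>. v x * \<phi> x))"

text \<open>Functions instead of classes modulo null sets. The domain is bounded throughout, so members of
  \<open>L\<^sup>s\<close> are integrable and the integrals in \<^const>\<open>weak_derivative\<close> exist.\<close>

definition sobolev :: "nat \<Rightarrow> ennreal \<Rightarrow> (real^'n::finite) set \<Rightarrow> (real^'n \<Rightarrow> real) set" where
  "sobolev m s \<Omega> =
     {u. in_Lp s \<Omega> u \<and>
         (\<forall>\<alpha>. mi_order \<alpha> \<le> m \<longrightarrow> (\<exists>v. in_Lp s \<Omega> v \<and> weak_derivative \<alpha> \<Omega> u v))}"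

subsection \<open>Elements\<close>

datatype shape = Triangle | Quadrilateral | Tetrahedron | Hexahedron

text \<open>The (closed, possibly non-convex) quadrilateral with cyclically ordered vertices
  \<open>a, b, c, d\<close>. Every simple quadrilateral has a diagonal inside it, and the vertices are labelled
  so that this is \<open>ac\<close>; the diagonal cuts the quadrilateral into two triangles. Straight
  angles, for which the quantity \<open>\<rho>\<^sub>K\<close> below would vanish, are excluded.\<close>

definition quadrilateral ::
  "'a::euclidean_space \<Rightarrow> 'a \<Rightarrow> 'a \<Rightarrow> 'a \<Rightarrow> 'a set \<Rightarrow> bool" where
  "quadrilateral a b c d K \<longleftrightarrow>
     \<not> collinear {d, a, b} \<and> \<not> collinear {a, b, c} \<and> \<not> collinear {b, c, d} \<and> \<not> collinear {c, d, a} \<and>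
     convex hull {a, b, c} \<inter> convex hull {a, c, d} = closed_segment a c \<and>
     K = convex hull {a, b, c} \<union> convex hull {a, c, d}"

definition neighbours :: "'a::euclidean_space set \<Rightarrow> 'a \<Rightarrow> 'a set" where
  "neighbours K v = {w. closed_segment v w edge_of K}"

text \<open>A polyhedron with six plane quadrilateral faces, three edges meeting at each vertex.\<close>

definition hexahedron :: "'a::euclidean_space set \<Rightarrow> bool" where
  "hexahedron K \<longleftrightarrow>
     polytope K \<and> aff_dim K = 3 \<and> card {F. F facet_of K} = 6 \<and>
     (\<forall>F. F facet_of K \<longrightarrow> card {v. v extreme_point_of F} = 4) \<and>
     (\<forall>v. v extreme_point_of K \<longrightarrow> card (neighbours K v) = 3)"

fun is_element :: "shape \<Rightarrow> 'a::euclidean_space set \<Rightarrow> bool" where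
  "is_element Triangle K \<longleftrightarrow> 2 simplex K"
| "is_element Quadrilateral K \<longleftrightarrow> (\<exists>a b c d. quadrilateral a b c d K)"
| "is_element Tetrahedron K \<longleftrightarrow> 3 simplex K"
| "is_element Hexahedron K \<longleftrightarrow> hexahedron K"

text \<open>The labelling of the vertices of a quadrilateral is unique up to rotation and reflection, so
  in the following definitions it does not matter which one is used.\<close>

definition quad_edges :: "'a::euclidean_space set \<Rightarrow> 'a set set" where
  "quad_edges K =
     {E. \<exists>a b c d. quadrilateral a b c d K \<and>
           E \<in> {closed_segment a b, closed_segment b c, closed_segment c d, closed_segment d a}}"

definition element_edges :: "shape \<Rightarrow> 'a::euclidean_space set \<Rightarrow> 'a set set" where
  "element_edges k K = (if k = Quadrilateral then quad_edges K else {E. E edge_of K})"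

text \<open>The faces of codimension 1, that is, the edges of plane elements.\<close>

definition element_faces :: "shape \<Rightarrow> 'a::euclidean_space set \<Rightarrow> 'a set set" where
  "element_faces k K = (if k = Quadrilateral then quad_edges K else {F. F facet_of K})"

text \<open>The inscribed sphere of a simplex is the boundary of the largest ball contained in it.\<close>

definition insphere_diameter :: "'a::euclidean_space set \<Rightarrow> real" where
  "insphere_diameter S = Sup {2 * r | r c. 0 \<le> r \<and> cball c r \<subseteq> S}"

fun corner_simplices :: "shape \<Rightarrow> 'a::euclidean_space set \<Rightarrow> 'a set set" where
  "corner_simplices Quadrilateral K =
     {S. \<exists>a b c d. quadrilateral a b c d K \<and>
           S \<in> {convex hull {d, a, b}, convex hull {a, b, c},
                 convex hull {b, c, d}, convex hull {c, d, a}}}"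
| "corner_simplices Hexahedron K =
     {convex hull (insert v (neighbours K v)) | v. v extreme_point_of K}"
| "corner_simplices _ K = {K}"

definition rho :: "shape \<Rightarrow> 'a::euclidean_space set \<Rightarrow> real" where
  "rho k K =
     (if k \<in> {Triangle, Tetrahedron} then insphere_diameter K
      else 2 * (INF S\<in>corner_simplices k K. insphere_diameter S))"

subsection \<open>Meshes\<close>

text \<open>Elements are closed and the domain is open, so ``the union of the elements'' is read as the
  interior of that union. (Merely asking for \<open>closure \<Omega> = \<Union>T\<close> would admit slit domains, whose slits
  contain faces common to two elements although they are not part of the domain.)\<close>

definition mesh :: "shape \<Rightarrow> 'a::euclidean_space set \<Rightarrow> 'a set set \<Rightarrow> bool" where
  "mesh k \<Omega> T \<longleftrightarrow>
     finite T \<and> (\<forall>K\<in>T. is_element k K) \<and>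
     pairwise (\<lambda>K L. interior K \<inter> interior L = {}) T \<and>
     \<Omega> = interior (\<Union>T)"

definition mesh_size :: "'a::euclidean_space set set \<Rightarrow> real" where
  "mesh_size T = Max (diameter ` T)"

definition min_edge_length :: "shape \<Rightarrow> 'a::euclidean_space set set \<Rightarrow> real" where
  "min_edge_length k T = (INF E\<in>(\<Union>K\<in>T. element_edges k K). diameter E)"

definition regular_family :: "('i \<Rightarrow> shape) \<Rightarrow> ('i \<Rightarrow> 'a::euclidean_space set set) \<Rightarrow> bool" where
  "regular_family k T \<longleftrightarrow> (\<exists>\<sigma>>0. \<forall>i. \<forall>K\<in>T i. diameter K \<le> \<sigma> * rho (k i) K)"

definition quasi_uniform_family :: "('i \<Rightarrow> shape) \<Rightarrow> ('i \<Rightarrow> 'a::euclidean_space set set) \<Rightarrow> bool" where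
  "quasi_uniform_family k T \<longleftrightarrow>
     regular_family k T \<and> (\<exists>\<kappa>. \<forall>i. mesh_size (T i) \<le> \<kappa> * min_edge_length (k i) (T i))"

definition interior_faces :: "shape \<Rightarrow> 'a::euclidean_space set set \<Rightarrow> 'a set set" where
  "interior_faces k T =
     {F. \<exists>K\<in>T. \<exists>L\<in>T. K \<noteq> L \<and> F \<in> element_faces k K \<and> F \<in> element_faces k L}"

definition is_orientation ::
  "shape \<Rightarrow> 'a::euclidean_space set set \<Rightarrow> ('a set \<Rightarrow> 'a set) \<Rightarrow> ('a set \<Rightarrow> 'a set) \<Rightarrow> bool" where
  "is_orientation k T Kp Km \<longleftrightarrow>
     (\<forall>F\<in>interior_faces k T. Kp F \<in> T \<and> Km F \<in> T \<and> Kp F \<noteq> Km F \<and>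
        F \<in> element_faces k (Kp F) \<and> F \<in> element_faces k (Km F))"

text \<open>The barycenter (centre of mass) of a lower-dimensional set \<open>F\<close> such as a plane face in space.
  The set \<open>F\<close> itself is Lebesgue null; it is thickened by the unit ball of the orthogonal complement
  of its direction space, which by Fubini does not move the centre of mass.\<close>

definition thickening :: "'a::euclidean_space set \<Rightarrow> 'a set" where
  "thickening F = {x + y | x y. x \<in> F \<and> norm y \<le> 1 \<and> (\<forall>a\<in>F. \<forall>b\<in>F. y \<bullet> (a - b) = 0)}"

definition barycenter :: "'a::euclidean_space set \<Rightarrow> 'a" where
  "barycenter F =
     (1 / measure lebesgue (thickening F)) *\<^sub>R (LINT x|lebesgue_on (thickening F). x)"

definition face_point :: "'a::euclidean_space set \<Rightarrow> 'a" where
  "face_point F =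
     (if DIM('a) = 2 then THE m. \<exists>a b. F = closed_segment a b \<and> m = midpoint a b
      else barycenter F)"

subsection \<open>Piecewise polynomials and their jumps\<close>

definition polynomial_le :: "nat \<Rightarrow> (real^'n::finite \<Rightarrow> real) \<Rightarrow> bool" where
  "polynomial_le p q \<longleftrightarrow>
     (\<exists>c. \<forall>x. q x = (\<Sum>\<alpha> | mi_order \<alpha> \<le> p. c \<alpha> * (\<Prod>i\<in>UNIV. (x $ i) ^ \<alpha> i)))"

text \<open>A piecewise polynomial is multivalued on the faces; the values there (on a null set) are left
  unspecified, and one-sided values are limits from the interior of an element.\<close>

definition piecewise_polynomial :: "nat \<Rightarrow> (real^'n::finite) set set \<Rightarrow> (real^'n \<Rightarrow> real) \<Rightarrow> bool" where
  "piecewise_polynomial p T u \<longleftrightarrow>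
     (\<forall>K\<in>T. \<exists>q. polynomial_le p q \<and> (\<forall>x\<in>interior K. u x = q x))"

definition jump ::
  "'n::finite multi_index \<Rightarrow> (real^'n \<Rightarrow> real) \<Rightarrow> (real^'n) set \<Rightarrow> (real^'n) set \<Rightarrow> real^'n \<Rightarrow> real" where
  "jump \<alpha> u K L x =
     Lim (at x within interior K) (mderiv \<alpha> u) - Lim (at x within interior L) (mderiv \<alpha> u)"

text \<open>The Euclidean norm of the vector of scaled jumps at \<open>x\<close>.\<close>

definition D_norm ::
  "nat \<Rightarrow> real \<Rightarrow> (real^'n::finite \<Rightarrow> real) \<Rightarrow> (real^'n) set \<Rightarrow> (real^'n) set \<Rightarrow> real^'n \<Rightarrow> real" where
  "D_norm p h u K L x =
     sqrt (\<Sum>\<alpha> | mi_order \<alpha> \<le> p. (jump \<alpha> u K L x / h ^ (p + 1 - mi_order \<alpha>))\<^sup>2)"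

text \<open>\<open>W\<^sup>p\<^sup>+\<^sup>1\<^sub>s\<close>-smoothness of Type A of the family \<open>u\<close> on the meshes \<open>T i\<close>, with \<open>Kp i F\<close> and
  \<open>Km i F\<close> the elements on the two sides of \<open>F\<close>.\<close>

definition smooth_type_A ::
  "nat \<Rightarrow> ennreal \<Rightarrow> ('i \<Rightarrow> shape) \<Rightarrow> ('i \<Rightarrow> (real^'n::finite) set set) \<Rightarrow>
   ('i \<Rightarrow> (real^'n) set \<Rightarrow> (real^'n) set) \<Rightarrow> ('i \<Rightarrow> (real^'n) set \<Rightarrow> (real^'n) set) \<Rightarrow>
   ('i \<Rightarrow> real^'n \<Rightarrow> real) \<Rightarrow> bool" where
  "smooth_type_A p s k T Kp Km u \<longleftrightarrow>
     (if s = \<infinity> then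
        \<exists>C. \<forall>i. \<forall>F\<in>interior_faces (k i) (T i).
          D_norm p (mesh_size (T i)) (u i) (Kp i F) (Km i F) (face_point F) \<le> C
      else
        \<exists>C. \<forall>i. (\<Sum>F\<in>interior_faces (k i) (T i). mesh_size (T i) ^ CARD('n) *
          D_norm p (mesh_size (T i)) (u i) (Kp i F) (Km i F) (face_point F) powr enn2real s) \<le> C)"

end

theory Submission
  imports Defs
begin

text \<open>
  If \<open>F\<close> is a face common to \<open>K\<close> and \<open>L\<close>, quasi-uniformity provides a ball of radius \<open>\<rho> \<sim> h\<close> about some
  point of \<open>F\<close> (not necessarily the face point) which is contained in \<open>K \<union> L\<close>, one half in each of the
  two elements. Integrating against the derivatives of a bump function of width \<open>\<sim> h\<close>, moved across the
  ball from \<open>K\<close> to \<open>L\<close>, gives moments of \<open>u\<close>. The moments of order \<open>p + 1\<close> are moments of weak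
  derivatives of \<open>u\<close>, so descending induction on the order shows that the moments of \<open>u - q\<^sub>L\<close> on the
  side of \<open>K\<close> are controlled by those on the side of \<open>L\<close>, that is by \<open>u - q\<^sub>L\<close> on \<open>L\<close>, and by the weak
  derivatives. Comparing with \<open>u - q\<^sub>K\<close> bounds the moments of the polynomial \<open>q\<^sub>K - q\<^sub>L\<close>, hence, by
  another descending induction, all its derivatives at distance \<open>O(h)\<close>, in particular at the face point.
  The bound is a multiple of \<open>h\<^sup>-\<^sup>n\<close> times an \<open>L\<^sup>1\<close> norm over \<open>K \<union> L\<close>. As the number of faces of an element
  is bounded, summation over the faces gives the cases \<open>s = 1\<close> and, by Cauchy-Schwarz, \<open>s = 2\<close>.\<close>

subsection \<open>Families of iterated partial derivatives\<close>

text \<open>The obstacle is that \<open>u\<close> is known only through its weak derivatives, and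
  that two elements sharing a face may form a non-convex patch of uncontrolled shape; traces,
  density arguments or a Poincare inequality would all need constants uniform over such patches.
  Testing against a kernel avoids this. A kernel supported in \<Omega> is itself a test function, so
  the definition of the weak derivative applies literally; and as functions of the centre of the
  kernel, the moments are smooth, with gradients consisting of moments one order higher.
  One-variable mean value estimates then suffice, and every constant is explicit in \<sigma>,
  \<kappa>, \<open>p\<close> and the dimension. Regularity speaks only about balls in corner
  simplices, so the ball across the face is built from these: each of them that is used is a cone
  over a part of the face, and slicing a cone through an inscribed ball yields a disc in its base.
  Two points cost extra work. Quadrilaterals may be non-convex, so convex parts \<open>S\<close>
  stand in for elements. And an element is a bare set without a chosen labelling of vertices, so
  counting its edges means bounding all admissible labellings at once.\<close>

text \<open>All mixed derivatives are carried as one family indexed by multi-indices, so their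
  symmetry is built in and no order of differentiation has to be tracked. Asking for the total
  derivative of every member gives smoothness of all orders and the chain rule along lines at
  once.\<close>

definition deriv_family :: "('n::finite multi_index \<Rightarrow> real^'n \<Rightarrow> real) \<Rightarrow> bool" where
  "deriv_family \<Phi> \<longleftrightarrow>
     (\<forall>\<alpha> x. (\<Phi> \<alpha> has_derivative (\<lambda>d. \<Sum>i\<in>UNIV. d $ i * \<Phi> (\<alpha>(i := Suc (\<alpha> i))) x)) (at x))"

lemma mi_order_upd [simp]: "mi_order (\<alpha>(i := Suc (\<alpha> i))) = Suc (mi_order \<alpha>)"
proof -
  have "(\<Sum>j\<in>UNIV - {i}. (\<alpha>(i := Suc (\<alpha> i))) j) = (\<Sum>j\<in>UNIV - {i}. \<alpha> j)"
    by (intro sum.cong) auto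
  then show ?thesis
    unfolding mi_order_def by (simp add: sum.remove[of UNIV i])
qed

lemma finite_mi_order_le: "finite {\<alpha> :: 'n::finite multi_index. mi_order \<alpha> \<le> p}"
proof -
  have "{\<alpha> :: 'n multi_index. mi_order \<alpha> \<le> p} \<subseteq> Pi\<^sub>E UNIV (\<lambda>_. {..p})"
  proof
    fix \<alpha> :: "'n multi_index" assume "\<alpha> \<in> {\<alpha>. mi_order \<alpha> \<le> p}"
    then have "\<alpha> i \<le> p" for i
      using member_le_sum[of i UNIV \<alpha>] by (simp add: mi_order_def)
    then show "\<alpha> \<in> Pi\<^sub>E UNIV (\<lambda>_. {..p})" by auto
  qed
  then show ?thesis
    by (rule finite_subset) (intro finite_PiE; simp)
qed

lemma finite_mi_order_eq: "finite {\<alpha> :: 'n::finite multi_index. mi_order \<alpha> = p}"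
  by (rule finite_subset[OF _ finite_mi_order_le[of p]]) auto

lemma mi_order_Suc_cases:
  fixes \<alpha> :: "'n::finite multi_index"
  assumes "mi_order \<alpha> = Suc k"
  obtains \<beta> i where "\<alpha> = \<beta>(i := Suc (\<beta> i))" "mi_order \<beta> = k"
proof -
  obtain i where "\<alpha> i \<noteq> 0"
    using assms unfolding mi_order_def by (metis nat.simps(3) sum.neutral)
  then have "\<alpha> = (\<alpha>(i := \<alpha> i - 1))(i := Suc ((\<alpha>(i := \<alpha> i - 1)) i))" by auto
  moreover from this have "mi_order (\<alpha>(i := \<alpha> i - 1)) = k"
    using assms by (metis mi_order_upd nat.inject)
  ultimately show ?thesis using that by blast
qed

lemma deriv_familyD:
  "deriv_family \<Phi> \<Longrightarrow>
    (\<Phi> \<alpha> has_derivative (\<lambda>d. \<Sum>i\<in>UNIV. d $ i * \<Phi> (\<alpha>(i := Suc (\<alpha> i))) x)) (at x)"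
  unfolding deriv_family_def by blast

lemma deriv_family_line:
  assumes "deriv_family \<Phi>"
  shows "((\<lambda>t. \<Phi> \<alpha> (x + t *\<^sub>R d)) has_real_derivative
           (\<Sum>i\<in>UNIV. d $ i * \<Phi> (\<alpha>(i := Suc (\<alpha> i))) (x + t *\<^sub>R d))) (at t within S)"
proof -
  have "((\<lambda>t. x + t *\<^sub>R d) has_derivative (\<lambda>h. h *\<^sub>R d)) (at t within S)"
    by (auto intro!: derivative_eq_intros)
  then have "((\<lambda>t. \<Phi> \<alpha> (x + t *\<^sub>R d)) has_derivative
      (\<lambda>h. \<Sum>i\<in>UNIV. (h *\<^sub>R d) $ i * \<Phi> (\<alpha>(i := Suc (\<alpha> i))) (x + t *\<^sub>R d))) (at t within S)"
    by (rule has_derivative_compose[OF _ deriv_familyD[OF assms]])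
  then show ?thesis
    unfolding has_field_derivative_def
    by (rule has_derivative_eq_rhs) (simp add: fun_eq_iff sum_distrib_left sum_distrib_right mult_ac)
qed

lemma deriv_family_partial:
  assumes "deriv_family \<Phi>"
  shows "partial i (\<Phi> \<alpha>) = \<Phi> (\<alpha>(i := Suc (\<alpha> i)))"
proof
  fix x
  have "((\<lambda>t. \<Phi> \<alpha> (x + t *\<^sub>R axis i 1)) has_real_derivative
      (\<Sum>j\<in>UNIV. axis i 1 $ j * \<Phi> (\<alpha>(j := Suc (\<alpha> j))) (x + 0 *\<^sub>R axis i 1))) (at 0)"
    by (rule deriv_family_line[OF assms])
  moreover have "(\<Sum>j\<in>UNIV. axis i 1 $ j * \<Phi> (\<alpha>(j := Suc (\<alpha> j))) (x + 0 *\<^sub>R axis i 1))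
      = \<Phi> (\<alpha>(i := Suc (\<alpha> i))) x"
    by (simp add: axis_def if_distrib[of "\<lambda>c. c * _"] cong: if_cong)
  ultimately show "partial i (\<Phi> \<alpha>) x = \<Phi> (\<alpha>(i := Suc (\<alpha> i))) x"
    unfolding partial_def by (simp add: DERIV_imp_deriv)
qed

lemma deriv_family_partial_funpow:
  assumes "deriv_family \<Phi>"
  shows "(partial i ^^ k) (\<Phi> \<alpha>) = \<Phi> (\<alpha>(i := \<alpha> i + k))"
proof (induction k)
  case (Suc k)
  have "(\<alpha>(i := \<alpha> i + k))(i := Suc ((\<alpha>(i := \<alpha> i + k)) i)) = \<alpha>(i := \<alpha> i + Suc k)"
    by simp
  with Suc show ?case
    by (simp only: funpow.simps o_apply deriv_family_partial[OF assms])
qed simp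

lemma set_coords: "distinct (coords :: 'n::finite list)" "set (coords :: 'n list) = UNIV"
proof -
  have "\<exists>xs :: 'n list. distinct xs \<and> set xs = UNIV"
    using finite_distinct_list[of "UNIV :: 'n set"] by auto
  then have "distinct (coords :: 'n list) \<and> set (coords :: 'n list) = UNIV"
    unfolding coords_def by (rule someI_ex)
  then show "distinct (coords :: 'n list)" "set (coords :: 'n list) = UNIV" by auto
qed

text \<open>Here the arbitrary enumeration \<open>coords\<close> becomes harmless: each coordinate
  occurs in it exactly once, so its exponent is raised once, by \<open>\<alpha> i\<close>, whatever
  the order.\<close>

lemma deriv_family_mderiv:
  assumes "deriv_family \<Phi>"
  shows "mderiv \<alpha> (\<Phi> (\<lambda>_. 0)) = \<Phi> \<alpha>"
proof -
  have *: "foldr (\<lambda>i. partial i ^^ \<alpha> i) xs (\<Phi> (\<lambda>_. 0)) = \<Phi> (\<lambda>i. if i \<in> set xs then \<alpha> i else 0)"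
    if "distinct xs" for xs
    using that
  proof (induction xs)
    case (Cons a xs)
    have "(\<lambda>i. if i \<in> set xs then \<alpha> i else 0)(a := (if a \<in> set xs then \<alpha> a else 0) + \<alpha> a)
      = (\<lambda>i. if i \<in> set (a # xs) then \<alpha> i else 0)"
      using Cons.prems by (auto simp: fun_eq_iff)
    with Cons show ?case
      by (simp add: deriv_family_partial_funpow[OF assms])
  qed simp
  show ?thesis
    unfolding mderiv_def by (simp add: * set_coords)
qed

lemma deriv_family_C_k:
  assumes "deriv_family \<Phi>"
  shows "C_k k (\<Phi> \<alpha>)"
proof (induction k arbitrary: \<alpha>)
  case 0
  show ?case
    by (auto intro!: continuous_at_imp_continuous_on has_derivative_continuous deriv_familyD[OF assms])
next
  case (Suc k)
  then show ?case
    by (auto simp: deriv_family_partial[OF assms] intro!: differentiableI deriv_familyD[OF assms])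
qed

lemma deriv_family_continuous:
  assumes "deriv_family \<Phi>"
  shows "continuous_on S (\<Phi> \<alpha>)"
  by (auto intro!: continuous_at_imp_continuous_on has_derivative_continuous deriv_familyD[OF assms])

lemma deriv_family_scale_translate:
  assumes "deriv_family \<Phi>"
  shows "deriv_family (\<lambda>\<alpha> x. \<Phi> \<alpha> (c *\<^sub>R (x - z)) * c ^ mi_order \<alpha>)"
  unfolding deriv_family_def
proof safe
  fix \<alpha> x
  have "((\<lambda>x. c *\<^sub>R (x - z)) has_derivative (\<lambda>h. c *\<^sub>R h)) (at x)"
    by (auto intro!: derivative_eq_intros)
  then have "((\<lambda>x. \<Phi> \<alpha> (c *\<^sub>R (x - z))) has_derivative
      (\<lambda>h. \<Sum>i\<in>UNIV. (c *\<^sub>R h) $ i * \<Phi> (\<alpha>(i := Suc (\<alpha> i))) (c *\<^sub>R (x - z)))) (at x)"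
    by (rule has_derivative_compose[OF _ deriv_familyD[OF assms]])
  then have "((\<lambda>x. \<Phi> \<alpha> (c *\<^sub>R (x - z)) * c ^ mi_order \<alpha>) has_derivative
      (\<lambda>h. (\<Sum>i\<in>UNIV. (c *\<^sub>R h) $ i * \<Phi> (\<alpha>(i := Suc (\<alpha> i))) (c *\<^sub>R (x - z))) * c ^ mi_order \<alpha>)) (at x)"
    by (rule has_derivative_mult_left)
  then show "((\<lambda>x. \<Phi> \<alpha> (c *\<^sub>R (x - z)) * c ^ mi_order \<alpha>) has_derivative
     (\<lambda>d. \<Sum>i\<in>UNIV. d $ i * (\<Phi> (\<alpha>(i := Suc (\<alpha> i))) (c *\<^sub>R (x - z))
             * c ^ mi_order (\<alpha>(i := Suc (\<alpha> i)))))) (at x)"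
    by (rule has_derivative_eq_rhs) (simp only: fun_eq_iff sum_distrib_right mi_order_upd, simp add: mult_ac)
qed

lemma deriv_family_sum:
  assumes "\<And>a. a \<in> A \<Longrightarrow> deriv_family (\<Phi> a)"
  shows "deriv_family (\<lambda>\<alpha> x. \<Sum>a\<in>A. c a * \<Phi> a \<alpha> x)"
  unfolding deriv_family_def
proof safe
  fix \<alpha> x
  have "((\<lambda>x. \<Sum>a\<in>A. c a * \<Phi> a \<alpha> x) has_derivative
     (\<lambda>d. \<Sum>a\<in>A. c a * (\<Sum>i\<in>UNIV. d $ i * \<Phi> a (\<alpha>(i := Suc (\<alpha> i))) x))) (at x)"
    by (intro has_derivative_sum has_derivative_mult_right deriv_familyD assms)
  then show "((\<lambda>x. \<Sum>a\<in>A. c a * \<Phi> a \<alpha> x) has_derivative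
     (\<lambda>d. \<Sum>i\<in>UNIV. d $ i * (\<Sum>a\<in>A. c a * \<Phi> a (\<alpha>(i := Suc (\<alpha> i))) x))) (at x)"
    by (rule has_derivative_eq_rhs)
       (simp add: fun_eq_iff sum_distrib_left mult.left_commute sum.swap[of _ A])
qed

lemma deriv_family_diff:
  assumes "deriv_family \<Phi>" "deriv_family \<Psi>"
  shows "deriv_family (\<lambda>\<alpha> x. \<Phi> \<alpha> x - \<Psi> \<alpha> x)"
  unfolding deriv_family_def
proof safe
  fix \<alpha> x
  show "((\<lambda>x. \<Phi> \<alpha> x - \<Psi> \<alpha> x) has_derivative
     (\<lambda>d. \<Sum>i\<in>UNIV. d $ i * (\<Phi> (\<alpha>(i := Suc (\<alpha> i))) x - \<Psi> (\<alpha>(i := Suc (\<alpha> i))) x))) (at x)"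
    by (rule has_derivative_eq_rhs[OF has_derivative_diff[OF assms[THEN deriv_familyD]]])
       (simp add: fun_eq_iff right_diff_distrib sum_subtractf)
qed

text \<open>The source of both concrete families: successive derivatives of powers give the
  monomials, those of a one-variable bump give the kernel. Raising one exponent changes one factor,
  as in the product rule.\<close>

lemma deriv_family_prod:
  fixes G :: "'n::finite \<Rightarrow> nat \<Rightarrow> real \<Rightarrow> real"
  assumes G: "\<And>i k t. (G i k has_real_derivative G i (Suc k) t) (at t)"
  shows "deriv_family (\<lambda>\<alpha> x. \<Prod>i\<in>UNIV. G i (\<alpha> i) (x $ i))"
  unfolding deriv_family_def
proof safe
  fix \<alpha> :: "'n multi_index" and x :: "real^'n"
  have "((\<lambda>x. G i (\<alpha> i) (x $ i)) has_derivative (\<lambda>d. G i (Suc (\<alpha> i)) (x $ i) * d $ i)) (at x)" for i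
  proof -
    have "((\<lambda>x. x $ i) has_derivative (\<lambda>d. d $ i)) (at x)"
      by (rule bounded_linear_imp_has_derivative[OF bounded_linear_vec_nth])
    then show ?thesis
      by (rule has_derivative_compose[where g = "G i (\<alpha> i)"])
         (rule G[unfolded has_field_derivative_def])
  qed
  then have "((\<lambda>x. \<Prod>i\<in>UNIV. G i (\<alpha> i) (x $ i)) has_derivative
      (\<lambda>d. \<Sum>i\<in>UNIV. (G i (Suc (\<alpha> i)) (x $ i) * d $ i) * (\<Prod>j\<in>UNIV - {i}. G j (\<alpha> j) (x $ j)))) (at x)"
    by (rule has_derivative_prod)
  moreover have "(\<Prod>j\<in>UNIV. G j ((\<alpha>(i := Suc (\<alpha> i))) j) (x $ j))
      = G i (Suc (\<alpha> i)) (x $ i) * (\<Prod>j\<in>UNIV - {i}. G j (\<alpha> j) (x $ j))" for i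
    by (subst prod.remove[of UNIV i]) (auto intro!: prod.cong)
  ultimately show "((\<lambda>x. \<Prod>i\<in>UNIV. G i (\<alpha> i) (x $ i)) has_derivative
      (\<lambda>d. \<Sum>i\<in>UNIV. d $ i * (\<Prod>j\<in>UNIV. G j ((\<alpha>(i := Suc (\<alpha> i))) j) (x $ j)))) (at x)"
    by (simp add: mult_ac)
qed

lemma polynomial_deriv_family:
  fixes q :: "real^'n::finite \<Rightarrow> real"
  assumes "polynomial_le p q"
  obtains \<Phi> where "deriv_family \<Phi>" "\<Phi> (\<lambda>_. 0) = q" "\<And>\<gamma> x. p < mi_order \<gamma> \<Longrightarrow> \<Phi> \<gamma> x = 0"
proof -
  obtain c where c: "\<And>x. q x = (\<Sum>\<alpha> | mi_order \<alpha> \<le> p. c \<alpha> * (\<Prod>i\<in>UNIV. (x $ i) ^ \<alpha> i))"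
    using assms unfolding polynomial_le_def by blast
  define M where "M m k t = poly ((pderiv ^^ k) (monom 1 m)) t" for m k and t :: real
  have M: "(M m k has_real_derivative M m (Suc k) t) (at t)" for m k t
    unfolding M_def by (simp add: poly_DERIV)
  have M0: "M m 0 t = t ^ m" for m t
    unfolding M_def by (simp add: poly_monom)
  have deg: "degree ((pderiv ^^ k) (monom (1::real) m)) \<le> m - k" for k m
    by (induction k) (auto simp: degree_pderiv degree_monom_eq)
  have M_zero: "M m k t = 0" if "m < k" for m k t
  proof -
    define l where "l = k - Suc m"
    have k: "k = l + Suc m"
      using that by (simp add: l_def)
    \<comment> \<open>After \<open>m\<close> derivatives the degree is 0, and one more kills the
      constant; \<open>deg\<close> with its truncated subtraction would only give degree 0
      again.\<close>
    have *: "(pderiv ^^ Suc m) (monom (1::real) m) = 0"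
      using deg[of m m] by (simp add: pderiv_eq_0_iff)
    have "(pderiv ^^ k) (monom (1::real) m) = (pderiv ^^ l) ((pderiv ^^ Suc m) (monom 1 m))"
      by (simp only: k funpow_add o_apply)
    also have "\<dots> = 0" unfolding * by (induction l) auto
    finally show ?thesis unfolding M_def by simp
  qed
  define \<Phi> where
    "\<Phi> \<gamma> x = (\<Sum>\<alpha> | mi_order \<alpha> \<le> p. c \<alpha> * (\<Prod>i\<in>UNIV. M (\<alpha> i) (\<gamma> i) (x $ i)))"
    for \<gamma> :: "'n multi_index" and x
  have "deriv_family \<Phi>"
    unfolding \<Phi>_def by (intro deriv_family_sum deriv_family_prod M)
  moreover have "\<Phi> (\<lambda>_. 0) = q"
    by (simp add: fun_eq_iff \<Phi>_def M0 c)
  moreover have "\<Phi> \<gamma> x = 0" if "p < mi_order \<gamma>" for \<gamma> x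
    unfolding \<Phi>_def
  proof (rule sum.neutral, safe)
    fix \<alpha> :: "'n multi_index" assume "mi_order \<alpha> \<le> p"
    \<comment> \<open>An order above \<open>p\<close> exceeds the monomial in some coordinate, and
      the factor belonging to that coordinate vanishes.\<close>
    then have "\<exists>i. \<alpha> i < \<gamma> i"
      using that sum_mono[of UNIV \<gamma> \<alpha>] unfolding mi_order_def by (metis leD le_less_trans not_le)
    then show "c \<alpha> * (\<Prod>i\<in>UNIV. M (\<alpha> i) (\<gamma> i) (x $ i)) = 0"
      using M_zero by (auto intro!: prod_zero)
  qed
  ultimately show ?thesis using that by blast
qed

subsection \<open>A smooth bump function\<close>

text \<open>A class closed under differentiation: polynomial over a power of \<open>1 - t^2\<close>,
  times the exponential, extended by zero. The standard bump function is the case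
  \<open>P = 1\<close>, \<open>m = 0\<close>.\<close>

definition bump :: "real poly \<Rightarrow> nat \<Rightarrow> real \<Rightarrow> real" where
  "bump P m t = (if \<bar>t\<bar> < 1 then poly P t / (1 - t\<^sup>2) ^ m * exp (- 1 / (1 - t\<^sup>2)) else 0)"

text \<open>A single term of the exponential series at \<open>1 / w\<close> already gives the
  bound.\<close>

lemma exp_minus_inverse_le:
  fixes w :: real
  assumes "0 < w"
  shows "exp (- 1 / w) \<le> fact k * w ^ k"
proof -
  have "(1 / w) ^ k / fact k \<le> exp (1 / w)"
  proof -
    have "(\<Sum>n\<in>{k}. (1 / w) ^ n / fact n) \<le> (\<Sum>n. (1 / w) ^ n / fact n)"
      using assms
      using exp_converges[of "1 / w"] by (intro sum_le_suminf)
        (auto simp: divide_inverse mult.commute sums_iff)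
    then show ?thesis
      by (simp add: exp_def divide_inverse mult.commute)
  qed
  then have "1 / w ^ k \<le> exp (1 / w) * fact k"
    by (simp add: power_one_over pos_divide_le_eq del: divide_divide_eq_left)
  then have "1 \<le> exp (1 / w) * fact k * w ^ k"
    using assms by (simp add: pos_divide_le_eq)
  then have "exp (- (1 / w)) * 1 \<le> exp (- (1 / w)) * (exp (1 / w) * fact k * w ^ k)"
    by (intro mult_left_mono) auto
  then show ?thesis
    by (simp add: exp_minus_inverse mult.assoc[symmetric] mult_exp_exp)
qed

text \<open>Quadratic flatness at the gluing points 1 and -1, which makes the derivative exist there
  and vanish. The exponential is estimated with exponent \<open>m + 2\<close> so that two powers of
  \<open>w\<close> survive the division by \<open>w ^ m\<close>.\<close>

lemma bump_le_square:
  assumes "\<bar>t\<bar> = 1"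
  shows "\<exists>C. \<forall>s. \<bar>bump P m s\<bar> \<le> C * (s - t)\<^sup>2"
proof -
  have "bounded (poly P ` {-1..1})"
    by (intro compact_imp_bounded compact_continuous_image continuous_on_poly continuous_on_id) auto
  then obtain B where "\<forall>y\<in>poly P ` {-1..1}. norm y \<le> B"
    unfolding bounded_iff by blast
  then have B: "\<bar>poly P s\<bar> \<le> B" if "s \<in> {-1..1}" for s
    using that by simp
  have B0: "0 \<le> B" using B[of 0] by auto
  have "\<bar>bump P m s\<bar> \<le> (B * fact (m + 2) * 4) * (s - t)\<^sup>2" for s
  proof (cases "\<bar>s\<bar> < 1")
    case True
    define w where "w = 1 - s\<^sup>2"
    have w: "0 < w" "w = (1 - \<bar>s\<bar>) * (1 + \<bar>s\<bar>)"
      using True by (auto simp: w_def abs_square_less_1, simp add: algebra_simps power2_eq_square)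
    \<comment> \<open>The factor \<open>1 - \<bar>s\<bar>\<close> is at most
      \<open>\<bar>s - t\<bar>\<close> because \<open>\<bar>t\<bar> = 1\<close>, and the other
      factor is at most 2.\<close>
    have "w \<le> \<bar>s - t\<bar> * 2"
      unfolding w(2) using True assms by (intro mult_mono) auto
    then have w2: "w\<^sup>2 \<le> (\<bar>s - t\<bar> * 2)\<^sup>2"
      using w by (intro power_mono) auto
    have "\<bar>bump P m s\<bar> = \<bar>poly P s\<bar> / w ^ m * exp (- 1 / w)"
      using True w by (simp add: bump_def w_def abs_mult)
    also have "\<dots> \<le> B / w ^ m * (fact (m + 2) * w ^ (m + 2))"
      using w(1) B[of s] B0 True by (intro mult_mono divide_right_mono exp_minus_inverse_le) (auto simp: abs_less_iff)
    also have "\<dots> = B * fact (m + 2) * w\<^sup>2"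
      using w(1) by (simp add: power_add power2_eq_square)
    also have "\<dots> \<le> B * fact (m + 2) * (\<bar>s - t\<bar> * 2)\<^sup>2"
      using w2 B0 by (intro mult_left_mono) auto
    finally show ?thesis by (simp add: power_mult_distrib)
  qed (use B0 in \<open>auto simp: bump_def\<close>)
  then show ?thesis by blast
qed

text \<open>Differentiating \<open>w ^ m\<close> in the denominator costs one power of
  \<open>w = 1 - t^2\<close>, differentiating the exponent \<open>- 1 / w\<close> costs two; over
  the common denominator \<open>w ^ (m + 2)\<close> the numerator is again a polynomial.\<close>

lemma bump_DERIV:
  "(bump P m has_real_derivative
      bump (pderiv P * [:1, 0, -1:]\<^sup>2 + [:0, 2 * real m:] * P * [:1, 0, -1:] - [:0, 2:] * P) (m + 2) t) (at t)"
proof -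
  consider "\<bar>t\<bar> < 1" | "\<bar>t\<bar> > 1" | "\<bar>t\<bar> = 1" by linarith
  then show ?thesis
  proof cases
    case 1
    define w where "w = 1 - t\<^sup>2"
    have w: "w \<noteq> 0" "1 - t\<^sup>2 \<noteq> 0" using 1 by (auto simp: w_def abs_square_eq_1)
    have "((\<lambda>t. poly P t / (1 - t\<^sup>2) ^ m * exp (- 1 / (1 - t\<^sup>2))) has_real_derivative
      ((poly (pderiv P) t * w ^ m - poly P t * (real m * w ^ (m - 1) * (- 2 * t))) / (w ^ m * w ^ m)
         * exp (- 1 / w) + poly P t / w ^ m * (exp (- 1 / w) * (- 2 * t / (w * w))))) (at t)"
    proof -
      have 1: "((\<lambda>t. 1 - t\<^sup>2) has_real_derivative - 2 * t) (at t)"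
        by (auto intro!: derivative_eq_intros)
      have 2: "((\<lambda>t. (1 - t\<^sup>2) ^ m) has_real_derivative real m * w ^ (m - 1) * (- 2 * t)) (at t)"
        unfolding w_def by (rule DERIV_cong[OF DERIV_power[OF 1]]) simp
      have 3: "((\<lambda>t. - 1 / (1 - t\<^sup>2)) has_real_derivative - 2 * t / (w * w)) (at t)"
        using DERIV_divide[OF DERIV_const[of "- 1"] 1 w(2)] by (simp add: w_def)
      have 4: "((\<lambda>t. exp (- 1 / (1 - t\<^sup>2))) has_real_derivative exp (- 1 / w) * (- 2 * t / (w * w))) (at t)"
        unfolding w_def using DERIV_chain2[OF DERIV_exp 3] by (simp add: w_def)
      have 5: "((\<lambda>t. poly P t / (1 - t\<^sup>2) ^ m) has_real_derivative
          (poly (pderiv P) t * w ^ m - poly P t * (real m * w ^ (m - 1) * (- 2 * t))) / (w ^ m * w ^ m)) (at t)"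
        using DERIV_divide[OF poly_DERIV 2, of P] w(2) by (simp add: w_def)
      show ?thesis
        by (rule DERIV_cong[OF DERIV_mult[OF 5 4]]) (simp add: w_def mult_ac)
    qed
    also have "(poly (pderiv P) t * w ^ m - poly P t * (real m * w ^ (m - 1) * (- 2 * t))) / (w ^ m * w ^ m)
         * exp (- 1 / w) + poly P t / w ^ m * (exp (- 1 / w) * (- 2 * t / (w * w)))
      = (poly (pderiv P) t * w\<^sup>2 + 2 * real m * t * poly P t * w - 2 * t * poly P t) / w ^ (m + 2)
         * exp (- 1 / w)"
    proof -
      \<comment> \<open>The relation \<open>real m = V * w / W\<close> remains valid for
        \<open>m = 0\<close>, where \<open>m - 1\<close> is truncated, so no case distinction is
        left in the identity.\<close>
      define V W where "V = real m * w ^ (m - 1)" and "W = w ^ m"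
      have W: "W \<noteq> 0" "real m = V * w / W"
        using w power_minus_mult[of m w] by (cases "m = 0"; simp add: V_def W_def mult.assoc)+
      have "(poly (pderiv P) t * W - poly P t * (V * (- 2 * t))) / (W * W) * E
          + poly P t / W * (E * (- 2 * t / (w * w)))
        = (poly (pderiv P) t * (w * w) + 2 * (V * w / W) * t * poly P t * w - 2 * t * poly P t) / (W * (w * w)) * E" for E
        using w(1) W(1) by (simp add: divide_simps) (simp add: algebra_simps)
      then show ?thesis
        unfolding power_add power2_eq_square W(2)[symmetric] by (simp add: V_def W_def mult.assoc)
    qed
    also have "\<dots> = bump (pderiv P * [:1, 0, -1:]\<^sup>2 + [:0, 2 * real m:] * P * [:1, 0, -1:] - [:0, 2:] * P) (m + 2) t"
    proof -
      have "poly ([:1, 0, -1:] :: real poly) t = w"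
        by (simp add: w_def power2_eq_square)
      moreover have "poly [:0, 2 * real m:] t = 2 * real m * t" "poly [:0, 2:] t = 2 * t"
        by simp_all
      ultimately have "poly (pderiv P * [:1, 0, -1:]\<^sup>2 + [:0, 2 * real m:] * P * [:1, 0, -1:] - [:0, 2:] * P) t
        = poly (pderiv P) t * w\<^sup>2 + 2 * real m * t * poly P t * w - 2 * t * poly P t"
        unfolding poly_add poly_mult poly_diff poly_power by simp
      then show ?thesis
        using 1 unfolding bump_def w_def by simp
    qed
    finally show ?thesis
      by (rule has_field_derivative_transform_within_open[where S = "{-1<..<1}"]) (use 1 in \<open>auto simp: bump_def\<close>)
  next
    case 2
    have "((\<lambda>_. 0 :: real) has_real_derivative 0) (at t)" by simp
    then have "(bump P m has_real_derivative 0) (at t)"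
      by (rule has_field_derivative_transform_within_open[where S = "- {-1..1}"])
         (use 2 in \<open>auto simp: bump_def\<close>)
    then show ?thesis using 2 by (simp add: bump_def)
  next
    case 3
    then obtain C where C: "\<And>s. \<bar>bump P m s\<bar> \<le> C * (s - t)\<^sup>2"
      using bump_le_square by blast
    have "((\<lambda>s. (bump P m s - bump P m t) / (s - t)) \<longlongrightarrow> 0) (at t)"
    proof (rule Lim_null_comparison)
      show "\<forall>\<^sub>F s in at t. norm ((bump P m s - bump P m t) / (s - t)) \<le> C * \<bar>s - t\<bar>"
        using eventually_neq_at_within[of t t UNIV]
      proof eventually_elim
        case (elim s)
        then have "\<bar>bump P m s\<bar> / \<bar>s - t\<bar> \<le> C * (s - t)\<^sup>2 / \<bar>s - t\<bar>"
          by (intro divide_right_mono C) auto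
        also have "\<dots> = C * \<bar>s - t\<bar>"
          using elim by (simp add: field_simps power2_eq_square flip: abs_mult)
        finally show ?case using 3 by (simp add: bump_def)
      qed
      show "((\<lambda>s. C * \<bar>s - t\<bar>) \<longlongrightarrow> 0) (at t)"
        by (auto intro!: tendsto_eq_intros)
    qed
    then show ?thesis using 3
      by (simp add: has_field_derivative_iff bump_def)
  qed
qed

lemma smooth_bump_exists:
  obtains G :: "nat \<Rightarrow> real \<Rightarrow> real" and c where
    "\<And>k t. (G k has_real_derivative G (Suc k) t) (at t)" "\<And>k t. 1 \<le> \<bar>t\<bar> \<Longrightarrow> G k t = 0"
    "\<And>t. 0 \<le> G 0 t" "0 < c" "\<And>t. \<bar>t\<bar> \<le> 1/2 \<Longrightarrow> c \<le> G 0 t"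
proof -
  \<comment> \<open>\<open>st\<close> is the update of numerator and exponent in
    \<open>bump_DERIV\<close>; iterating it from \<open>(1, 0)\<close> enumerates the derivatives of
    the standard bump.\<close>
  define st where "st = (\<lambda>(P, m). (pderiv P * [:1, 0, -1:]\<^sup>2 +
      [:0, 2 * real m:] * P * [:1, 0, -1:] - [:0, 2:] * P, m + 2 :: nat))"
  define G where "G k = (\<lambda>(P, m). bump P m) ((st ^^ k) (1, 0))" for k
  show ?thesis
  proof
    show "(G k has_real_derivative G (Suc k) t) (at t)" for k t
    proof -
      obtain P m where "(st ^^ k) (1, 0) = (P, m)" by fastforce
      then show ?thesis
        using bump_DERIV[of P m t] by (simp add: G_def st_def)
    qed
    show "G k t = 0" if "1 \<le> \<bar>t\<bar>" for k t
      using that by (auto simp: G_def bump_def split: prod.split)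
    show "0 \<le> G 0 t" for t
      by (simp add: G_def bump_def)
    \<comment> \<open>For \<open>\<bar>t\<bar> \<le> 1/2\<close> one has
      \<open>1 - t^2 \<ge> 3/4\<close>, whence this lower bound.\<close>
    show "0 < exp (- 1 / (3/4 :: real))" by simp
    show "exp (- 1 / (3/4)) \<le> G 0 t" if "\<bar>t\<bar> \<le> 1/2" for t :: real
    proof -
      have "t\<^sup>2 \<le> 1/4" using power_mono[OF that, of 2] by (simp add: power2_eq_square)
      then have "- 1 / (3/4) \<le> - 1 / (1 - t\<^sup>2)" by (simp add: field_simps)
      then show ?thesis using that by (simp add: G_def bump_def)
    qed
  qed
qed

subsection \<open>Differentiation under the integral sign\<close>

lemma DERIV_bound_segment:
  fixes w :: "real \<Rightarrow> real"
  assumes "\<And>t. (w has_real_derivative w' t) (at t)" and "\<And>t. a \<le> t \<Longrightarrow> t \<le> b \<Longrightarrow> \<bar>w' t\<bar> \<le> D"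
    and "s \<in> {a..b}" "t \<in> {a..b}"
  shows "\<bar>w t - w s\<bar> \<le> D * \<bar>t - s\<bar>"
proof -
  have "norm (w t - w s) \<le> D * norm (t - s)"
    by (rule field_differentiable_bound[of "{a..b}" w w'])
       (use assms in \<open>auto intro: DERIV_subset\<close>)
  then show ?thesis by simp
qed

text \<open>Dominated convergence for the difference quotients: the mean value theorem turns the
  bound on the derivative near \<open>t0\<close> into a bound on the quotients.\<close>

lemma DERIV_under_integral:
  fixes \<Phi> :: "real \<Rightarrow> 'a \<Rightarrow> real"
  assumes int: "\<And>t. integrable M (\<Phi> t)" and g: "integrable M g"
    and der: "\<And>t x. x \<in> space M \<Longrightarrow> ((\<lambda>t. \<Phi> t x) has_real_derivative \<Phi>' t x) (at t)"
    and bd: "\<And>t x. x \<in> space M \<Longrightarrow> \<bar>t - t0\<bar> \<le> 1 \<Longrightarrow> \<bar>\<Phi>' t x\<bar> \<le> g x"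
    and meas: "\<Phi>' t0 \<in> borel_measurable M"
  shows "((\<lambda>t. LINT x|M. \<Phi> t x) has_real_derivative (LINT x|M. \<Phi>' t0 x)) (at t0)"
proof -
  define q where "q t x = (\<Phi> t x - \<Phi> t0 x) / (t - t0)" for t x
  have "((\<lambda>t. LINT x|M. q t x) \<longlongrightarrow> (LINT x|M. \<Phi>' t0 x)) (at t0)"
    unfolding tendsto_at_iff_sequentially
  proof safe
    fix X :: "nat \<Rightarrow> real"
    assume X: "\<forall>i. X i \<in> UNIV - {t0}" "X \<longlonglongrightarrow> t0"
    then obtain N where N: "\<And>n. n \<ge> N \<Longrightarrow> dist (X n) t0 < 1"
      by (meson lim_sequentially zero_less_one)
    \<comment> \<open>Only a tail of the sequence stays within distance 1 of \<open>t0\<close>,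
      where the domination holds; hence the shift by \<open>N\<close>.\<close>
    have "(\<lambda>n. LINT x|M. q (X (n + N)) x) \<longlonglongrightarrow> (LINT x|M. \<Phi>' t0 x)"
    proof (rule integral_dominated_convergence)
      show "AE x in M. (\<lambda>n. q (X (n + N)) x) \<longlonglongrightarrow> \<Phi>' t0 x"
      proof (rule AE_I2)
        fix x assume "x \<in> space M"
        then have "((\<lambda>t. q t x) \<longlongrightarrow> \<Phi>' t0 x) (at t0)"
          using der[of x t0] unfolding q_def has_field_derivative_iff by simp
        then show "(\<lambda>n. q (X (n + N)) x) \<longlonglongrightarrow> \<Phi>' t0 x"
          using X LIMSEQ_ignore_initial_segment[of X t0 N]
          unfolding tendsto_at_iff_sequentially comp_def
          by (auto dest!: spec[of _ "\<lambda>n. X (n + N)"])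
      qed
      show "AE x in M. norm (q (X (n + N)) x) \<le> g x" for n
      proof (rule AE_I2)
        fix x assume x: "x \<in> space M"
        define s where "s = X (n + N)"
        have s: "s \<noteq> t0" "\<bar>s - t0\<bar> \<le> 1"
          using X(1) N[of "n + N"] by (auto simp: s_def dist_real_def)
        have "\<bar>\<Phi> s x - \<Phi> t0 x\<bar> \<le> g x * \<bar>s - t0\<bar>"
          by (rule DERIV_bound_segment[of _ "\<lambda>t. \<Phi>' t x" "t0 - 1" "t0 + 1"])
             (use der[OF x] bd[OF x] s in \<open>auto simp: abs_le_iff\<close>)
        then show "norm (q (X (n + N)) x) \<le> g x"
          using s by (simp add: q_def pos_divide_le_eq flip: s_def)
      qed
      show "(\<lambda>x. q (X (n + N)) x) \<in> borel_measurable M" for n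
        unfolding q_def using borel_measurable_integrable[OF int] by measurable
    qed (use meas g in auto)
    then show "((\<lambda>t. LINT x|M. q t x) \<circ> X) \<longlonglongrightarrow> (LINT x|M. \<Phi>' t0 x)"
      unfolding comp_def by (rule LIMSEQ_offset)
  qed
  moreover have "(LINT x|M. q t x) = ((LINT x|M. \<Phi> t x) - (LINT x|M. \<Phi> t0 x)) / (t - t0)" for t
    unfolding q_def using int by simp
  ultimately show ?thesis
    unfolding has_field_derivative_iff by simp
qed

lemma continuous_imp_measurable_lebesgue_on:
  fixes f :: "real^'n::finite \<Rightarrow> real"
  assumes "continuous_on UNIV f"
  shows "f \<in> borel_measurable (lebesgue_on \<Omega>)"
  by (intro measurable_restrict_space1 measurable_completion)
     (simp add: borel_measurable_continuous_onI assms)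

lemma integrable_continuous_bounded_domain:
  fixes f :: "real^'n::finite \<Rightarrow> real"
  assumes "continuous_on UNIV f" "bounded \<Omega>" "\<Omega> \<in> sets lebesgue"
  shows "integrable (lebesgue_on \<Omega>) f"
proof -
  have "bounded (f ` closure \<Omega>)"
    using assms by (intro compact_imp_bounded compact_continuous_image)
      (auto intro: continuous_on_subset simp: compact_closure)
  then obtain B where B: "\<forall>y\<in>f ` closure \<Omega>. norm y \<le> B"
    unfolding bounded_iff by blast
  have "finite_measure (lebesgue_on \<Omega>)"
    by (intro finite_measure_lebesgue_on bounded_set_imp_lmeasurable assms)
  then show ?thesis
    by (intro finite_measure.integrable_const_bound[of _ _ B])
       (use B closure_subset[of \<Omega>] continuous_imp_measurable_lebesgue_on[OF assms(1)]
         in \<open>auto simp: space_restrict_space intro!: AE_I2\<close>)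
qed

lemma indicator_integrable:
  fixes f :: "real^'n::finite \<Rightarrow> real"
  assumes "integrable (lebesgue_on \<Omega>) f" "E \<in> sets lebesgue"
  shows "integrable (lebesgue_on \<Omega>) (\<lambda>x. indicator E x * f x)"
proof (rule Bochner_Integration.integrable_bound[OF assms(1)])
  have "indicator E \<in> borel_measurable (lebesgue_on \<Omega>)"
    using assms by (intro measurable_restrict_space1) auto
  then show "(\<lambda>x. indicator E x * f x) \<in> borel_measurable (lebesgue_on \<Omega>)"
    using assms(1) by (intro borel_measurable_times) auto
qed (auto simp: indicator_def)

lemma lborel_integral_translate:
  fixes f :: "real^'n::finite \<Rightarrow> real"
  assumes "f \<in> borel_measurable borel"
  shows "(LINT x|lborel. f (x + a)) = (LINT x|lborel. f x)"
proof -
  have "(LINT x|lborel. f x) = (LINT x|distr lborel borel ((+) a). f x)"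
    using lborel_distr_plus[of a] by (metis)
  also have "\<dots> = (LINT x|lborel. f (a + x))"
    using assms by (intro integral_distr) auto
  finally show ?thesis by (simp add: add.commute)
qed

text \<open>By translation invariance the integral of \<open>H (x + t *\<^sub>R d)\<close> does not
  depend on \<open>t\<close>; differentiating it at 0 under the integral sign gives the claim,
  without Fubini or boundary terms.\<close>

lemma integral_derivative_compact_support:
  fixes H :: "real^'n::finite \<Rightarrow> real"
  assumes H: "continuous_on UNIV H" "\<And>x. x \<notin> cball z R \<Longrightarrow> H x = 0"
    and H': "continuous_on UNIV H'" "\<And>x. x \<notin> cball z R \<Longrightarrow> H' x = 0"
    and der: "\<And>x t. ((\<lambda>t. H (x + t *\<^sub>R d)) has_real_derivative H' (x + t *\<^sub>R d)) (at t)"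
  shows "(LINT x|lborel. H' x) = 0"
proof -
  have bdd: "\<exists>B\<ge>0. \<forall>x. \<bar>f x\<bar> \<le> B * indicator (cball z R) x" 
    if "continuous_on UNIV f" "\<And>x. x \<notin> cball z R \<Longrightarrow> f x = 0" for f :: "real^'n \<Rightarrow> real"
  proof -
    have "bounded (f ` cball z R)"
      using that by (intro compact_imp_bounded compact_continuous_image) (auto intro: continuous_on_subset)
    then obtain B where "\<forall>y\<in>f ` cball z R. norm y \<le> B"
      unfolding bounded_iff by blast
    then show ?thesis
      using that(2) by (intro exI[of _ "max B 0"]) (auto simp: indicator_def le_max_iff_disj)
  qed
  obtain B where B: "\<And>x. \<bar>H x\<bar> \<le> B * indicator (cball z R) x"
    using bdd[OF H] by blast
  obtain B' where B'0: "0 \<le> B'" and B': "\<And>x. \<bar>H' x\<bar> \<le> B' * indicator (cball z R) x"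
    using bdd[OF H'] by blast
  have meas: "H \<in> borel_measurable borel" "H' \<in> borel_measurable borel"
    using H H' by (auto intro: borel_measurable_continuous_onI)
  have cball: "integrable lborel (indicator (cball z R) :: _ \<Rightarrow> real)" for z :: "real^'n" and R
    by (intro integrable_real_indicator) (use emeasure_bounded_finite[OF bounded_cball, of z R] in simp_all)
  have "((\<lambda>t. LINT x|lborel. H (x + t *\<^sub>R d)) has_real_derivative (LINT x|lborel. H' (x + 0 *\<^sub>R d))) (at 0)"
  \<comment> \<open>For \<open>\<bar>t\<bar> \<le> 1\<close> the translated supports all lie in the
    ball enlarged by \<open>norm d\<close>, so one integrable function dominates.\<close>
  proof (rule DERIV_under_integral[where g = "\<lambda>x. B' * indicator (cball z (R + norm d)) x"])
    fix t :: real
    have "integrable lborel (\<lambda>x. B * indicator (cball (z - t *\<^sub>R d) R) x :: real)"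
      by (intro integrable_mult_right cball)
    then show "integrable lborel (\<lambda>x. H (x + t *\<^sub>R d))"
    proof (rule Bochner_Integration.integrable_bound)
      show "AE x in lborel. norm (H (x + t *\<^sub>R d)) \<le> norm (B * indicator (cball (z - t *\<^sub>R d) R) x)"
      proof (rule AE_I2)
        fix x
        have "x + t *\<^sub>R d \<in> cball z R \<longleftrightarrow> x \<in> cball (z - t *\<^sub>R d) R"
          by (simp add: dist_norm algebra_simps)
        then have "(indicator (cball z R) (x + t *\<^sub>R d) :: real) = indicator (cball (z - t *\<^sub>R d) R) x"
          by (simp add: indicator_def)
        then show "norm (H (x + t *\<^sub>R d)) \<le> norm (B * indicator (cball (z - t *\<^sub>R d) R) x)"
          using B[of "x + t *\<^sub>R d"] by simp
      qed
    qed (use meas in measurable)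
  next
    show "integrable lborel (\<lambda>x. B' * indicator (cball z (R + norm d)) x)"
      by (intro integrable_mult_right cball)
  next
    fix t :: real and x :: "real^'n"
    assume t: "\<bar>t - 0\<bar> \<le> 1"
    have "norm (t *\<^sub>R d) \<le> norm d"
      using t by (simp add: mult_left_le_one_le)
    then have "indicator (cball z R) (x + t *\<^sub>R d) \<le> (indicator (cball z (R + norm d)) x :: real)"
      using norm_triangle_ineq4[of "z - x" "t *\<^sub>R d"] norm_triangle_ineq[of "z - (x + t *\<^sub>R d)" "t *\<^sub>R d"]
      by (auto simp: indicator_def dist_norm)
    with B'0 show "\<bar>H' (x + t *\<^sub>R d)\<bar> \<le> B' * indicator (cball z (R + norm d)) x"
      using B'[of "x + t *\<^sub>R d"]
      by (cases "x + t *\<^sub>R d \<in> cball z R") (auto simp: indicator_def split: if_splits)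
  qed (use der meas in auto)
  moreover have "(\<lambda>t. LINT x|lborel. H (x + t *\<^sub>R d)) = (\<lambda>t. LINT x|lborel. H x)"
    using lborel_integral_translate[OF meas(1)] by auto
  ultimately have "((\<lambda>t. LINT x|lborel. H x) has_real_derivative (LINT x|lborel. H' x)) (at (0 :: real))"
    by simp
  then show ?thesis
    using DERIV_const DERIV_unique by blast
qed

subsection \<open>Moments against a scaled bump function\<close>

text \<open>A smooth bump with all its derivatives, supported in the unit cube and at least
  \<open>c0\<close> on the concentric cube of half the size; \<open>M N\<close> bounds all
  derivatives up to order \<open>N\<close> together. One instance is fixed for all meshes, which
  keeps the constants independent of them.\<close>

locale bump_kernel =
  fixes \<Theta> :: "'n::finite multi_index \<Rightarrow> real^'n \<Rightarrow> real" and c0 :: real and M :: "nat \<Rightarrow> real"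
  assumes \<Theta>: "deriv_family \<Theta>"
    and \<Theta>_zero: "\<And>\<gamma> x i. 1 \<le> \<bar>x $ i\<bar> \<Longrightarrow> \<Theta> \<gamma> x = 0"
    and \<Theta>_nonneg: "\<And>x. 0 \<le> \<Theta> (\<lambda>_. 0) x"
    and c0: "0 < c0" "\<And>x. (\<And>i. \<bar>x $ i\<bar> \<le> 1/2) \<Longrightarrow> c0 \<le> \<Theta> (\<lambda>_. 0) x"
    and M: "\<And>\<gamma> x N. mi_order \<gamma> \<le> N \<Longrightarrow> \<bar>\<Theta> \<gamma> x\<bar> \<le> M N"

lemma bump_kernel_exists: "\<exists>\<Theta> c0 M. bump_kernel (\<Theta> :: 'n::finite multi_index \<Rightarrow> real^'n \<Rightarrow> real) c0 M"
proof -
  obtain G c where G: "\<And>k t. (G k has_real_derivative G (Suc k) t) (at t)"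
    "\<And>k t. 1 \<le> \<bar>t\<bar> \<Longrightarrow> G k t = 0"
    "\<And>t. 0 \<le> G 0 t" and c: "0 < c" "\<And>t. \<bar>t\<bar> \<le> 1/2 \<Longrightarrow> c \<le> G 0 t"
    by (rule smooth_bump_exists) blast
  define \<Theta> where "\<Theta> = (\<lambda>(\<alpha> :: 'n multi_index) x. \<Prod>i\<in>UNIV. G (\<alpha> i) (x $ i :: real))"
  have \<Theta>: "deriv_family \<Theta>"
    unfolding \<Theta>_def by (rule deriv_family_prod[of "\<lambda>_. G"]) (rule G)
  have zero: "\<Theta> \<gamma> x = 0" if "1 \<le> \<bar>x $ i\<bar>" for \<gamma> x i
    unfolding \<Theta>_def using G(2)[OF that] by (intro prod_zero) auto
  have "\<exists>B. \<forall>x. \<bar>\<Theta> \<gamma> x\<bar> \<le> B" for \<gamma>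
  proof -
    have "bounded (\<Theta> \<gamma> ` cbox (\<chi> i. - 1) (\<chi> i. 1))"
      by (intro compact_imp_bounded compact_continuous_image deriv_family_continuous \<Theta> compact_cbox)
    then obtain B where B: "\<forall>y\<in>\<Theta> \<gamma> ` cbox (\<chi> i. - 1) (\<chi> i. 1). norm y \<le> B"
      unfolding bounded_iff by blast
    have "\<bar>\<Theta> \<gamma> x\<bar> \<le> max B 0" for x
    proof (cases "x \<in> cbox (\<chi> i. - 1) (\<chi> i. 1)")
      case True
      then show ?thesis using B by fastforce
    next
      case False
      then obtain i where "1 \<le> \<bar>x $ i\<bar>"
        by (auto simp: mem_box_cart) (meson abs_ge_minus_self abs_ge_self linorder_le_cases order_trans minus_le_iff)+
      then show ?thesis using zero by simp
    qed
    then show ?thesis by blast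
  qed
  then obtain B where B: "\<And>\<gamma> x. \<bar>\<Theta> \<gamma> x\<bar> \<le> B \<gamma>" by metis
  have B0: "0 \<le> B \<gamma>" for \<gamma> using B[of \<gamma> 0] by linarith
  have "bump_kernel \<Theta> (c ^ CARD('n)) (\<lambda>N. \<Sum>\<gamma> | mi_order \<gamma> \<le> N. B \<gamma>)"
  proof
    show "0 \<le> \<Theta> (\<lambda>_. 0) x" for x
      unfolding \<Theta>_def by (intro prod_nonneg) (auto simp: G)
    show "c ^ CARD('n) \<le> \<Theta> (\<lambda>_. 0) x" if "\<And>i. \<bar>x $ i\<bar> \<le> 1/2" for x
      using prod_mono[of UNIV "\<lambda>_. c" "\<lambda>i. G 0 (x $ i)"] c that
      by (auto simp: \<Theta>_def less_imp_le)
    show "\<bar>\<Theta> \<gamma> x\<bar> \<le> (\<Sum>\<gamma> | mi_order \<gamma> \<le> N. B \<gamma>)" if "mi_order \<gamma> \<le> N" for \<gamma> x N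
      using member_le_sum[of \<gamma> "{\<gamma>. mi_order \<gamma> \<le> N}" B] B[of \<gamma> x] B0 that finite_mi_order_le
      by force
  qed (use \<Theta> zero c in auto)
  then show ?thesis by blast
qed

context bump_kernel
begin

text \<open>The \<gamma>-th derivative of the bump rescaled to width \<open>r\<close> about
  \<open>z\<close>. It is not normalized, so its mass is of order \<open>r ^ CARD('n)\<close>;
  dividing by this mass produces the factor h^-n of the final bound.\<close>

definition ker :: "real \<Rightarrow> real^'n \<Rightarrow> 'n multi_index \<Rightarrow> real^'n \<Rightarrow> real" where
  "ker r z \<gamma> x = \<Theta> \<gamma> ((1 / r) *\<^sub>R (x - z)) * (1 / r) ^ mi_order \<gamma>"

text \<open>Up to a sign and the normalization, the \<gamma>-th distributional derivative of
  \<open>f\<close> mollified on scale \<open>r\<close> at \<open>z\<close>. Integrating over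
  \<Omega> matches \<open>weak_derivative\<close>.\<close>

definition mom :: "(real^'n) set \<Rightarrow> (real^'n \<Rightarrow> real) \<Rightarrow> real \<Rightarrow> 'n multi_index \<Rightarrow> real^'n \<Rightarrow> real" where
  "mom \<Omega> f r \<gamma> z = (LINT x|lebesgue_on \<Omega>. f x * ker r z \<gamma> x)"

lemma ker_family: "deriv_family (ker r z)"
  using deriv_family_scale_translate[OF \<Theta>, of "1 / r" z]
  by (simp add: ker_def[abs_def])

lemma M_nonneg: "0 \<le> M N"
  using M[of "\<lambda>_. 0" N 0] by (simp add: mi_order_def)

lemma ker_bound:
  assumes "mi_order \<gamma> \<le> N" "0 < r"
  shows "\<bar>ker r z \<gamma> x\<bar> \<le> M N / r ^ mi_order \<gamma>"
  using M[OF assms(1)] assms(2)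
  by (simp add: ker_def abs_mult power_one_over divide_right_mono)

lemma ker_zero:
  assumes "0 < r" "x \<notin> cball z (real CARD('n) * r)"
  shows "ker r z \<gamma> x = 0"
proof (rule ccontr)
  assume "ker r z \<gamma> x \<noteq> 0"
  then have "\<bar>((1 / r) *\<^sub>R (x - z)) $ i\<bar> < 1" for i
    using \<Theta>_zero unfolding ker_def by (metis mult_zero_left not_le)
  then have "\<bar>(x - z) $ i\<bar> \<le> r" for i
    using assms(1) less_imp_le[of "\<bar>(x - z) $ i\<bar>" r] by (simp add: abs_mult divide_less_eq)
  \<comment> \<open>The support is a cube; the l1 norm puts it into a Euclidean ball. This is the
    origin of the radii \<open>CARD('n) * r\<close> from here on.\<close>
  then have "norm (x - z) \<le> (\<Sum>i\<in>(UNIV :: 'n set). r)"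
    by (intro order_trans[OF norm_le_l1_cart] sum_mono) auto
  then show False
    using assms(2) by (simp add: dist_norm norm_minus_commute)
qed

lemma ker_measurable: "ker r z \<gamma> \<in> borel_measurable (lebesgue_on \<Omega>)"
  by (intro continuous_imp_measurable_lebesgue_on deriv_family_continuous ker_family)

lemma integrable_ker:
  assumes "integrable (lebesgue_on \<Omega>) f" "0 < r"
  shows "integrable (lebesgue_on \<Omega>) (\<lambda>x. f x * ker r z \<gamma> x)"
proof (rule Bochner_Integration.integrable_bound)
  show "integrable (lebesgue_on \<Omega>) (\<lambda>x. f x * (M (mi_order \<gamma>) / r ^ mi_order \<gamma>))"
    using assms by simp
  show "AE x in lebesgue_on \<Omega>. norm (f x * ker r z \<gamma> x) \<le> norm (f x * (M (mi_order \<gamma>) / r ^ mi_order \<gamma>))"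
    using mult_left_mono[OF ker_bound[of \<gamma> "mi_order \<gamma>" r z], of "\<bar>f _\<bar>"] assms M_nonneg
    by (intro AE_I2) (auto simp: abs_mult)
qed (use assms ker_measurable in measurable)

text \<open>The set \<open>B\<close> is left free so that the same estimate serves the balls inside
  one element as well as the large ball across the face.\<close>

lemma mom_bound:
  assumes f: "integrable (lebesgue_on \<Omega>) f" and r: "0 < r" and \<gamma>: "mi_order \<gamma> \<le> N"
    and B: "B \<in> sets lebesgue" "cball z (real CARD('n) * r) \<subseteq> B"
  shows "\<bar>mom \<Omega> f r \<gamma> z\<bar> \<le> M N / r ^ mi_order \<gamma> * (LINT x|lebesgue_on \<Omega>. indicator B x * \<bar>f x\<bar>)"
proof -
  have int: "integrable (lebesgue_on \<Omega>) (\<lambda>x. indicator B x * \<bar>f x\<bar>)"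
    by (intro indicator_integrable integrable_abs f B)
  have "\<bar>mom \<Omega> f r \<gamma> z\<bar> \<le> (LINT x|lebesgue_on \<Omega>. \<bar>f x * ker r z \<gamma> x\<bar>)"
    unfolding mom_def by (rule integral_abs_bound)
  also have "\<dots> \<le> (LINT x|lebesgue_on \<Omega>. M N / r ^ mi_order \<gamma> * (indicator B x * \<bar>f x\<bar>))"
  proof (rule integral_mono)
    show "\<bar>f x * ker r z \<gamma> x\<bar> \<le> M N / r ^ mi_order \<gamma> * (indicator B x * \<bar>f x\<bar>)" for x
    proof (cases "x \<in> B")
      case True
      then show ?thesis
        using mult_right_mono[OF ker_bound[OF \<gamma> r, of z x], of "\<bar>f x\<bar>"]
        by (simp add: abs_mult mult.commute)
    next
      case False
      then show ?thesis
        using ker_zero[OF r, of x z \<gamma>] B(2) by (metis subsetD abs_zero indicator_simps(2) mult_zero_left mult_zero_right order_refl)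
    qed
  qed (use int integrable_ker[OF f r] in auto)
  also have "\<dots> = M N / r ^ mi_order \<gamma> * (LINT x|lebesgue_on \<Omega>. indicator B x * \<bar>f x\<bar>)"
    by (rule integral_mult_right_zero)
  finally show ?thesis .
qed

lemma mom_diff:
  assumes "integrable (lebesgue_on \<Omega>) f" "integrable (lebesgue_on \<Omega>) g" "0 < r"
  shows "mom \<Omega> (\<lambda>x. f x - g x) r \<gamma> z = mom \<Omega> f r \<gamma> z - mom \<Omega> g r \<gamma> z"
  unfolding mom_def using integrable_ker[OF assms(1,3)] integrable_ker[OF assms(2,3)]
  by (simp add: left_diff_distrib)

text \<open>Moving the centre by a vector moves the argument of the kernel by its opposite. Hence,
  as functions of the centre, the moments behave like a \<open>deriv_family\<close> with reversed
  sign.\<close>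

lemma mom_DERIV:
  assumes f: "integrable (lebesgue_on \<Omega>) f" and r: "0 < r"
  shows "((\<lambda>t. mom \<Omega> f r \<gamma> (z + t *\<^sub>R d)) has_real_derivative
      - (\<Sum>i\<in>UNIV. d $ i * mom \<Omega> f r (\<gamma>(i := Suc (\<gamma> i))) (z + t *\<^sub>R d))) (at t)"
proof -
  let ?g = "\<lambda>x. \<bar>f x\<bar> * (\<Sum>i\<in>UNIV. \<bar>d $ i\<bar> * (M (Suc (mi_order \<gamma>)) / r ^ Suc (mi_order \<gamma>)))"
  have ker_shift: "ker r (z + t *\<^sub>R d) \<alpha> x = ker r z \<alpha> (x + t *\<^sub>R (- d))" for t \<alpha> x
    by (simp add: ker_def algebra_simps)
  have "((\<lambda>t. LINT x|lebesgue_on \<Omega>. f x * ker r (z + t *\<^sub>R d) \<gamma> x) has_real_derivative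
     (LINT x|lebesgue_on \<Omega>. f x * (\<Sum>i\<in>UNIV. (- d) $ i * ker r (z + t *\<^sub>R d) (\<gamma>(i := Suc (\<gamma> i))) x))) (at t)"
  proof (rule DERIV_under_integral[where g = ?g])
    show "((\<lambda>t. f x * ker r (z + t *\<^sub>R d) \<gamma> x) has_real_derivative
        f x * (\<Sum>i\<in>UNIV. (- d) $ i * ker r (z + t *\<^sub>R d) (\<gamma>(i := Suc (\<gamma> i))) x)) (at t)" for t x
      unfolding ker_shift by (rule DERIV_cmult[OF deriv_family_line[OF ker_family]])
    show "\<bar>f x * (\<Sum>i\<in>UNIV. (- d) $ i * ker r (z + t *\<^sub>R d) (\<gamma>(i := Suc (\<gamma> i))) x)\<bar> \<le> ?g x" for t x
      unfolding abs_mult[of "f x"]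
    proof (intro mult_left_mono order_trans[OF sum_abs] sum_mono)
      fix i
      have "\<bar>ker r (z + t *\<^sub>R d) (\<gamma>(i := Suc (\<gamma> i))) x\<bar> \<le> M (Suc (mi_order \<gamma>)) / r ^ Suc (mi_order \<gamma>)"
        using ker_bound[of "\<gamma>(i := Suc (\<gamma> i))" "Suc (mi_order \<gamma>)" r] r by simp
      then show "\<bar>(- d) $ i * ker r (z + t *\<^sub>R d) (\<gamma>(i := Suc (\<gamma> i))) x\<bar>
          \<le> \<bar>d $ i\<bar> * (M (Suc (mi_order \<gamma>)) / r ^ Suc (mi_order \<gamma>))"
        unfolding abs_mult by (intro mult_mono) auto
    qed auto
    show "integrable (lebesgue_on \<Omega>) ?g"
      using f by simp
    show "(\<lambda>x. f x * (\<Sum>i\<in>UNIV. (- d) $ i * ker r (z + t *\<^sub>R d) (\<gamma>(i := Suc (\<gamma> i))) x))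
        \<in> borel_measurable (lebesgue_on \<Omega>)"
      using ker_measurable borel_measurable_integrable[OF f] by measurable
  qed (rule integrable_ker[OF f r])
  moreover have "(LINT x|lebesgue_on \<Omega>. f x * (\<Sum>i\<in>UNIV. (- d) $ i * ker r (z + t *\<^sub>R d) (\<gamma>(i := Suc (\<gamma> i))) x))
    = - (\<Sum>i\<in>UNIV. d $ i * mom \<Omega> f r (\<gamma>(i := Suc (\<gamma> i))) (z + t *\<^sub>R d))"
  proof -
    have "(LINT x|lebesgue_on \<Omega>. f x * (\<Sum>i\<in>UNIV. (- d) $ i * ker r (z + t *\<^sub>R d) (\<gamma>(i := Suc (\<gamma> i))) x))
      = (LINT x|lebesgue_on \<Omega>. (\<Sum>i\<in>UNIV. (- d $ i) * (f x * ker r (z + t *\<^sub>R d) (\<gamma>(i := Suc (\<gamma> i))) x)))"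
      by (simp add: sum_distrib_left mult.left_commute)
    also have "\<dots> = (\<Sum>i\<in>UNIV. - d $ i * mom \<Omega> f r (\<gamma>(i := Suc (\<gamma> i))) (z + t *\<^sub>R d))"
      unfolding mom_def
      by (subst Bochner_Integration.integral_sum) (auto intro: integrable_ker[OF f r])
    finally show ?thesis by (simp add: sum_negf)
  qed
  ultimately show ?thesis unfolding mom_def by simp
qed

section \<open>Integration by parts against the kernel\<close>

lemma mom_eq_lborel:
  assumes "open \<Omega>" "continuous_on UNIV f" "0 < r" "cball z (real CARD('n) * r) \<subseteq> \<Omega>"
  shows "mom \<Omega> f r \<gamma> z = (LINT x|lborel. f x * ker r z \<gamma> x)"
proof -
  have cont: "continuous_on UNIV (\<lambda>x. f x * ker r z \<gamma> x)"
    by (intro continuous_intros assms deriv_family_continuous ker_family)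
  have zero: "ker r z \<gamma> x = 0" if "x \<notin> \<Omega>" for x
    using that assms(4) by (intro ker_zero[OF assms(3)]) blast
  have "mom \<Omega> f r \<gamma> z = (LINT x|lebesgue. indicator \<Omega> x *\<^sub>R (f x * ker r z \<gamma> x))"
    unfolding mom_def using assms(1) by (subst integral_restrict_space) auto
  also have "\<dots> = (LINT x|lebesgue. f x * ker r z \<gamma> x)"
    by (intro Bochner_Integration.integral_cong) (auto simp: indicator_def zero)
  also have "\<dots> = (LINT x|lborel. f x * ker r z \<gamma> x)"
    using cont by (intro integral_completion) (auto intro: borel_measurable_continuous_onI)
  finally show ?thesis .
qed

text \<open>The product of a family member with the kernel has compact support inside \<Omega>, so
  its partial derivative integrates to zero.\<close>

lemma mom_by_parts:
  assumes "open \<Omega>" "deriv_family \<Phi>" "0 < r" "cball z (real CARD('n) * r) \<subseteq> \<Omega>" "bounded \<Omega>"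
  shows "mom \<Omega> (\<Phi> \<delta>) r (\<gamma>(i := Suc (\<gamma> i))) z = - mom \<Omega> (\<Phi> (\<delta>(i := Suc (\<delta> i)))) r \<gamma> z"
proof -
  let ?d = "axis i 1 :: real^'n"
  let ?H' = "\<lambda>x. \<Phi> \<delta> x * ker r z (\<gamma>(i := Suc (\<gamma> i))) x + \<Phi> (\<delta>(i := Suc (\<delta> i))) x * ker r z \<gamma> x"
  have ax: "(\<Sum>j\<in>UNIV. axis i 1 $ j * g j) = g i" for g :: "'n \<Rightarrow> real"
    by (simp add: axis_def if_distrib[of "\<lambda>c. c * _"] cong: if_cong)
  have "(LINT x|lborel. ?H' x) = 0"
  proof (rule integral_derivative_compact_support[where H = "\<lambda>x. \<Phi> \<delta> x * ker r z \<gamma> x" and d = ?d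
        and z = z and R = "real CARD('n) * r"])
    show "((\<lambda>t. \<Phi> \<delta> (x + t *\<^sub>R ?d) * ker r z \<gamma> (x + t *\<^sub>R ?d)) has_real_derivative
            ?H' (x + t *\<^sub>R ?d)) (at t)" for x t
      by (rule DERIV_cong[OF DERIV_mult[OF deriv_family_line[OF assms(2)] deriv_family_line[OF ker_family]]])
         (simp add: ax mult.commute)
  qed (auto intro!: continuous_on_add continuous_on_mult deriv_family_continuous[OF assms(2)]
      deriv_family_continuous[OF ker_family] simp: ker_zero[OF assms(3)])
  moreover have "integrable lborel (\<lambda>x. \<Phi> \<delta> x * ker r z \<gamma> x)" for \<delta> \<gamma>
  proof -
    have cont: "continuous_on UNIV (\<lambda>x. \<Phi> \<delta> x * ker r z \<gamma> x)"
      by (intro continuous_intros deriv_family_continuous assms ker_family)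
    have "integrable lborel (\<lambda>x. indicator (cball z (real CARD('n) * r)) x *\<^sub>R (\<Phi> \<delta> x * ker r z \<gamma> x))"
      by (intro borel_integrable_compact continuous_on_subset[OF cont]) auto
    then show ?thesis
      by (rule Bochner_Integration.integrable_cong[THEN iffD1, rotated 2])
         (auto simp: indicator_def ker_zero[OF assms(3)])
  qed
  ultimately show ?thesis
    using assms by (simp add: mom_eq_lborel deriv_family_continuous)
qed

text \<open>Used in two ways: moments of order above the degree annihilate a polynomial, and lower
  moments of a polynomial become averages of its derivatives.\<close>

lemma mom_deriv_family:
  assumes "open \<Omega>" "deriv_family \<Phi>" "0 < r" "cball z (real CARD('n) * r) \<subseteq> \<Omega>" "bounded \<Omega>"
  shows "mom \<Omega> (\<Phi> \<delta>) r \<gamma> z = (- 1) ^ mi_order \<gamma> * mom \<Omega> (\<Phi> (\<lambda>i. \<delta> i + \<gamma> i)) r (\<lambda>_. 0) z"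
proof (induction "mi_order \<gamma>" arbitrary: \<gamma> \<delta>)
  case 0
  then have "\<gamma> = (\<lambda>_. 0)" by (auto simp: mi_order_def)
  then show ?case by (simp add: mi_order_def)
next
  case (Suc k)
  then obtain \<beta> i where \<beta>: "\<gamma> = \<beta>(i := Suc (\<beta> i))" "mi_order \<beta> = k"
    by (metis mi_order_Suc_cases)
  have eq: "(\<lambda>j. (\<delta>(i := Suc (\<delta> i))) j + \<beta> j) = (\<lambda>j. \<delta> j + \<gamma> j)"
    by (auto simp: \<beta>)
  have "mom \<Omega> (\<Phi> \<delta>) r \<gamma> z = - mom \<Omega> (\<Phi> (\<delta>(i := Suc (\<delta> i)))) r \<beta> z"
    unfolding \<beta>(1) by (rule mom_by_parts[OF assms])
  also have "\<dots> = - ((- 1) ^ mi_order \<beta> * mom \<Omega> (\<Phi> (\<lambda>j. \<delta> j + \<gamma> j)) r (\<lambda>_. 0) z)"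
    using Suc(1)[of \<beta> "\<delta>(i := Suc (\<delta> i))"] \<beta>(2) eq by simp
  finally show ?case by (simp add: \<beta>)
qed

lemma ker_test_function:
  assumes "0 < r" "cball z (real CARD('n) * r) \<subseteq> \<Omega>"
  shows "test_function \<Omega> (ker r z (\<lambda>_. 0))"
proof -
  have "closure {x. ker r z (\<lambda>_. 0) x \<noteq> 0} \<subseteq> cball z (real CARD('n) * r)"
    using ker_zero[OF assms(1), of _ z "\<lambda>_. 0"] by (intro closure_minimal) (blast, simp)
  then show ?thesis
    unfolding test_function_def using assms(2) deriv_family_C_k[OF ker_family]
    by (auto intro!: bounded_subset[OF bounded_cball] simp: compact_eq_bounded_closed simp del: mem_cball)
qed

text \<open>The only place where weak differentiability is exploited; it works because the kernel is
  an admissible test function.\<close>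

lemma mom_weak_derivative:
  assumes "0 < r" "cball z (real CARD('n) * r) \<subseteq> \<Omega>" "weak_derivative \<beta> \<Omega> u v"
  shows "mom \<Omega> u r \<beta> z = (- 1) ^ mi_order \<beta> * mom \<Omega> v r (\<lambda>_. 0) z"
proof -
  have "(LINT x|lebesgue_on \<Omega>. u x * mderiv \<beta> (ker r z (\<lambda>_. 0)) x)
      = (- 1) ^ mi_order \<beta> * (LINT x|lebesgue_on \<Omega>. v x * ker r z (\<lambda>_. 0) x)"
    using assms(3) ker_test_function[OF assms(1,2)] unfolding weak_derivative_def by blast
  then show ?thesis
    by (simp add: mom_def deriv_family_mderiv[OF ker_family])
qed

text \<open>Only the cube of side \<open>r\<close> about \<open>z\<close> is counted, where the
  kernel is at least \<open>c0\<close>; elsewhere it is nonnegative.\<close>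

lemma mom_one_lower:
  assumes "0 < r" "cball z (real CARD('n) * r) \<subseteq> \<Omega>" "open \<Omega>" "bounded \<Omega>"
  shows "c0 * r ^ CARD('n) \<le> mom \<Omega> (\<lambda>_. 1) r (\<lambda>_. 0) z"
proof -
  define Q where "Q = cbox (\<chi> i. z $ i - r / 2) (\<chi> i. z $ i + r / 2)"
  have Q_iff: "x \<in> Q \<longleftrightarrow> (\<forall>i. \<bar>((1 / r) *\<^sub>R (x - z)) $ i\<bar> \<le> 1/2)" for x
  proof -
    have "z $ i - r / 2 \<le> x $ i \<and> x $ i \<le> z $ i + r / 2 \<longleftrightarrow> \<bar>((1 / r) *\<^sub>R (x - z)) $ i\<bar> \<le> 1/2" for i
      using assms(1) by (simp add: abs_mult pos_divide_le_eq) argo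
    then show ?thesis
      unfolding Q_def mem_box_cart by simp
  qed
  have "c0 * r ^ CARD('n) = c0 * measure lborel Q"
    unfolding Q_def using assms(1)
    by (subst content_cbox_cart) (auto simp: interval_ne_empty_cart)
  also have "\<dots> = (LINT x|lborel. c0 * indicator Q x)"
    by (simp add: Q_def)
  also have "\<dots> \<le> (LINT x|lborel. 1 * ker r z (\<lambda>_. 0) x)"
  proof (rule integral_mono)
    show "integrable lborel (\<lambda>x. c0 * indicator Q x)"
      unfolding Q_def by (intro integrable_mult_right integrable_real_indicator) (auto simp: emeasure_lborel_cbox_eq)
    have "integrable lborel (\<lambda>x. indicator (cball z (real CARD('n) * r)) x *\<^sub>R ker r z (\<lambda>_. 0) x)"
      by (intro borel_integrable_compact deriv_family_continuous[OF ker_family]) auto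
    then show "integrable lborel (\<lambda>x. 1 * ker r z (\<lambda>_. 0) x)"
      by (rule Bochner_Integration.integrable_cong[THEN iffD1, rotated 2])
         (auto simp: indicator_def ker_zero[OF assms(1)])
    show "c0 * indicator Q x \<le> 1 * ker r z (\<lambda>_. 0) x" for x
      using c0(2)[of "(1 / r) *\<^sub>R (x - z)"] \<Theta>_nonneg[of "(1 / r) *\<^sub>R (x - z)"] Q_iff[of x]
      by (auto simp: ker_def indicator_def mi_order_def)
  qed
  also have "\<dots> = mom \<Omega> (\<lambda>_. 1) r (\<lambda>_. 0) z"
    using assms by (subst mom_eq_lborel) auto
  finally show ?thesis .
qed

end

section \<open>Transport of bounds along segments\<close>

text \<open>The mean value theorem along a segment. The sign \<open>s\<close> covers both uses: 1
  for derivative families, -1 for moments as functions of the centre. The factor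
  \<open>CARD('n)\<close> comes from summing over the coordinates.\<close>

lemma line_variation_bound:
  fixes W :: "'n::finite multi_index \<Rightarrow> real^'n \<Rightarrow> real"
  assumes der: "\<And>t. ((\<lambda>t. W \<gamma> (a + t *\<^sub>R d)) has_real_derivative
        s * (\<Sum>i\<in>UNIV. d $ i * W (\<gamma>(i := Suc (\<gamma> i))) (a + t *\<^sub>R d))) (at t)"
    and s: "\<bar>s\<bar> = 1" and d: "norm d \<le> L"
    and E: "\<And>i t. 0 \<le> t \<Longrightarrow> t \<le> 1 \<Longrightarrow> \<bar>W (\<gamma>(i := Suc (\<gamma> i))) (a + t *\<^sub>R d)\<bar> \<le> E"
    and t: "0 \<le> t" "t \<le> 1"
  shows "\<bar>W \<gamma> (a + t *\<^sub>R d) - W \<gamma> a\<bar> \<le> real CARD('n) * L * E"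
proof -
  have E0: "0 \<le> E" using E[of 0] by (meson abs_ge_zero order_trans zero_le_one order_refl)
  have L0: "0 \<le> L" using d norm_ge_zero order_trans by blast
  have "\<bar>W \<gamma> (a + t *\<^sub>R d) - W \<gamma> (a + 0 *\<^sub>R d)\<bar> \<le> (real CARD('n) * L * E) * \<bar>t - 0\<bar>"
  proof (rule DERIV_bound_segment[OF der, of 0 1])
    fix t :: real assume t: "0 \<le> t" "t \<le> 1"
    have "\<bar>s * (\<Sum>i\<in>UNIV. d $ i * W (\<gamma>(i := Suc (\<gamma> i))) (a + t *\<^sub>R d))\<bar>
      \<le> (\<Sum>i\<in>UNIV. \<bar>d $ i * W (\<gamma>(i := Suc (\<gamma> i))) (a + t *\<^sub>R d)\<bar>)"
      unfolding abs_mult[of s] s mult_1_left by (rule sum_abs)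
    also have "\<dots> \<le> (\<Sum>i\<in>(UNIV :: 'n set). L * E)"
    proof (rule sum_mono)
      fix i
      show "\<bar>d $ i * W (\<gamma>(i := Suc (\<gamma> i))) (a + t *\<^sub>R d)\<bar> \<le> L * E"
        unfolding abs_mult using E[OF t] d component_le_norm_cart[of d i] L0
        by (intro mult_mono) auto
    qed
    finally show "\<bar>s * (\<Sum>i\<in>UNIV. d $ i * W (\<gamma>(i := Suc (\<gamma> i))) (a + t *\<^sub>R d))\<bar> \<le> real CARD('n) * L * E"
      by simp
  qed (use t in auto)
  also have "\<dots> \<le> (real CARD('n) * L * E) * 1"
    using t L0 E0 by (intro mult_left_mono) auto
  finally show ?thesis by simp
qed

text \<open>Along a path of length \<open>\<Lambda> * r\<close>, a bound of size r^-(k+1) on order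
  k+1 allows a variation of size r^-k on order k. The scaled bound thus survives each step down from
  order p+1, at the cost of a factor \<open>1 + CARD('n) * \<Lambda>\<close>.\<close>

lemma downward_propagation:
  fixes W :: "'n::finite multi_index \<Rightarrow> real^'n \<Rightarrow> real"
  assumes der: "\<And>\<gamma> t. ((\<lambda>t. W \<gamma> (a + t *\<^sub>R d)) has_real_derivative
        s * (\<Sum>i\<in>UNIV. d $ i * W (\<gamma>(i := Suc (\<gamma> i))) (a + t *\<^sub>R d))) (at t)"
    and s: "\<bar>s\<bar> = 1" and d: "norm d \<le> \<Lambda> * r" and r: "0 < r" "0 \<le> \<Lambda>"
    and start: "\<And>\<gamma>. mi_order \<gamma> \<le> p \<Longrightarrow> \<bar>W \<gamma> a\<bar> \<le> B / r ^ mi_order \<gamma>"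
    and top: "\<And>\<gamma> t. mi_order \<gamma> = Suc p \<Longrightarrow> 0 \<le> t \<Longrightarrow> t \<le> 1 \<Longrightarrow> \<bar>W \<gamma> (a + t *\<^sub>R d)\<bar> \<le> B / r ^ Suc p"
    and B: "0 \<le> B"
    and \<gamma>: "mi_order \<gamma> \<le> p" and t: "0 \<le> t" "t \<le> 1"
  shows "\<bar>W \<gamma> (a + t *\<^sub>R d)\<bar> \<le> B * (1 + real CARD('n) * \<Lambda>) ^ Suc p / r ^ mi_order \<gamma>"
proof -
  define A where "A = 1 + real CARD('n) * \<Lambda>"
  have A: "1 \<le> A" using r by (simp add: A_def)
  \<comment> \<open>\<open>m\<close> is the distance of the order of \<gamma> from the top order
    \<open>Suc p\<close>, so the induction on \<open>m\<close> descends in the order.\<close>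
  have *: "\<bar>W \<gamma> (a + t *\<^sub>R d)\<bar> \<le> B * A ^ m / r ^ mi_order \<gamma>"
    if "mi_order \<gamma> + m = Suc p" "0 \<le> t" "t \<le> 1" for m \<gamma> t
    using that
  proof (induction m arbitrary: \<gamma> t)
    case 0
    then show ?case using top by simp
  next
    case (Suc m)
    have "\<bar>W \<gamma> (a + t *\<^sub>R d) - W \<gamma> a\<bar> \<le> real CARD('n) * (\<Lambda> * r) * (B * A ^ m / r ^ Suc (mi_order \<gamma>))"
    proof (rule line_variation_bound[OF der s d])
      show "\<bar>W (\<gamma>(i := Suc (\<gamma> i))) (a + t *\<^sub>R d)\<bar> \<le> B * A ^ m / r ^ Suc (mi_order \<gamma>)"
        if "0 \<le> t" "t \<le> 1" for i t
        using Suc.IH[of "\<gamma>(i := Suc (\<gamma> i))" t] Suc.prems that by (simp del: fun_upd_apply)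
    qed (use Suc.prems in auto)
    also have "\<dots> = real CARD('n) * \<Lambda> * (B * A ^ m) / r ^ mi_order \<gamma>"
      using r by simp
    finally have "\<bar>W \<gamma> (a + t *\<^sub>R d)\<bar> \<le> B * 1 / r ^ mi_order \<gamma> + real CARD('n) * \<Lambda> * (B * A ^ m) / r ^ mi_order \<gamma>"
      using start[of \<gamma>] Suc.prems by simp
    also have "\<dots> \<le> B * A ^ m / r ^ mi_order \<gamma> + real CARD('n) * \<Lambda> * (B * A ^ m) / r ^ mi_order \<gamma>"
      using A B r by (intro add_right_mono divide_right_mono mult_left_mono one_le_power) auto
    also have "\<dots> = B * A ^ Suc m / r ^ mi_order \<gamma>"
      by (simp add: A_def add_divide_distrib algebra_simps)
    finally show ?case .
  qed
  have "\<bar>W \<gamma> (a + t *\<^sub>R d)\<bar> \<le> B * A ^ (Suc p - mi_order \<gamma>) / r ^ mi_order \<gamma>"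
    using \<gamma> t by (intro *) auto
  also have "\<dots> \<le> B * A ^ Suc p / r ^ mi_order \<gamma>"
    using A B r by (intro divide_right_mono mult_left_mono power_increasing) auto
  finally show ?thesis by (simp add: A_def)
qed

section \<open>Comparison of the two one-sided polynomials\<close>

context bump_kernel
begin

text \<open>The averages of the derivatives of a polynomial control the derivatives at the centre, up to the
  oscillation of the latter, which is controlled by the next higher derivatives.\<close>

lemma polynomial_from_moments:
  assumes \<Phi>: "deriv_family \<Phi>" "\<And>\<gamma> x. p < mi_order \<gamma> \<Longrightarrow> \<Phi> \<gamma> x = 0"
    and r: "0 < r" "cball c (real CARD('n) * r) \<subseteq> \<Omega>" "open \<Omega>" "bounded \<Omega>"
    and \<Lambda>: "real CARD('n) \<le> \<Lambda>"
    and B: "\<And>\<gamma>. mi_order \<gamma> \<le> p \<Longrightarrow> \<bar>mom \<Omega> (\<Phi> (\<lambda>_. 0)) r \<gamma> c\<bar> \<le> B / r ^ mi_order \<gamma>"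
    and \<gamma>: "mi_order \<gamma> \<le> p" and x: "x \<in> cball c (\<Lambda> * r)"
  shows "\<bar>\<Phi> \<gamma> x\<bar> \<le> B / (c0 * r ^ CARD('n)) * (1 + 2 * real CARD('n) * \<Lambda>) ^ Suc p / r ^ mi_order \<gamma>"
proof -
  define n where "n = real CARD('n)"
  define A where "A = 1 + 2 * n * \<Lambda>"
  define B' where "B' = B / (c0 * r ^ CARD('n))"
  have n: "1 \<le> n" "n \<le> \<Lambda>" using \<Lambda> by (auto simp: n_def Suc_le_eq)
  have A: "1 \<le> A" using n by (simp add: A_def)
  have B0: "0 \<le> B" using B[of "\<lambda>_. 0"] by (simp add: mi_order_def)
  have I0: "0 < c0 * r ^ CARD('n)" using c0(1) r(1) by simp
  have B'0: "0 \<le> B'" using B0 I0 by (simp add: B'_def)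
  define I where "I = mom \<Omega> (\<lambda>_. 1) r (\<lambda>_. 0) c"
  have I: "c0 * r ^ CARD('n) \<le> I"
    unfolding I_def by (rule mom_one_lower[OF r])
  have \<Omega>: "\<Omega> \<in> sets lebesgue" using r(3) by auto
  have int: "integrable (lebesgue_on \<Omega>) (\<Phi> \<gamma>)" for \<gamma>
    by (rule integrable_continuous_bounded_domain[OF deriv_family_continuous[OF \<Phi>(1)] r(4) \<Omega>])
  have int1: "integrable (lebesgue_on \<Omega>) (\<lambda>_. 1 :: real)"
    by (rule integrable_continuous_bounded_domain[OF _ r(4) \<Omega>]) auto
  \<comment> \<open>The start \<open>m = 0\<close> is order \<open>Suc p\<close>, at which the
    derivatives vanish.\<close>
  have *: "\<bar>\<Phi> \<gamma> x\<bar> \<le> B' * A ^ m / r ^ mi_order \<gamma>"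
    if "mi_order \<gamma> + m = Suc p" "x \<in> cball c (\<Lambda> * r)" for m \<gamma> x
    using that
  proof (induction m arbitrary: \<gamma> x)
    case 0
    then show ?case using \<Phi>(2) B'0 r(1) by simp
  next
    case (Suc m)
    \<comment> \<open>\<open>D\<close> bounds the oscillation of \<open>\<Phi> \<gamma>\<close>
      about \<open>c\<close>; it is obtained from the bound one order higher.\<close>
    define D where "D = n * \<Lambda> * (B' * A ^ m) / r ^ mi_order \<gamma>"
    have osc: "\<bar>\<Phi> \<gamma> y - \<Phi> \<gamma> c\<bar> \<le> D" if y: "y \<in> cball c (\<Lambda> * r)" for y
    proof -
      have "\<bar>\<Phi> \<gamma> (c + 1 *\<^sub>R (y - c)) - \<Phi> \<gamma> c\<bar> \<le> real CARD('n) * (\<Lambda> * r) * (B' * A ^ m / r ^ Suc (mi_order \<gamma>))"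
      proof (rule line_variation_bound[where s = 1])
        show "norm (y - c) \<le> \<Lambda> * r" using y by (simp add: dist_norm norm_minus_commute)
        fix i and t :: real assume t: "0 \<le> t" "t \<le> 1"
        have "norm (t *\<^sub>R (y - c)) \<le> \<Lambda> * r"
          using t y mult_left_le_one_le[of "norm (y - c)" t]
          by (simp add: dist_norm norm_minus_commute)
        then have "c + t *\<^sub>R (y - c) \<in> cball c (\<Lambda> * r)"
          by (simp add: dist_norm)
        then show "\<bar>\<Phi> (\<gamma>(i := Suc (\<gamma> i))) (c + t *\<^sub>R (y - c))\<bar> \<le> B' * A ^ m / r ^ Suc (mi_order \<gamma>)"
          using Suc.IH[of "\<gamma>(i := Suc (\<gamma> i))"] Suc.prems by (simp del: fun_upd_apply)
      next
        show "((\<lambda>t. \<Phi> \<gamma> (c + t *\<^sub>R (y - c))) has_real_derivative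
            1 * (\<Sum>i\<in>UNIV. (y - c) $ i * \<Phi> (\<gamma>(i := Suc (\<gamma> i))) (c + t *\<^sub>R (y - c)))) (at t)" for t
          unfolding mult_1_left by (rule deriv_family_line[OF \<Phi>(1)])
      qed auto
      also have "\<dots> = D"
        using r(1) by (simp add: D_def n_def)
      finally show ?thesis by simp
    qed
    \<comment> \<open>The average of \<open>\<Phi> \<gamma>\<close> is its value at \<open>c\<close>
      times the mass \<open>I\<close> of the kernel, up to an oscillation of at most
      \<open>D * I\<close>.\<close>
    have "mom \<Omega> (\<Phi> \<gamma>) r (\<lambda>_. 0) c = \<Phi> \<gamma> c * I + mom \<Omega> (\<lambda>y. \<Phi> \<gamma> y - \<Phi> \<gamma> c) r (\<lambda>_. 0) c"
    proof -
      have "mom \<Omega> (\<lambda>y. \<Phi> \<gamma> c) r (\<lambda>_. 0) c = \<Phi> \<gamma> c * I"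
        unfolding I_def mom_def by simp
      moreover have "integrable (lebesgue_on \<Omega>) (\<lambda>y. \<Phi> \<gamma> c)"
        using integrable_mult_right[OF int1, of "\<Phi> \<gamma> c"] by simp
      ultimately show ?thesis
        using mom_diff[OF int _ r(1)] by simp
    qed
    moreover have "\<bar>mom \<Omega> (\<lambda>y. \<Phi> \<gamma> y - \<Phi> \<gamma> c) r (\<lambda>_. 0) c\<bar> \<le> D * I"
    proof -
      have int': "integrable (lebesgue_on \<Omega>) (\<lambda>y. \<Phi> \<gamma> y - \<Phi> \<gamma> c)"
        using int integrable_mult_right[OF int1, of "\<Phi> \<gamma> c"] by simp
      have "\<bar>mom \<Omega> (\<lambda>y. \<Phi> \<gamma> y - \<Phi> \<gamma> c) r (\<lambda>_. 0) c\<bar>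
        \<le> (LINT y|lebesgue_on \<Omega>. \<bar>(\<Phi> \<gamma> y - \<Phi> \<gamma> c) * ker r c (\<lambda>_. 0) y\<bar>)"
        unfolding mom_def by (rule integral_abs_bound)
      also have "\<dots> \<le> (LINT y|lebesgue_on \<Omega>. D * (1 * ker r c (\<lambda>_. 0) y))"
      proof (rule integral_mono)
        fix y
        have k0: "0 \<le> ker r c (\<lambda>_. 0) y"
          using \<Theta>_nonneg by (simp add: ker_def mi_order_def)
        show "\<bar>(\<Phi> \<gamma> y - \<Phi> \<gamma> c) * ker r c (\<lambda>_. 0) y\<bar> \<le> D * (1 * ker r c (\<lambda>_. 0) y)"
        proof (cases "y \<in> cball c (real CARD('n) * r)")
          case True
          then have "y \<in> cball c (\<Lambda> * r)"
            using mult_right_mono[OF \<Lambda> less_imp_le[OF r(1)]] by simp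
          then show ?thesis
            using osc k0 by (simp add: abs_mult mult_right_mono)
        qed (simp add: ker_zero[OF r(1)])
      qed (use integrable_ker[OF int' r(1)] integrable_ker[OF int1 r(1)] in auto)
      finally show ?thesis by (simp add: I_def mom_def)
    qed
    \<comment> \<open>Integration by parts moves \<gamma> from the kernel onto the polynomial, so
      the hypothesis on moments bounds averages of \<open>\<Phi> \<gamma>\<close>.\<close>
    moreover have "\<bar>mom \<Omega> (\<Phi> \<gamma>) r (\<lambda>_. 0) c\<bar> \<le> B / r ^ mi_order \<gamma>"
      using mom_deriv_family[OF r(3) \<Phi>(1) r(1,2,4), of "\<lambda>_. 0" \<gamma>] B[of \<gamma>] Suc.prems
      by (simp add: abs_mult power_abs)
    ultimately have "\<bar>\<Phi> \<gamma> c * I\<bar> \<le> B / r ^ mi_order \<gamma> + D * I"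
      by linarith
    then have "\<bar>\<Phi> \<gamma> c\<bar> * I \<le> (B / r ^ mi_order \<gamma> / I + D) * I"
      using I I0 by (simp add: abs_mult distrib_right)
    then have "\<bar>\<Phi> \<gamma> c\<bar> \<le> B / r ^ mi_order \<gamma> / I + D"
      using I I0 by (auto dest: mult_right_le_imp_le)
    also have "B / r ^ mi_order \<gamma> / I \<le> B / r ^ mi_order \<gamma> / (c0 * r ^ CARD('n))"
      using I I0 B0 r(1) by (intro divide_left_mono) auto
    also have "\<dots> = B' * 1 / r ^ mi_order \<gamma>"
      by (simp add: B'_def)
    also have "\<dots> \<le> B' * A ^ m / r ^ mi_order \<gamma>"
      using A B'0 r(1) by (intro divide_right_mono mult_left_mono one_le_power) auto
    \<comment> \<open>\<open>D\<close> enters twice, for the value at \<open>c\<close> and for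
      passing from \<open>c\<close> to \<open>x\<close>; this is the 2 in \<open>A\<close>.\<close>
    finally have "\<bar>\<Phi> \<gamma> x\<bar> \<le> B' * A ^ m / r ^ mi_order \<gamma> + D + D"
      using osc[OF Suc.prems(2)] by linarith
    also have "\<dots> = B' * A ^ Suc m / r ^ mi_order \<gamma>"
      by (simp add: D_def A_def add_divide_distrib algebra_simps)
    finally show ?case .
  qed
  have "\<bar>\<Phi> \<gamma> x\<bar> \<le> B' * A ^ (Suc p - mi_order \<gamma>) / r ^ mi_order \<gamma>"
    using \<gamma> x by (intro *) auto
  also have "\<dots> \<le> B' * A ^ Suc p / r ^ mi_order \<gamma>"
    using A B'0 r(1) by (intro divide_right_mono mult_left_mono power_increasing) auto
  finally show ?thesis by (simp add: A_def B'_def n_def)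
qed

text \<open>One-sided information is kept apart: \<open>\<Phi>\<close> meets \<open>u\<close> only
  on \<open>U\<close>, \<open>\<Psi>\<close> only on \<open>V\<close>, and the weak derivatives are
  the only term on the whole ball. Kernel supports have radius \<open>CARD('n) * r\<close>, and the
  end positions of the centre are twice that far from \<open>y\<close>, so that each support lies on
  its own side.\<close>

lemma difference_of_approximants:
  fixes u :: "real^'n \<Rightarrow> real"
  assumes \<Phi>: "deriv_family \<Phi>" "\<And>\<gamma> x. p < mi_order \<gamma> \<Longrightarrow> \<Phi> \<gamma> x = 0"
    and \<Psi>: "deriv_family \<Psi>" "\<And>\<gamma> x. p < mi_order \<gamma> \<Longrightarrow> \<Psi> \<gamma> x = 0"
    and \<Omega>: "open \<Omega>" "bounded \<Omega>"
    and u: "integrable (lebesgue_on \<Omega>) u"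
    and v: "\<And>\<beta>. mi_order \<beta> = Suc p \<Longrightarrow> integrable (lebesgue_on \<Omega>) (v \<beta>) \<and> weak_derivative \<beta> \<Omega> u (v \<beta>)"
    and r: "0 < r" "norm e = 1" "ball y (4 * (real CARD('n) * r)) \<subseteq> \<Omega>"
    and \<Lambda>: "real CARD('n) \<le> \<Lambda>"
    and \<gamma>: "mi_order \<gamma> \<le> p" and x: "x \<in> cball (y + (2 * (real CARD('n) * r)) *\<^sub>R e) (\<Lambda> * r)"
  defines "U \<equiv> ball (y + (2 * (real CARD('n) * r)) *\<^sub>R e) (2 * (real CARD('n) * r))"
    and "V \<equiv> ball (y - (2 * (real CARD('n) * r)) *\<^sub>R e) (2 * (real CARD('n) * r))"
  shows "\<bar>\<Phi> \<gamma> x - \<Psi> \<gamma> x\<bar> \<le> M (Suc p) * (2 * (1 + 4 * (real CARD('n))\<^sup>2) ^ Suc p) / c0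
            * (1 + 2 * real CARD('n) * \<Lambda>) ^ Suc p / (r ^ CARD('n) * r ^ mi_order \<gamma>) *
      ((LINT x|lebesgue_on \<Omega>. indicator U x * \<bar>u x - \<Phi> (\<lambda>_. 0) x\<bar>)
        + (LINT x|lebesgue_on \<Omega>. indicator V x * \<bar>u x - \<Psi> (\<lambda>_. 0) x\<bar>)
        + r ^ Suc p * (\<Sum>\<beta> | mi_order \<beta> = Suc p.
            LINT x|lebesgue_on \<Omega>. indicator (ball y (4 * (real CARD('n) * r))) x * \<bar>v \<beta> x\<bar>))"
    (is "_ \<le> _ * (?X1 + ?X0 + r ^ Suc p * ?V)")
proof -
  define n where "n = real CARD('n)"
  have n: "1 \<le> n" by (simp add: n_def Suc_le_eq)
  have nr: "0 < n * r" using n r(1) by simp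
  define a where "a = y - (2 * (n * r)) *\<^sub>R e"
  define c where "c = y + (2 * (n * r)) *\<^sub>R e"
  define d where "d = (4 * (n * r)) *\<^sub>R e"
  have c_eq: "c = a + 1 *\<^sub>R d"
    by (simp add: a_def c_def d_def algebra_simps flip: scaleR_add_left)
  have zero: "0 \<le> (LINT x|lebesgue_on \<Omega>. indicator B x * \<bar>f x\<bar>)" for B and f :: "real^'n \<Rightarrow> real"
    by (intro integral_nonneg_AE) auto
  have V0: "0 \<le> ?V" by (intro sum_nonneg zero)
  \<comment> \<open>The centre stays within \<open>2 * (n * r)\<close> of \<open>y\<close>, so the
    support reaches at most to distance \<open>3 * (n * r)\<close>.\<close>
  have path: "cball (a + t *\<^sub>R d) (n * r) \<subseteq> ball y (4 * (n * r))" if t: "0 \<le> t" "t \<le> 1" for t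
  proof
    fix z assume z: "z \<in> cball (a + t *\<^sub>R d) (n * r)"
    have "a + t *\<^sub>R d - y = (2 * (n * r) * (2 * t - 1)) *\<^sub>R e"
      by (simp add: a_def d_def algebra_simps flip: scaleR_add_left)
    then have "norm (a + t *\<^sub>R d - y) = 2 * (n * r) * \<bar>2 * t - 1\<bar>"
      using r(2) nr by (simp add: abs_mult[of "2 * (n * r)"])
    also have "\<dots> \<le> 2 * (n * r) * 1"
      using t nr by (intro mult_left_mono) auto
    finally show "z \<in> ball y (4 * (n * r))"
      using z nr norm_triangle_ineq[of "a + t *\<^sub>R d - y" "z - (a + t *\<^sub>R d)"]
      by (simp add: dist_norm norm_minus_commute)
  qed
  have sub: "ball y (4 * (n * r)) \<subseteq> \<Omega>" using r(3) by (simp add: n_def)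
  have pathO: "cball (a + t *\<^sub>R d) (n * r) \<subseteq> \<Omega>" if t: "0 \<le> t" "t \<le> 1" for t
    using path[OF t] sub by blast
  have \<Omega>s: "\<Omega> \<in> sets lebesgue" using \<Omega>(1) by auto
  have int: "integrable (lebesgue_on \<Omega>) (\<Phi> \<gamma>)" "integrable (lebesgue_on \<Omega>) (\<Psi> \<gamma>)" for \<gamma>
    by (rule integrable_continuous_bounded_domain[OF deriv_family_continuous[OF \<Phi>(1)] \<Omega>(2) \<Omega>s]
        integrable_continuous_bounded_domain[OF deriv_family_continuous[OF \<Psi>(1)] \<Omega>(2) \<Omega>s])+
  define f where "f x = u x - \<Psi> (\<lambda>_. 0) x" for x
  define g where "g x = u x - \<Phi> (\<lambda>_. 0) x" for x
  have f: "integrable (lebesgue_on \<Omega>) f" and g: "integrable (lebesgue_on \<Omega>) g"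
    unfolding f_def g_def using u int by auto
  define N where "N = M (Suc p)"
  have N0: "0 \<le> N" by (simp add: N_def M_nonneg)
  have small: "cball c (n * r) \<subseteq> U" "cball a (n * r) \<subseteq> V"
    using nr by (auto simp: U_def V_def c_def a_def n_def)
  \<comment> \<open>\<open>B\<close> covers both the moments at the start \<open>a\<close> and,
    scaled by \<open>r ^ Suc p\<close>, the top-order moments along the path, in the common form
    that propagation requires.\<close>
  define B where "B = N * (?X0 + r ^ Suc p * ?V)"
  have X0: "0 \<le> ?X0" and X1: "0 \<le> ?X1" by (rule zero)+
  have B0: "0 \<le> B" using N0 X0 V0 r(1) by (simp add: B_def)
  \<comment> \<open>The path from \<open>a\<close> to \<open>c\<close> has length
    \<open>4 * (n * r)\<close>, so \<open>\<Lambda>\<close> is \<open>4 * n\<close>; the sign -1 is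
    that of \<open>mom_DERIV\<close>.\<close>
  have mom_f: "\<bar>mom \<Omega> f r \<gamma> (a + 1 *\<^sub>R d)\<bar> \<le> B * (1 + real CARD('n) * (4 * n)) ^ Suc p / r ^ mi_order \<gamma>"
    if \<gamma>: "mi_order \<gamma> \<le> p" for \<gamma>
  proof (rule downward_propagation[where s = "- 1" and W = "mom \<Omega> f r" and t = 1])
    show "norm d \<le> 4 * n * r" using r n by (simp add: d_def)
    show "\<bar>mom \<Omega> f r \<gamma> a\<bar> \<le> B / r ^ mi_order \<gamma>" if "mi_order \<gamma> \<le> p" for \<gamma>
    proof -
      have "\<bar>mom \<Omega> f r \<gamma> a\<bar> \<le> N / r ^ mi_order \<gamma> * ?X0"
        unfolding N_def f_def[symmetric] using that small(2)
        by (intro mom_bound f r(1)) (auto simp: V_def n_def)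
      also have "\<dots> \<le> N / r ^ mi_order \<gamma> * (?X0 + r ^ Suc p * ?V)"
        using N0 V0 r(1) by (intro mult_left_mono) auto
      finally show ?thesis by (simp add: B_def)
    qed
    show "\<bar>mom \<Omega> f r \<gamma> (a + t *\<^sub>R d)\<bar> \<le> B / r ^ Suc p"
      if \<gamma>: "mi_order \<gamma> = Suc p" and t: "0 \<le> t" "t \<le> 1" for \<gamma> t
    proof -
      \<comment> \<open>At order \<open>Suc p\<close> the polynomial contributes nothing, and the
        moment of \<open>u\<close> is, up to sign, the zeroth moment of its weak derivative.\<close>
      have "mom \<Omega> (\<Psi> (\<lambda>_. 0)) r \<gamma> (a + t *\<^sub>R d) = 0"
        using mom_deriv_family[OF \<Omega>(1) \<Psi>(1) r(1) _ \<Omega>(2), of "a + t *\<^sub>R d" "\<lambda>_. 0" \<gamma>] pathO[OF t] \<gamma> \<Psi>(2)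
        by (simp add: n_def mom_def)
      then have "\<bar>mom \<Omega> f r \<gamma> (a + t *\<^sub>R d)\<bar> = \<bar>mom \<Omega> u r \<gamma> (a + t *\<^sub>R d)\<bar>"
        unfolding f_def using mom_diff[OF u int(2) r(1)] by simp
      also have "\<dots> = \<bar>mom \<Omega> (v \<gamma>) r (\<lambda>_. 0) (a + t *\<^sub>R d)\<bar>"
        using mom_weak_derivative[OF r(1), of "a + t *\<^sub>R d" \<Omega> \<gamma> u "v \<gamma>"] pathO[OF t] v[OF \<gamma>]
        by (simp add: n_def abs_mult power_abs)
      also have "\<dots> \<le> M (Suc p) / r ^ mi_order (\<lambda>_ :: 'n. 0)
           * (LINT x|lebesgue_on \<Omega>. indicator (ball y (4 * (real CARD('n) * r))) x * \<bar>v \<gamma> x\<bar>)"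
        using v[OF \<gamma>] path[OF t] by (intro mom_bound r(1)) (auto simp: n_def mi_order_def)
      also have "\<dots> = N * (LINT x|lebesgue_on \<Omega>. indicator (ball y (4 * (real CARD('n) * r))) x * \<bar>v \<gamma> x\<bar>)"
        by (simp add: mi_order_def N_def)
      also have "\<dots> \<le> N * ?V"
        using \<gamma> by (intro mult_left_mono N0 member_le_sum zero finite_mi_order_eq) auto
      also have "\<dots> \<le> B / r ^ Suc p"
      proof -
        have "N * ?V * r ^ Suc p \<le> B"
          using N0 X0 by (simp add: B_def mult.assoc mult.commute[of "r ^ Suc p"] mult_left_mono del: power_Suc)
        then show ?thesis
          using r(1) by (simp add: pos_le_divide_eq del: power_Suc)
      qed
      finally show ?thesis .
    qed
    show "((\<lambda>t. mom \<Omega> f r \<gamma> (a + t *\<^sub>R d)) has_real_derivative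
      - 1 * (\<Sum>i\<in>UNIV. d $ i * mom \<Omega> f r (\<gamma>(i := Suc (\<gamma> i))) (a + t *\<^sub>R d))) (at t)" for \<gamma> t
      using mom_DERIV[OF f r(1)] by simp
  qed (use n r(1) \<gamma> B0 in auto)
  define A where "A = (1 + 4 * n\<^sup>2) ^ Suc p"
  have A: "1 \<le> A" unfolding A_def by (intro one_le_power) simp
  define K where "K = ?X1 + ?X0 + r ^ Suc p * ?V"
  define \<Delta> where "\<Delta> \<gamma> x = \<Phi> \<gamma> x - \<Psi> \<gamma> x" for \<gamma> x
  \<comment> \<open>\<open>\<Delta>\<close> at order zero is \<open>f - g\<close>; the moments of
    either are at most a scaled \<open>N * K * A\<close>, whence the factor
    \<open>2 * A\<close>.\<close>
  have "\<bar>\<Delta> \<gamma> x\<bar> \<le> (N * (2 * A) * K) / (c0 * r ^ CARD('n)) * (1 + 2 * real CARD('n) * \<Lambda>) ^ Suc p / r ^ mi_order \<gamma>"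
  proof (rule polynomial_from_moments[where \<Omega> = \<Omega> and c = c])
    show "deriv_family \<Delta>"
      unfolding \<Delta>_def by (rule deriv_family_diff[OF \<Phi>(1) \<Psi>(1)])
    show "cball c (real CARD('n) * r) \<subseteq> \<Omega>"
      using pathO[of 1] by (simp add: c_eq n_def)
    show "x \<in> cball c (\<Lambda> * r)" using x by (simp add: c_def n_def)
    show "\<bar>mom \<Omega> (\<Delta> (\<lambda>_. 0)) r \<gamma> c\<bar> \<le> N * (2 * A) * K / r ^ mi_order \<gamma>" if \<gamma>: "mi_order \<gamma> \<le> p" for \<gamma>
    proof -
      have "mom \<Omega> (\<Delta> (\<lambda>_. 0)) r \<gamma> c = mom \<Omega> (\<lambda>x. f x - g x) r \<gamma> c"
        by (simp add: \<Delta>_def[abs_def] f_def g_def)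
      also have "\<dots> = mom \<Omega> f r \<gamma> c - mom \<Omega> g r \<gamma> c"
        by (rule mom_diff[OF f g r(1)])
      finally have "\<bar>mom \<Omega> (\<Delta> (\<lambda>_. 0)) r \<gamma> c\<bar> \<le> \<bar>mom \<Omega> f r \<gamma> c\<bar> + \<bar>mom \<Omega> g r \<gamma> c\<bar>"
        by simp
      also have "\<bar>mom \<Omega> f r \<gamma> c\<bar> \<le> B * A / r ^ mi_order \<gamma>"
        using mom_f[OF \<gamma>] by (simp add: c_eq A_def n_def power2_eq_square mult.left_commute)
      also have "\<dots> \<le> N * K * A / r ^ mi_order \<gamma>"
        using N0 A r(1) X1 by (intro divide_right_mono mult_right_mono) (auto simp: B_def K_def intro!: mult_left_mono)
      also have "\<bar>mom \<Omega> g r \<gamma> c\<bar> \<le> N / r ^ mi_order \<gamma> * ?X1"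
        unfolding N_def g_def[symmetric] using \<gamma> small(1)
        by (intro mom_bound g r(1)) (auto simp: U_def n_def)
      also have "\<dots> \<le> N / r ^ mi_order \<gamma> * (K * A)"
      proof -
        have "?X1 * 1 \<le> K * A"
          using X0 X1 V0 r(1) A by (intro mult_mono) (auto simp: K_def)
        then show ?thesis using N0 r(1) by (intro mult_left_mono) auto
      qed
      finally show ?thesis by (simp add: mult_ac)
    qed
    show "\<Delta> \<gamma> x = 0" if "p < mi_order \<gamma>" for \<gamma> x
      using that \<Phi>(2) \<Psi>(2) by (simp add: \<Delta>_def)
  qed (use r(1) \<Omega> \<Lambda> \<gamma> in auto)
  also have "\<dots> = N * (2 * A) / c0 * (1 + 2 * real CARD('n) * \<Lambda>) ^ Suc p / (r ^ CARD('n) * r ^ mi_order \<gamma>) * K"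
    by (simp add: mult_ac)
  finally show ?thesis
    by (simp only: \<Delta>_def N_def A_def n_def K_def)
qed

end

subsection \<open>Balls across a common face\<close>

text \<open>In the cone over \<open>A\<close>, the points of apex weight \<open>u\<close> form a
  translate of \<open>A\<close> shrunk by \<open>1 - u\<close>, and the height over the hyperplane
  determines \<open>u\<close>. The slice of the ball at the height of its centre has radius
  \<open>r\<close>; undoing the shrinking only enlarges it.\<close>

lemma cone_contains_disc:
  fixes A :: "'a::euclidean_space set"
  assumes A: "convex A" "A \<subseteq> {x. n \<bullet> x = b}" and n: "norm n = 1"
    and ball: "cball c r \<subseteq> convex hull (insert w A)" and r: "0 < r"
  obtains y where "y \<in> A" "{z. n \<bullet> z = b} \<inter> cball y r \<subseteq> A"
proof -
  define l where "l x = n \<bullet> x - b" for x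
  have nn: "n \<bullet> n = 1" using n by (simp add: dot_square_norm)
  have "A \<noteq> {}"
  proof
    assume "A = {}"
    then have "c = w" "c + r *\<^sub>R n = w"
      using ball r n by (auto simp: subset_iff dist_norm)
    then show False using r n by auto
  qed
  then have hull: "x \<in> convex hull (insert w A) \<longleftrightarrow>
      (\<exists>u\<ge>0. \<exists>v\<ge>0. \<exists>a. u + v = 1 \<and> a \<in> A \<and> x = u *\<^sub>R w + v *\<^sub>R a)" for x
    using A(1) by (simp add: convex_hull_insert hull_same)
  have l_comb: "l (u *\<^sub>R w + v *\<^sub>R a) = u * l w" if "u + v = 1" "a \<in> A" for u v a
  proof -
    have "n \<bullet> a = b" using A(2) that by auto
    have "v = 1 - u" using that by simp
    show ?thesis unfolding \<open>v = 1 - u\<close> using \<open>n \<bullet> a = b\<close> by (simp add: l_def inner_add_right algebra_simps)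
  qed
  have "c \<in> convex hull (insert w A)" using ball r by auto
  then obtain u v y where c: "0 \<le> u" "0 \<le> v" "u + v = 1" "y \<in> A" "c = u *\<^sub>R w + v *\<^sub>R y"
    unfolding hull by blast
  \<comment> \<open>The sign pushes the centre towards the apex. The pushed point still lies in the
    cone and has larger apex weight, so the weight of the centre is below 1 and \<open>v\<close> is
    positive.\<close>
  define s where "s = (if l w < 0 then - 1 else 1 :: real)"
  have "c + (s * r) *\<^sub>R n \<in> convex hull (insert w A)"
    using ball r n by (auto simp: subset_iff dist_norm s_def)
  then obtain u' v' a' where c': "0 \<le> u'" "0 \<le> v'" "u' + v' = 1" "a' \<in> A" "c + (s * r) *\<^sub>R n = u' *\<^sub>R w + v' *\<^sub>R a'"
    unfolding hull by blast
  have lc: "l c = u * l w" using l_comb[OF c(3,4)] c(5) by simp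
  have "l (c + (s * r) *\<^sub>R n) = u' * l w" using l_comb[OF c'(3,4)] c'(5) by simp
  moreover have "l (c + (s * r) *\<^sub>R n) = l c + s * r"
    using nn by (simp add: l_def inner_add_right)
  ultimately have eq: "(u' - u) * l w = s * r"
    using lc by (simp add: left_diff_distrib)
  then have lw: "l w \<noteq> 0" using r by (auto simp: s_def split: if_splits)
  have "0 < u' - u"
  proof (rule ccontr)
    assume "\<not> 0 < u' - u"
    then have "(u' - u) * (l w * s) \<le> 0"
      by (intro mult_nonpos_nonneg) (auto simp: s_def)
    moreover have "(u' - u) * (l w * s) = r"
      unfolding mult.assoc[symmetric] eq by (simp add: s_def)
    ultimately show False using r by simp
  qed
  then have v: "0 < v" "v \<le> 1" using c c' by auto
  \<comment> \<open>Moving \<open>c\<close> parallel to the hyperplane keeps its height, hence its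
    apex weight, and the apex terms cancel. \<open>v \<le> 1\<close> is what preserves the radius
    \<open>r\<close>.\<close>
  have "z \<in> A" if z: "n \<bullet> z = b" "z \<in> cball y r" for z
  proof -
    have "norm (v *\<^sub>R (z - y)) \<le> r"
      using z(2) v mult_left_le_one_le[of "norm (z - y)" v]
      by (simp add: dist_norm norm_minus_commute)
    then have "c + v *\<^sub>R (z - y) \<in> convex hull (insert w A)"
      using ball by (auto simp: subset_iff dist_norm)
    then obtain u2 v2 a where a: "u2 + v2 = 1" "a \<in> A" "c + v *\<^sub>R (z - y) = u2 *\<^sub>R w + v2 *\<^sub>R a"
      unfolding hull by blast
    have "l (c + v *\<^sub>R (z - y)) = u2 * l w" using l_comb[OF a(1,2)] a(3) by simp
    moreover have "l (c + v *\<^sub>R (z - y)) = l c"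
      using z(1) c(4) A(2) by (auto simp: l_def inner_add_right inner_diff_right)
    ultimately have "u2 = u" using lc lw by simp
    then have "v2 = v" using a(1) c(3) by simp
    then have "v *\<^sub>R z = v *\<^sub>R a"
      using a(3) c(5) \<open>u2 = u\<close> by (simp add: algebra_simps)
    then show ?thesis using v a(2) by simp
  qed
  then show ?thesis using that c(4) by blast
qed

text \<open>A point \<open>x\<close> near \<open>y\<close> on the side of \<open>q\<close> lies on
  the segment from \<open>q\<close> to a point \<open>z\<close> of the disc. The condition on
  \<open>\<bar>n \<bullet> x - b\<bar>\<close> stands for Cauchy-Schwarz with a unit normal,
  supplied where the lemma is applied.\<close>

lemma half_ball_subset:
  fixes S :: "'a::euclidean_space set"
  assumes S: "convex S" and disc: "{z. n \<bullet> z = b} \<inter> cball y r \<subseteq> S" and y: "n \<bullet> y = b"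
    and q: "q \<in> S" "r \<le> \<bar>n \<bullet> q - b\<bar>" "dist q y \<le> \<Lambda> * r" and r: "0 < r" "1 \<le> \<Lambda>"
  shows "{x \<in> cball y (r / (2 + 2 * \<Lambda>)). 0 \<le> (n \<bullet> x - b) * (n \<bullet> q - b)} \<inter> {x. \<bar>n \<bullet> x - b\<bar> \<le> norm (x - y)} \<subseteq> S"
proof safe
  fix x assume x: "x \<in> cball y (r / (2 + 2 * \<Lambda>))" "0 \<le> (n \<bullet> x - b) * (n \<bullet> q - b)"
    "\<bar>n \<bullet> x - b\<bar> \<le> norm (x - y)"
  \<comment> \<open>Chosen so that \<open>\<rho> + \<Lambda> * \<rho> = r / 2\<close>; as the weight
    of \<open>q\<close> is at most 1/4, the point \<open>z\<close> then ends up within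
    \<open>r\<close> of \<open>y\<close>.\<close>
  define \<rho> where "\<rho> = r / (2 + 2 * \<Lambda>)"
  have \<rho>: "0 < \<rho>" "\<rho> \<le> r / 4" "\<rho> * (1 + \<Lambda>) = r / 2"
    using r by (auto simp: \<rho>_def field_simps)
  define l where "l x = n \<bullet> x - b" for x
  \<comment> \<open>The weight of \<open>q\<close> that puts \<open>z\<close> on the
    hyperplane.\<close>
  define t where "t = l x / l q"
  have lq: "l q \<noteq> 0" using q(2) r by (auto simp: l_def)
  have nx: "norm (x - y) \<le> \<rho>" using x(1) by (simp add: \<rho>_def dist_norm norm_minus_commute)
  have t0: "0 \<le> t"
    using x(2) unfolding t_def l_def by (simp add: zero_le_divide_iff zero_le_mult_iff)
  have "\<bar>t\<bar> \<le> \<rho> / r"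
  proof -
    have "\<bar>l x\<bar> / \<bar>l q\<bar> \<le> \<rho> / r"
      using x(3) nx q(2) r by (intro frac_le) (auto simp: l_def)
    then show ?thesis by (simp add: t_def abs_divide)
  qed
  then have t1: "t \<le> \<rho> / r" "t * r \<le> \<rho>" using r t0 by (auto simp: pos_le_divide_eq)
  have t4: "t \<le> 1/4"
  proof -
    have "\<rho> / r \<le> 1/4" using \<rho> r by (simp add: field_simps)
    then show ?thesis using t1 by linarith
  qed
  define z where "z = (1 / (1 - t)) *\<^sub>R (x - t *\<^sub>R q)"
  have xz: "x = (1 - t) *\<^sub>R z + t *\<^sub>R q" using t4 by (simp add: z_def)
  have "l x = t * l q" using lq by (simp add: t_def)
  then have "(1 - t) * l z = 0"
  proof -
    have "l x = (1 - t) * l z + t * l q"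
      by (subst xz) (simp add: l_def inner_add_right algebra_simps)
    then show ?thesis using \<open>l x = t * l q\<close> by simp
  qed
  then have lz: "n \<bullet> z = b" using t4 by (simp add: l_def)
  have "(1 - t) *\<^sub>R (z - y) = (x - y) - t *\<^sub>R (q - y)"
    by (subst xz) (simp add: algebra_simps)
  then have "(1 - t) * norm (z - y) = norm ((x - y) - t *\<^sub>R (q - y))"
    using t4 norm_scaleR[of "1 - t" "z - y"] by simp
  also have "\<dots> \<le> norm (x - y) + t * norm (q - y)"
    using norm_triangle_ineq4[of "x - y" "t *\<^sub>R (q - y)"] t0 by simp
  also have "\<dots> \<le> \<rho> + t * (\<Lambda> * r)"
    using nx q(3) t0 by (intro add_mono mult_left_mono) (auto simp: dist_norm)
  also have "\<dots> \<le> \<rho> + \<Lambda> * \<rho>"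
    using t1(2) r mult_left_mono[of "t * r" \<rho> \<Lambda>] by (simp add: mult_ac)
  also have "\<dots> = r / 2" using \<rho>(3) by (simp add: algebra_simps)
  finally have "(1 - t) * norm (z - y) \<le> r / 2" .
  moreover have "1 / 2 * norm (z - y) \<le> (1 - t) * norm (z - y)"
    using t4 by (intro mult_right_mono) auto
  ultimately have "norm (z - y) \<le> r" by linarith
  then have "z \<in> S" using disc lz by (auto simp: dist_norm norm_minus_commute)
  then show "x \<in> S"
    unfolding xz using t0 t4 by (intro convexD[OF S _ q(1)]) auto
qed

text \<open>The inscribed ball is there to provide a point at height at least \<open>r\<close>. Its
  centre may be arbitrarily close to the hyperplane, so it is first pushed away from it by
  \<open>r\<close>.\<close>

lemma half_ball_of_face:
  fixes S :: "'a::euclidean_space set"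
  assumes S: "convex S" and n: "norm n = 1" and disc: "{z. n \<bullet> z = b} \<inter> cball y r \<subseteq> S" and y: "n \<bullet> y = b"
    and ball: "cball c r \<subseteq> S" and r: "0 < r" "1 \<le> \<Lambda>" and diam: "\<And>x. x \<in> S \<Longrightarrow> dist x y \<le> \<Lambda> * r"
  obtains e where "e = n \<or> e = - n" "{x \<in> cball y (r / (2 + 2 * \<Lambda>)). 0 \<le> e \<bullet> (x - y)} \<subseteq> S"
proof -
  define s where "s = (if n \<bullet> c - b < 0 then - 1 else 1 :: real)"
  define q where "q = c + (s * r) *\<^sub>R n"
  have nn: "n \<bullet> n = 1" using n by (simp add: dot_square_norm)
  have qS: "q \<in> S"
    using ball r n by (auto simp: q_def subset_iff dist_norm s_def)
  have lq: "n \<bullet> q - b = s * (\<bar>n \<bullet> c - b\<bar> + r)"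
    using nn by (auto simp: q_def inner_add_right s_def abs_if)
  have s: "s = 1 \<or> s = - 1" by (simp add: s_def)
  have lq_ge: "r \<le> \<bar>n \<bullet> q - b\<bar>" using s r by (auto simp: lq abs_mult)
  have "{x \<in> cball y (r / (2 + 2 * \<Lambda>)). 0 \<le> (s *\<^sub>R n) \<bullet> (x - y)} \<subseteq> S"
  proof safe
    fix x assume x: "x \<in> cball y (r / (2 + 2 * \<Lambda>))" "0 \<le> (s *\<^sub>R n) \<bullet> (x - y)"
    have lx: "n \<bullet> x - b = n \<bullet> (x - y)" using y by (simp add: inner_diff_right)
    have "0 \<le> (n \<bullet> (x - y) * s) * (\<bar>n \<bullet> c - b\<bar> + r)"
      using x(2) r by (intro mult_nonneg_nonneg[OF _ add_nonneg_nonneg]) (auto simp: mult.commute)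
    then have "0 \<le> (n \<bullet> x - b) * (n \<bullet> q - b)"
      by (simp add: lq lx mult.assoc)
    moreover have "\<bar>n \<bullet> x - b\<bar> \<le> norm (x - y)"
      unfolding lx using Cauchy_Schwarz_ineq2[of n "x - y"] n by simp
    ultimately show "x \<in> S"
      using half_ball_subset[OF S disc y qS lq_ge diam[OF qS] r] x(1) by blast
  qed
  moreover have "s *\<^sub>R n = n \<or> s *\<^sub>R n = - n" using s by auto
  ultimately show ?thesis using that by blast
qed

lemma ball_in_half_ball:
  fixes y e :: "'a::euclidean_space"
  assumes "norm e = 1" "0 < \<rho>"
  shows "ball (y + (\<rho> / 2) *\<^sub>R e) (\<rho> / 2) \<subseteq> {x \<in> cball y \<rho>. 0 \<le> e \<bullet> (x - y)}"
proof safe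
  fix x assume x: "x \<in> ball (y + (\<rho> / 2) *\<^sub>R e) (\<rho> / 2)"
  define d where "d = x - (y + (\<rho> / 2) *\<^sub>R e)"
  have d: "norm d < \<rho> / 2" "x - y = (\<rho> / 2) *\<^sub>R e + d"
    using x by (auto simp: d_def dist_norm norm_minus_commute)
  then show "x \<in> cball y \<rho>"
    using norm_triangle_ineq[of "(\<rho> / 2) *\<^sub>R e" d] assms
    by (simp add: dist_norm norm_minus_commute)
  have "e \<bullet> (x - y) = \<rho> / 2 + e \<bullet> d"
    using assms(1) d(2) by (simp add: inner_add_right dot_square_norm)
  moreover have "\<bar>e \<bullet> d\<bar> \<le> norm d"
    using Cauchy_Schwarz_ineq2[of e d] assms(1) by simp
  ultimately show "0 \<le> e \<bullet> (x - y)" using d(1) by linarith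
qed

text \<open>One disc in the common face serves both elements. Each side yields a half ball over it,
  and these lie on opposite sides of the hyperplane because otherwise the interiors of
  \<open>K\<close> and \<open>L\<close> would share an open ball.\<close>

lemma ball_across_face:
  fixes S S' :: "'a::euclidean_space set"
  assumes S: "convex S" "F \<subseteq> S" "S \<subseteq> K" and S': "convex S'" "F \<subseteq> S'" "S' \<subseteq> L"
    and disj: "interior K \<inter> interior L = {}"
    and A: "convex A" "A \<subseteq> F" "A \<subseteq> {x. n \<bullet> x = b}" and n: "norm n = 1"
    and balls: "cball c1 r \<subseteq> convex hull (insert w A)" "cball c2 r \<subseteq> S" "cball c3 r \<subseteq> S'"
    and r: "0 < r" "1 \<le> \<Lambda>"
    and diam: "\<And>x y. x \<in> S \<Longrightarrow> y \<in> S \<Longrightarrow> dist x y \<le> \<Lambda> * r"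
      "\<And>x y. x \<in> S' \<Longrightarrow> y \<in> S' \<Longrightarrow> dist x y \<le> \<Lambda> * r"
  obtains y e where "y \<in> F" "norm e = 1"
    "{x \<in> cball y (r / (2 + 2 * \<Lambda>)). 0 \<le> e \<bullet> (x - y)} \<subseteq> K"
    "{x \<in> cball y (r / (2 + 2 * \<Lambda>)). e \<bullet> (x - y) \<le> 0} \<subseteq> L"
proof -
  obtain y where y: "y \<in> A" "{z. n \<bullet> z = b} \<inter> cball y r \<subseteq> A"
    using cone_contains_disc[OF A(1,3) n balls(1) r(1)] by blast
  define \<rho> where "\<rho> = r / (2 + 2 * \<Lambda>)"
  have \<rho>: "0 < \<rho>" using r by (simp add: \<rho>_def)
  have yb: "n \<bullet> y = b" using y A by auto
  have yS: "y \<in> S" "y \<in> S'" using y A S S' by auto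
  obtain e where e: "e = n \<or> e = - n" "{x \<in> cball y \<rho>. 0 \<le> e \<bullet> (x - y)} \<subseteq> S"
    unfolding \<rho>_def using y A S balls r diam yS
    by (elim half_ball_of_face[OF S(1) n _ yb balls(2) r, rotated 2]) auto
  obtain e' where e': "e' = n \<or> e' = - n" "{x \<in> cball y \<rho>. 0 \<le> e' \<bullet> (x - y)} \<subseteq> S'"
    unfolding \<rho>_def using y A S' balls r diam yS
    by (elim half_ball_of_face[OF S'(1) n _ yb balls(3) r, rotated 2]) auto
  have ne: "norm e = 1" "norm e' = 1" using e e' n by auto
  have "e' \<noteq> e"
  proof
    assume "e' = e"
    have "ball (y + (\<rho> / 2) *\<^sub>R e) (\<rho> / 2) \<subseteq> {x \<in> cball y \<rho>. 0 \<le> e \<bullet> (x - y)}"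
      by (rule ball_in_half_ball[OF ne(1) \<rho>])
    then have "ball (y + (\<rho> / 2) *\<^sub>R e) (\<rho> / 2) \<subseteq> interior K"
      "ball (y + (\<rho> / 2) *\<^sub>R e) (\<rho> / 2) \<subseteq> interior L"
      using e(2) e'(2) S(3) S'(3) \<open>e' = e\<close> by (intro interior_maximal; force)+
    then have "ball (y + (\<rho> / 2) *\<^sub>R e) (\<rho> / 2) = {}" using disj by blast
    then show False using \<rho> by simp
  qed
  then have "e' = - e" using e e' by auto
  then have "{x \<in> cball y \<rho>. e \<bullet> (x - y) \<le> 0} \<subseteq> L"
    using e'(2) S'(3) by auto
  then show ?thesis
    using that[of y e] e S y A ne unfolding \<rho>_def by blast
qed

subsection \<open>The face points lie on the faces\<close>

text \<open>Slabs of equal height over a base are translates of each other, so the mean height over a slab is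
  its midpoint: halving the slab repeatedly shows that the deviation scales linearly in the height,
  whereas it is trivially bounded by the height times the volume.\<close>

locale slab =
  fixes F :: "'a::euclidean_space set" and n :: 'a and b :: real
  assumes F: "compact F" "F \<subseteq> {x. n \<bullet> x = b}" and n: "norm n = 1"
begin

definition l :: "'a \<Rightarrow> real" where "l x = n \<bullet> x - b"
definition P :: "'a \<Rightarrow> 'a" where "P x = x - l x *\<^sub>R n"
text \<open>Half-open in height, so that consecutive slabs are disjoint and tile exactly.\<close>

definition H :: "real \<Rightarrow> real \<Rightarrow> 'a set" where "H s t = {x. s \<le> l x \<and> l x < t \<and> P x \<in> F}"

lemma nn: "n \<bullet> n = 1"
  using n by (simp add: dot_square_norm)

lemma l_shift [simp]: "l (x + s *\<^sub>R n) = l x + s"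
  by (simp add: l_def inner_add_right nn)

lemma P_shift [simp]: "P (x + s *\<^sub>R n) = P x"
  by (simp add: P_def scaleR_add_left)

lemma l_P [simp]: "l (P x) = 0"
  using l_shift[of x "- l x"] by (simp add: P_def)

lemma H_shift: "x + a *\<^sub>R n \<in> H (s + a) (t + a) \<longleftrightarrow> x \<in> H s t"
  by (simp add: H_def)

lemma continuous_l: "continuous_on S l"
  unfolding l_def[abs_def] by (intro continuous_intros)

lemma continuous_P: "continuous_on S P"
  unfolding P_def[abs_def] by (intro continuous_intros continuous_l)

lemma H_borel: "H s t \<in> sets borel"
proof -
  have "closed {x. P x \<in> F}"
    using continuous_closed_preimage[OF continuous_P closed_UNIV compact_imp_closed[OF F(1)]]
    by (simp add: vimage_def)
  moreover have "closed {x. s \<le> l x}"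
    by (intro closed_Collect_le continuous_on_const continuous_l)
  moreover have "open {x. l x < t}"
    by (intro open_Collect_less continuous_on_const continuous_l)
  ultimately have "{x. s \<le> l x} \<inter> {x. l x < t} \<inter> {x. P x \<in> F} \<in> sets borel"
    by (intro sets.Int) auto
  then show ?thesis by (simp add: H_def Int_def conj_assoc)
qed

lemma H_bounded: "bounded (H s t)"
proof -
  obtain R where R: "\<And>x. x \<in> F \<Longrightarrow> norm x \<le> R"
    using compact_imp_bounded[OF F(1)] by (auto simp: bounded_iff)
  have "norm x \<le> R + (\<bar>s\<bar> + \<bar>t\<bar>)" if "x \<in> H s t" for x
  proof -
    have "norm x \<le> norm (P x) + norm (l x *\<^sub>R n)"
      using norm_triangle_ineq[of "P x" "l x *\<^sub>R n"] by (simp add: P_def)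
    then show ?thesis
      using that R[of "P x"] n by (auto simp: H_def)
  qed
  then show ?thesis by (auto simp: bounded_iff)
qed

lemma H_integrable:
  fixes f :: "'a \<Rightarrow> real"
  assumes "continuous_on UNIV f"
  shows "integrable lborel (\<lambda>x. indicator (H s t) x * f x)"
proof (rule Bochner_Integration.integrable_bound)
  show "integrable lborel (\<lambda>x. indicator (closure (H s t)) x *\<^sub>R f x)"
    using H_bounded by (intro borel_integrable_compact continuous_on_subset[OF assms])
      (auto simp: compact_closure)
  show "(\<lambda>x. indicator (H s t) x * f x) \<in> borel_measurable lborel"
    using H_borel borel_measurable_continuous_onI[OF assms] by simp
  show "AE x in lborel. norm (indicator (H s t) x * f x) \<le> norm (indicator (closure (H s t)) x *\<^sub>R f x)"
    using closure_subset[of "H s t"] by (intro AE_I2) (auto simp: indicator_def)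
qed

lemma integral_shift:
  fixes f :: "'a \<Rightarrow> real"
  assumes "continuous_on UNIV f"
  shows "(LINT x|lborel. indicator (H (s + a) (t + a)) x * f x) = (LINT x|lborel. indicator (H s t) x * f (x + a *\<^sub>R n))"
proof -
  have "(LINT x|lborel. indicator (H (s + a) (t + a)) x * f x)
    = (LINT x|distr lborel borel ((+) (a *\<^sub>R n)). indicator (H (s + a) (t + a)) x * f x)"
    by (simp only: lborel_distr_plus)
  also have "\<dots> = (LINT x|lborel. indicator (H (s + a) (t + a)) (a *\<^sub>R n + x) * f (a *\<^sub>R n + x))"
    using H_borel borel_measurable_continuous_onI[OF assms] by (intro integral_distr) auto
  also have "\<dots> = (LINT x|lborel. indicator (H s t) x * f (x + a *\<^sub>R n))"
    by (intro Bochner_Integration.integral_cong) (auto simp: indicator_def H_shift add.commute[of "a *\<^sub>R n"])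
  finally show ?thesis .
qed

lemma integral_split:
  fixes f :: "'a \<Rightarrow> real"
  assumes "continuous_on UNIV f" "s \<le> m" "m \<le> t"
  shows "(LINT x|lborel. indicator (H s t) x * f x)
    = (LINT x|lborel. indicator (H s m) x * f x) + (LINT x|lborel. indicator (H m t) x * f x)"
proof -
  have "(LINT x|lborel. indicator (H s t) x * f x)
    = (LINT x|lborel. indicator (H s m) x * f x + indicator (H m t) x * f x)"
    using assms by (intro Bochner_Integration.integral_cong) (auto simp: indicator_def H_def)
  then show ?thesis
    by (simp add: Bochner_Integration.integral_add[OF H_integrable H_integrable] assms)
qed

lemma mean_height: "(LINT x|lborel. indicator (H (- 1) 1) x * l x) = 0"
proof -
  \<comment> \<open>The deviation of the integrated height from \<open>d / 2\<close> times the
    volume.\<close>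
  define E where "E d = (LINT x|lborel. indicator (H 0 d) x * (l x - d / 2))" for d
  define m where "m d = (LINT x|lborel. indicator (H 0 d) x * (1 :: real))" for d
  have cont: "continuous_on UNIV (\<lambda>x. l x - c)" for c
    by (intro continuous_intros continuous_l)
  \<comment> \<open>After the upper half is shifted down by \<open>d\<close>, the halves carry the
    integrands \<open>l x - d\<close> and \<open>l x\<close>, which add up to twice
    \<open>l x - d / 2\<close>.\<close>
  have E2: "E (2 * d) = 2 * E d" if "0 \<le> d" for d
  proof -
    have "E (2 * d) = (LINT x|lborel. indicator (H 0 d) x * (l x - d)) + (LINT x|lborel. indicator (H d (2 * d)) x * (l x - d))"
      unfolding E_def using that integral_split[OF cont, of 0 d "2 * d" d] by simp
    also have "(LINT x|lborel. indicator (H d (2 * d)) x * (l x - d)) = (LINT x|lborel. indicator (H 0 d) x * (l x - 0))"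
      using integral_shift[OF cont, of 0 d d d] by simp
    also have "(LINT x|lborel. indicator (H 0 d) x * (l x - d)) + (LINT x|lborel. indicator (H 0 d) x * (l x - 0))
      = (LINT x|lborel. 2 * (indicator (H 0 d) x * (l x - d / 2)))"
      by (subst Bochner_Integration.integral_add[OF H_integrable[OF cont] H_integrable[OF cont], symmetric])
         (simp add: algebra_simps)
    finally show ?thesis by (simp add: E_def)
  qed
  have m2: "m (2 * d) = 2 * m d" if "0 \<le> d" for d
    using that integral_split[of "\<lambda>_. 1" 0 d "2 * d"] integral_shift[of "\<lambda>_. 1" 0 d d] by (simp add: m_def)
  have Ek: "E (2 ^ k * d) = 2 ^ k * E d" and mk: "m (2 ^ k * d) = 2 ^ k * m d" if "0 \<le> d" for d k
    using that E2[of "2 ^ _ * d"] m2[of "2 ^ _ * d"] by (induction k; simp add: mult.assoc)+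
  have bd: "\<bar>E d\<bar> \<le> d * m d" if "0 \<le> d" for d
  proof -
    have "\<bar>E d\<bar> \<le> (LINT x|lborel. \<bar>indicator (H 0 d) x * (l x - d / 2)\<bar>)"
      unfolding E_def by (rule integral_abs_bound)
    also have "\<dots> \<le> (LINT x|lborel. d * (indicator (H 0 d) x * 1))"
      using that by (intro integral_mono integrable_abs H_integrable cont integrable_mult_right) 
        (auto simp: indicator_def H_def abs_le_iff)
    finally show ?thesis by (simp add: m_def)
  qed
  \<comment> \<open>At \<open>d = 2 * (1 / 2) ^ k\<close> the linear scaling of \<open>E\<close> and
    \<open>m\<close> turns the trivial bound into \<open>d * m 2\<close>, which tends to 0.\<close>
  have "\<bar>E 2\<bar> \<le> 2 * m 2 * (1 / 2) ^ k" for k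
  proof -
    define d where "d = 2 * (1 / 2 :: real) ^ k"
    have d: "0 \<le> d" "2 ^ k * d = 2" by (auto simp: d_def power_one_over)
    have "\<bar>E 2\<bar> = 2 ^ k * \<bar>E d\<bar>"
      using Ek[OF d(1), of k] d(2) by (simp add: abs_mult)
    also have "\<dots> \<le> 2 ^ k * (d * m d)"
      using bd[OF d(1)] by (intro mult_left_mono) auto
    also have "\<dots> = d * m 2"
      using mk[OF d(1), of k] d(2) by simp
    finally show ?thesis by (simp add: d_def mult_ac)
  qed
  moreover have "(\<lambda>k. 2 * m 2 * (1 / 2) ^ k) \<longlonglongrightarrow> 2 * m 2 * 0"
    by (intro tendsto_mult tendsto_const LIMSEQ_realpow_zero) auto
  ultimately have "\<bar>E 2\<bar> \<le> 2 * m 2 * 0"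
    by (intro LIMSEQ_le_const) auto
  then have "E 2 = 0" by simp
  moreover have "E 2 = (LINT x|lborel. indicator (H (- 1) 1) x * l x)"
    using integral_shift[OF cont, of "- 1" 1 1 1] l_shift[of _ 1] by (simp add: E_def)
  ultimately show ?thesis by simp
qed

text \<open>If a hyperplane separated the barycenter from \<open>F\<close>, integrate the
  functional: it splits into its value at the foot point \<open>P x\<close>, which lies in
  \<open>F\<close>, and a multiple of the height, whose mean is zero. The disc ensures that the
  thickening extends only along the normal and has positive volume.\<close>

lemma barycenter_mem:
  assumes conv: "convex F" and y: "y \<in> F" "{z. n \<bullet> z = b} \<inter> cball y r \<subseteq> F" and r: "0 < r"
  shows "barycenter F \<in> F"
proof -
  have lF: "l x = 0" if "x \<in> F" for x using that F by (auto simp: l_def)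
  have Th: "thickening F = {x. - 1 \<le> l x \<and> l x \<le> 1 \<and> P x \<in> F}"
  proof safe
    fix x assume "x \<in> thickening F"
    then obtain z w where x: "x = z + w" "z \<in> F" "norm w \<le> 1" "\<And>a c. a \<in> F \<Longrightarrow> c \<in> F \<Longrightarrow> w \<bullet> (a - c) = 0"
      unfolding thickening_def by auto
    define v where "v = w - (n \<bullet> w) *\<^sub>R n"
    have nv: "n \<bullet> v = 0" by (simp add: v_def inner_diff_right nn)
    \<comment> \<open>A component of \<open>w\<close> tangent to the hyperplane would be detected by
      the disc: moving from \<open>y\<close> by \<open>r\<close> along it stays in \<open>F\<close>,
      to whose directions \<open>w\<close> is orthogonal.\<close>
    have "v = 0"
    proof (rule ccontr)
      assume v0: "v \<noteq> 0"
      define z' where "z' = y + (r / norm v) *\<^sub>R v"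
      have "n \<bullet> z' = b" using y(1) F nv by (auto simp: z'_def inner_add_right)
      moreover have "dist y z' \<le> r" using v0 r by (simp add: z'_def dist_norm)
      ultimately have "z' \<in> F" using y(2) by auto
      then have "w \<bullet> (z' - y) = 0" using x(4) y(1) by blast
      then have "w \<bullet> v = 0" using v0 r by (simp add: z'_def)
      moreover have "w \<bullet> v = v \<bullet> v + (n \<bullet> w) * (n \<bullet> v)"
        by (simp add: v_def inner_diff_left inner_commute)
      ultimately show False using nv v0 by simp
    qed
    then have w: "w = (n \<bullet> w) *\<^sub>R n" by (simp add: v_def)
    then have "x = z + (n \<bullet> w) *\<^sub>R n" using x(1) by simp
    then have lx: "l x = n \<bullet> w" "P x = z"
      using lF[OF x(2)] by (simp_all) (simp_all add: P_def)
    have "\<bar>n \<bullet> w\<bar> \<le> 1" using Cauchy_Schwarz_ineq2[of n w] n x(3) by simp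
    then show "- 1 \<le> l x" "l x \<le> 1" "P x \<in> F" using lx x(2) by auto
  next
    fix x assume x: "- 1 \<le> l x" "l x \<le> 1" "P x \<in> F"
    have "n \<bullet> (a - c) = 0" if "a \<in> F" "c \<in> F" for a c
      using that F by (auto simp: inner_diff_right)
    moreover have "x = P x + l x *\<^sub>R n" by (simp add: P_def)
    moreover have "norm (l x *\<^sub>R n) \<le> 1" using x n by auto
    ultimately show "x \<in> thickening F"
      unfolding thickening_def using x(3) by (intro CollectI exI[of _ "P x"] exI[of _ "l x *\<^sub>R n"]) auto
  qed
  have closed: "closed (thickening F)"
  proof -
    have "closed {x. P x \<in> F}"
      using continuous_closed_preimage[OF continuous_P closed_UNIV compact_imp_closed[OF F(1)]]
      by (simp add: vimage_def)
    moreover have "closed {x. - 1 \<le> l x}" "closed {x. l x \<le> 1}"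
      by (intro closed_Collect_le continuous_on_const continuous_l)+
    ultimately have "closed ({x. - 1 \<le> l x} \<inter> {x. l x \<le> 1} \<inter> {x. P x \<in> F})" by auto
    then show ?thesis by (simp add: Th Int_def conj_assoc)
  qed
  have "thickening F \<subseteq> H (- 1) 2" by (auto simp: Th H_def)
  then have compact: "compact (thickening F)"
    using closed bounded_subset[OF H_bounded] by (simp add: compact_eq_bounded_closed)
  have pos: "0 < measure lebesgue (thickening F)"
  proof -
    have "ball y (min r 1) \<subseteq> thickening F"
    proof
      fix x assume x: "x \<in> ball y (min r 1)"
      have lx: "l x = n \<bullet> (x - y)" using y(1) F by (auto simp: l_def inner_diff_right)
      have "\<bar>l x\<bar> \<le> 1"
        unfolding lx using Cauchy_Schwarz_ineq2[of n "x - y"] n x by (simp add: dist_norm norm_minus_commute)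
      moreover have "P x \<in> F"
      proof -
        have "(norm (P x - y))\<^sup>2 = (norm (x - y))\<^sup>2 - (l x)\<^sup>2"
          unfolding P_def power2_norm_eq_inner lx
          by (simp add: inner_diff_left inner_diff_right nn inner_commute power2_eq_square algebra_simps)
        then have "(norm (P x - y))\<^sup>2 \<le> (norm (x - y))\<^sup>2" by simp
        then have "norm (P x - y) \<le> norm (x - y)" by (rule power2_le_imp_le) simp
        then have "P x \<in> cball y r" using x by (simp add: dist_norm norm_minus_commute)
        moreover have "n \<bullet> P x = b" using l_P[of x] by (simp add: l_def)
        ultimately show ?thesis using y(2) by blast
      qed
      ultimately show "x \<in> thickening F" by (simp add: Th abs_le_iff)
    qed
    then have "measure lebesgue (ball y (min r 1)) \<le> measure lebesgue (thickening F)"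
      using compact by (intro measure_mono_fmeasurable) (auto simp: lmeasurable_compact)
    moreover have "0 < measure lebesgue (ball y (min r 1))"
      using r content_ball_pos[of "min r 1" y] by simp
    ultimately show ?thesis by linarith
  qed
  define I where "I = (LINT x|lborel. indicator (thickening F) x *\<^sub>R x)"
  have Tb: "thickening F \<in> sets borel" using closed by auto
  have I: "(LINT x|lebesgue_on (thickening F). x) = I"
    unfolding I_def using Tb
    by (subst integral_restrict_space) (auto intro!: integral_completion)
  have intI: "integrable lborel (\<lambda>x. indicator (thickening F) x *\<^sub>R x)"
    by (intro borel_integrable_compact compact continuous_intros)
  have meas: "measure lebesgue (thickening F) = (LINT x|lborel. indicator (thickening F) x)"
    using Tb by simp
  have int1: "integrable lborel (\<lambda>x. indicator (thickening F) x :: real)"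
    using borel_integrable_compact[OF compact, of "\<lambda>_. 1 :: real"] by simp
  show ?thesis
  proof (rule ccontr)
    assume "barycenter F \<notin> F"
    then obtain a \<beta> where a: "a \<bullet> barycenter F < \<beta>" "\<And>x. x \<in> F \<Longrightarrow> \<beta> < a \<bullet> x"
      using separating_hyperplane_closed_point[OF conv compact_imp_closed[OF F(1)]] by metis
    \<comment> \<open>The thickening is closed at height 1 and the slab is half-open; they differ by
      part of a hyperplane.\<close>
    have null: "AE x in lborel. l x \<noteq> 1"
    proof (rule AE_I')
      have "negligible {x. n \<bullet> x = b + 1}"
        using nn by (intro negligible_hyperplane) auto
      then show "{x. n \<bullet> x = b + 1} \<in> null_sets lborel"
        by (auto simp: negligible_iff_null_sets null_sets_completion_iff)
      show "{x \<in> space lborel. \<not> l x \<noteq> 1} \<subseteq> {x. n \<bullet> x = b + 1}"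
        by (auto simp: l_def)
    qed
    have "(LINT x|lborel. indicator (thickening F) x * l x) = (LINT x|lborel. indicator (H (- 1) 1) x * l x)"
    proof (rule integral_cong_AE)
      show "AE x in lborel. indicator (thickening F) x * l x = indicator (H (- 1) 1) x * l x"
        using null by eventually_elim (auto simp: indicator_def H_def Th)
    qed (use Tb H_borel borel_measurable_continuous_onI[OF continuous_l] in auto)
    then have l0: "(LINT x|lborel. indicator (thickening F) x * l x) = 0"
      by (simp add: mean_height)
    have intl: "integrable lborel (\<lambda>x. indicator (thickening F) x * l x)"
      using borel_integrable_compact[OF compact continuous_l] by simp
    have "continuous_on (thickening F) (\<lambda>x. a \<bullet> P x - \<beta>)"
      by (intro continuous_intros continuous_P)
    then have inta: "integrable lborel (\<lambda>x. indicator (thickening F) x * (a \<bullet> P x - \<beta>))"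
      using borel_integrable_compact[OF compact] by fastforce
    have "a \<bullet> I = (LINT x|lborel. a \<bullet> (indicator (thickening F) x *\<^sub>R x))"
      unfolding I_def by (rule integral_inner_right[OF intI, symmetric])
    also have "\<dots> = (LINT x|lborel. indicator (thickening F) x * (a \<bullet> P x - \<beta>)
        + ((a \<bullet> n) * (indicator (thickening F) x * l x) + \<beta> * indicator (thickening F) x))"
      by (intro Bochner_Integration.integral_cong) (auto simp: P_def inner_diff_right algebra_simps)
    also have "\<dots> = (LINT x|lborel. indicator (thickening F) x * (a \<bullet> P x - \<beta>))
        + ((a \<bullet> n) * 0 + \<beta> * measure lebesgue (thickening F))"
      unfolding meas l0[symmetric] using inta intl int1
      by (simp only: Bochner_Integration.integral_add integral_mult_right_zero
          integrable_mult_right Bochner_Integration.integrable_add)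
    also have "\<dots> \<ge> \<beta> * measure lebesgue (thickening F)"
    proof -
      have "0 \<le> (LINT x|lborel. indicator (thickening F) x * (a \<bullet> P x - \<beta>))"
        using a(2) by (intro integral_nonneg_AE AE_I2) (auto simp: indicator_def Th less_imp_le)
      then show ?thesis by simp
    qed
    finally have "\<beta> * measure lebesgue (thickening F) \<le> a \<bullet> I" by simp
    then have "\<beta> \<le> (a \<bullet> I) / measure lebesgue (thickening F)"
      using pos by (simp add: pos_le_divide_eq)
    also have "\<dots> = a \<bullet> barycenter F"
      by (simp add: barycenter_def I)
    finally show False using a(1) by simp
  qed
qed

end

subsection \<open>Elements and their faces\<close>

lemma convex_hull_insert_convex_hull: "convex hull (insert w (convex hull A)) = convex hull (insert w A)"
  using hull_insert[of convex w A] by simp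

lemma facets_of_simplex:
  assumes "F facet_of (convex hull C)" "\<not> affine_dependent C"
  obtains u where "u \<in> C" "F = convex hull (C - {u})"
  using assms facet_of_convex_hull_affine_independent by blast

text \<open>A vertex is the intersection of the facets through it. In a plane polytope these are
  segments, so a single one would not cut down to a point.\<close>

lemma two_edges_at_vertex:
  fixes F :: "'a::euclidean_space set"
  assumes F: "polytope F" "aff_dim F = 2" and v: "v extreme_point_of F"
  obtains w1 w2 where "w1 \<noteq> w2" "closed_segment v w1 edge_of F" "closed_segment v w2 edge_of F"
proof -
  have edge: "\<exists>w. E = closed_segment v w" if E: "E facet_of F" "v \<in> E" for E
  proof -
    have face: "E face_of F" "aff_dim E = 1" using E F(2) by (auto simp: facet_of_def)
    then have "polytope E" using face_of_polytope_polytope F(1) by blast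
    moreover have "collinear E" using face(2) by (simp add: collinear_aff_dim)
    ultimately obtain p q where pq: "E = closed_segment p q"
      using E(2) compact_convex_collinear_segment[of E] polytope_imp_compact polytope_imp_convex by blast
    have "v extreme_point_of closed_segment p q"
      using extreme_point_of_face[OF face(1)] v E(2) pq by blast
    then have "v = p \<or> v = q" unfolding extreme_point_of_segment .
    then show ?thesis unfolding pq using closed_segment_commute by blast
  qed
  define \<E> where "\<E> = {E. E facet_of F \<and> {v} \<subseteq> E}"
  have "{v} \<noteq> F" using F(2) by auto
  then have Int: "{v} = \<Inter>\<E>"
    unfolding \<E>_def using v F(1)
    by (intro face_of_polyhedron) (auto simp: face_of_singleton polytope_imp_polyhedron)
  have "\<E> \<noteq> {}"
  proof
    assume "\<E> = {}"
    then have "{v} = UNIV" using Int by auto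
    then have "aff_dim F \<le> 0"
      by (metis aff_dim_sing aff_dim_subset subset_UNIV)
    then show False using F(2) by simp
  qed
  then obtain E1 where E1: "E1 \<in> \<E>" by blast
  have "\<exists>E2\<in>\<E>. E2 \<noteq> E1"
  proof (rule ccontr)
    assume "\<not> ?thesis"
    then have "\<E> = {E1}" using E1 by blast
    then have "E1 = {v}" using Int by auto
    then show False using E1 F(2) by (auto simp: \<E>_def facet_of_def)
  qed
  then obtain E2 where E2: "E2 \<in> \<E>" "E2 \<noteq> E1" by blast
  have "E1 facet_of F" "v \<in> E1" "E2 facet_of F" "v \<in> E2"
    using E1 E2(1) by (auto simp: \<E>_def)
  then obtain w1 w2 where w: "E1 = closed_segment v w1" "E2 = closed_segment v w2"
    using edge[of E1] edge[of E2] by metis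
  show ?thesis
  proof
    show "w1 \<noteq> w2" using w E2(2) by blast
    show "closed_segment v w1 edge_of F" "closed_segment v w2 edge_of F"
      using E1 E2(1) F(2) unfolding w \<E>_def by (auto simp: facet_of_def edge_of_def)
  qed
qed

text \<open>At a vertex of \<open>F\<close>, two of the three neighbours are joined to it by edges
  of \<open>F\<close>; the third is the apex. The corner tetrahedron is thus a cone over a triangle
  in \<open>F\<close>, the form needed for \<open>cone_contains_disc\<close>.\<close>

lemma hexahedron_corner_at_face:
  fixes K :: "'a::euclidean_space set"
  assumes K: "hexahedron K" and F: "F facet_of K"
  obtains A w where "convex A" "A \<subseteq> F" "convex hull (insert w A) \<in> corner_simplices Hexahedron K"
    "convex hull (insert w A) \<subseteq> K"
proof -
  have poly: "polytope K" and dim: "aff_dim K = 3"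
    and nb: "\<And>v. v extreme_point_of K \<Longrightarrow> card (neighbours K v) = 3"
    using K by (auto simp: hexahedron_def)
  have face: "F face_of K" "F \<noteq> {}" "aff_dim F = 2" using F dim by (auto simp: facet_of_def)
  have polyF: "polytope F" using face_of_polytope_polytope poly face(1) by blast
  obtain v where v: "v extreme_point_of F"
    using extreme_point_exists_convex polytope_imp_compact polytope_imp_convex polyF face(2) by blast
  obtain w1 w2 where w: "w1 \<noteq> w2" "closed_segment v w1 edge_of F" "closed_segment v w2 edge_of F"
    using two_edges_at_vertex[OF polyF face(3) v] .
  have vK: "v extreme_point_of K" using extreme_point_of_face[OF face(1)] v by blast
  have nbr: "w1 \<in> neighbours K v" "w2 \<in> neighbours K v"
    using w(2,3) face(1) face_of_trans by (auto simp: neighbours_def edge_of_def)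
  have "finite (neighbours K v)" using nb[OF vK] by (simp add: card_ge_0_finite)
  then have "card (neighbours K v - {w1, w2}) = 1"
    using nbr w(1) nb[OF vK] by (subst card_Diff_subset) auto
  then obtain w3 where "neighbours K v - {w1, w2} = {w3}"
    by (auto simp: card_1_singleton_iff)
  then have N: "insert w3 {v, w1, w2} = insert v (neighbours K v)" using nbr by blast
  have N_sub: "neighbours K v \<subseteq> K"
    by (auto simp: neighbours_def dest: edge_of_imp_subset)
  have wF: "{v, w1, w2} \<subseteq> F"
    using w(2,3)[THEN edge_of_imp_subset] by auto
  have eq: "convex hull (insert w3 (convex hull {v, w1, w2})) = convex hull (insert v (neighbours K v))"
    unfolding convex_hull_insert_convex_hull N ..
  show ?thesis
  proof
    show "convex (convex hull {v, w1, w2})" by simp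
    show "convex hull {v, w1, w2} \<subseteq> F"
      by (intro hull_minimal wF) (use polyF polytope_imp_convex in blast)
    show "convex hull (insert w3 (convex hull {v, w1, w2})) \<in> corner_simplices Hexahedron K"
      unfolding eq using vK by auto
    show "convex hull (insert w3 (convex hull {v, w1, w2})) \<subseteq> K"
      unfolding eq using N_sub vK polytope_imp_convex[OF poly]
      by (intro hull_minimal) (auto simp: extreme_point_of_def)
  qed
qed

text \<open>Only the two triangles of the diagonal \<open>ac\<close> are offered: they lie in
  \<open>K\<close> and together contain all four edges, whereas the corner triangle at a reflex
  vertex does not lie in \<open>K\<close>.\<close>

lemma quadrilateral_edge_cases:
  assumes "E \<in> quad_edges K"
  obtains a b c where "E = closed_segment a b" "convex hull {a, b, c} \<subseteq> K"
    "convex hull {a, b, c} \<in> corner_simplices Quadrilateral K"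
proof -
  obtain a b c d where q: "quadrilateral a b c d K"
    and E: "E \<in> {closed_segment a b, closed_segment b c, closed_segment c d, closed_segment d a}"
    using assms unfolding quad_edges_def by blast
  have K: "convex hull {a, b, c} \<subseteq> K" "convex hull {a, c, d} \<subseteq> K"
    using q by (auto simp: quadrilateral_def)
  have corner: "convex hull {a, b, c} \<in> corner_simplices Quadrilateral K"
    "convex hull {c, d, a} \<in> corner_simplices Quadrilateral K"
    using q by (auto intro!: exI)
  have perm: "{b, c, a} = {a, b, c}" "{c, d, a} = {a, c, d}" "{d, a, c} = {a, c, d}" by auto
  from E consider "E = closed_segment a b" | "E = closed_segment b c" | "E = closed_segment c d"
    | "E = closed_segment d a" by blast
  then show ?thesis
  proof cases
    case 1 then show ?thesis using that K corner by blast
  next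
    case 2 then show ?thesis using that[of b c a] K corner by (simp only: perm)
  next
    case 3 then show ?thesis using that[of c d a] K corner by (simp only: perm)
  next
    case 4 then show ?thesis using that[of d a c] K corner by (simp only: perm)
  qed
qed

definition shape_in_dim :: "nat \<Rightarrow> shape \<Rightarrow> bool" where
  "shape_in_dim n k \<longleftrightarrow> n = 2 \<and> k \<in> {Triangle, Quadrilateral} \<or> n = 3 \<and> k \<in> {Tetrahedron, Hexahedron}"

lemma shape_in_dim_cases:
  assumes "is_element k (K :: 'a::euclidean_space set)" "shape_in_dim DIM('a) k"
  obtains (simplex) C where "k = Triangle \<or> k = Tetrahedron" "\<not> affine_dependent C"
      "card C = DIM('a) + 1" "K = convex hull C" "aff_dim K = DIM('a)"
    | (quad) "k = Quadrilateral" "DIM('a) = 2" "\<exists>a b c d. quadrilateral a b c d K"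
    | (hex) "k = Hexahedron" "DIM('a) = 3" "hexahedron K"
proof (cases k)
  case Triangle
  then have "2 simplex K" "DIM('a) = 2" using assms by (auto simp: shape_in_dim_def)
  then show ?thesis using simplex(1) Triangle aff_dim_simplex[of 2 K] by (auto simp: simplex_def)
next
  case Tetrahedron
  then have "3 simplex K" "DIM('a) = 3" using assms by (auto simp: shape_in_dim_def)
  then show ?thesis using simplex(1) Tetrahedron aff_dim_simplex[of 3 K] by (auto simp: simplex_def)
qed (use assms quad hex in \<open>auto simp: shape_in_dim_def\<close>)

text \<open>The common interface to all shapes. \<open>S\<close> is a convex part of
  \<open>K\<close> containing the face: \<open>K\<close> itself, or one of the two triangles of a
  quadrilateral. The base \<open>A\<close> of the corner simplex is the whole face except for a
  hexahedron, where it is a triangle in it.\<close>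

lemma element_face_structure:
  fixes K :: "'a::euclidean_space set"
  assumes el: "is_element k K" and F: "F \<in> element_faces k K" and dim: "shape_in_dim DIM('a) k"
  obtains S A w where "convex S" "compact S" "F \<subseteq> S" "S \<subseteq> K" "convex A" "A \<subseteq> F"
    "convex hull (insert w A) \<in> corner_simplices k K" "convex hull (insert w A) \<subseteq> S"
  using el dim
proof (cases rule: shape_in_dim_cases)
  case (simplex C)
  then have "F facet_of (convex hull C)" using F by (auto simp: element_faces_def split: if_splits)
  then obtain u where u: "u \<in> C" "F = convex hull (C - {u})"
    using facets_of_simplex simplex(2) by blast
  have K: "convex hull (insert u F) = K"
    unfolding u(2) convex_hull_insert_convex_hull using u(1) simplex(4) by (simp add: insert_absorb)
  have "finite C" using aff_independent_finite simplex(2) by blast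
  then have "compact K" by (simp add: simplex(4) finite_imp_compact_convex_hull)
  moreover have "F \<subseteq> K" unfolding u(2) simplex(4) by (intro hull_mono) auto
  ultimately show ?thesis
    using that[of K F u] K u simplex by auto
next
  case quad
  then have "F \<in> quad_edges K" using F by (simp add: element_faces_def)
  then obtain a b c where abc: "F = closed_segment a b" "convex hull {a, b, c} \<subseteq> K"
    "convex hull {a, b, c} \<in> corner_simplices Quadrilateral K"
    by (rule quadrilateral_edge_cases)
  have eq: "convex hull (insert c F) = convex hull {a, b, c}"
    unfolding abc(1) segment_convex_hull convex_hull_insert_convex_hull by (simp add: insert_commute)
  have "F \<subseteq> convex hull (insert c F)" by (meson hull_subset subset_insertI subset_trans)
  then show ?thesis
    using that[of "convex hull {a, b, c}" F c] abc eq quad(1)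
    by (simp add: finite_imp_compact_convex_hull)
next
  case hex
  then have facet: "F facet_of K" using F by (simp add: element_faces_def)
  have "polytope K" using hex(3) by (simp add: hexahedron_def)
  then have K: "convex K" "compact K" "F \<subseteq> K"
    using facet polytope_imp_convex polytope_imp_compact facet_of_imp_subset by blast+
  obtain A w where "convex A" "A \<subseteq> F" "convex hull (insert w A) \<in> corner_simplices Hexahedron K"
    "convex hull (insert w A) \<subseteq> K"
    by (rule hexahedron_corner_at_face[OF hex(3) facet])
  then show ?thesis using that[of K A w] K hex(1) by blast
qed

lemma element_face_props:
  fixes K :: "'a::euclidean_space set"
  assumes el: "is_element k K" and F: "F \<in> element_faces k K" and dim: "shape_in_dim DIM('a) k"
  shows "convex F" "compact F" "F \<noteq> {}" "aff_dim F < DIM('a)"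
    and "DIM('a) = 2 \<Longrightarrow> \<exists>a b. F = closed_segment a b"
proof -
  have "convex F \<and> compact F \<and> F \<noteq> {} \<and> aff_dim F < DIM('a) \<and> (DIM('a) = 2 \<longrightarrow> (\<exists>a b. F = closed_segment a b))"
    using el dim
  proof (cases rule: shape_in_dim_cases)
    case (simplex C)
    then have facet: "F facet_of K" using F by (auto simp: element_faces_def split: if_splits)
    have "finite C" using aff_independent_finite simplex(2) by blast
    then have "polytope K" using simplex(4) by (simp add: polytope_convex_hull)
    then have "polytope F" using facet facet_of_imp_face_of face_of_polytope_polytope by blast
    moreover have d: "aff_dim F = DIM('a) - 1" "F \<noteq> {}" using facet simplex(5) by (auto simp: facet_of_def)
    moreover have "\<exists>a b. F = closed_segment a b" if "DIM('a) = 2"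
    proof -
      have "collinear F" using d that by (simp add: collinear_aff_dim)
      then show ?thesis
        using compact_convex_collinear_segment[of F] d(2) \<open>polytope F\<close>
          polytope_imp_convex polytope_imp_compact by metis
    qed
    ultimately show ?thesis
      using polytope_imp_convex polytope_imp_compact by auto
  next
    case quad
    then have "F \<in> quad_edges K" using F by (simp add: element_faces_def)
    then obtain a b where "F = closed_segment a b" by (rule quadrilateral_edge_cases)
    moreover from this have "aff_dim F \<le> 1"
      by (simp add: collinear_aff_dim[symmetric])
    ultimately show ?thesis using quad(2) by auto
  next
    case hex
    then have facet: "F facet_of K" using F by (simp add: element_faces_def)
    have "polytope K" "aff_dim K = 3" using hex(3) by (auto simp: hexahedron_def)
    moreover from this have "polytope F" using facet facet_of_imp_face_of face_of_polytope_polytope by blast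
    ultimately show ?thesis
      using hex(2) facet polytope_imp_convex polytope_imp_compact by (auto simp: facet_of_def)
  qed
  then show "convex F" "compact F" "F \<noteq> {}" "aff_dim F < DIM('a)"
    and "DIM('a) = 2 \<Longrightarrow> \<exists>a b. F = closed_segment a b" by auto
qed

lemma element_compact_frontier:
  fixes K :: "'a::euclidean_space set"
  assumes el: "is_element k K" and dim: "shape_in_dim DIM('a) k"
  shows "compact K" "negligible (frontier K)"
proof -
  have "compact K \<and> negligible (frontier K)"
    using el dim
  proof (cases rule: shape_in_dim_cases)
    case (simplex C)
    then show ?thesis
      using aff_independent_finite negligible_convex_frontier
      by (auto simp: finite_imp_compact_convex_hull)
  next
    case quad
    then obtain a b c d where K: "K = convex hull {a, b, c} \<union> convex hull {a, c, d}"
      by (auto simp: quadrilateral_def)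
    have "negligible (frontier (convex hull {a, b, c}) \<union> frontier (convex hull {a, c, d}))"
      by (intro negligible_Un negligible_convex_frontier convex_convex_hull)
    then have "negligible (frontier K)"
      unfolding K by (rule negligible_subset) (rule frontier_Un_subset)
    then show ?thesis unfolding K by (auto simp: finite_imp_compact_convex_hull intro!: compact_Un)
  next
    case hex
    then show ?thesis
      using polytope_imp_compact polytope_imp_convex negligible_convex_frontier by (auto simp: hexahedron_def)
  qed
  then show "compact K" "negligible (frontier K)" by auto
qed

lemma polytope_edge_exists:
  fixes P :: "'a::euclidean_space set"
  assumes "polytope P" "aff_dim P = int (Suc d)"
  shows "\<exists>E. E edge_of P"
  using assms
proof (induction d arbitrary: P)
  case 0
  then show ?case by (auto simp: edge_of_def intro!: exI[of _ P] face_of_refl polytope_imp_convex)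
next
  case (Suc d)
  then obtain F where F: "F facet_of P" using polytope_facet_exists[of P] by auto
  then have "polytope F" "aff_dim F = int (Suc d)"
    using Suc.prems facet_of_imp_face_of face_of_polytope_polytope by (auto simp: facet_of_def)
  then obtain E where "E edge_of F" using Suc.IH by blast
  then show ?case
    using facet_of_imp_face_of[OF F] face_of_trans by (auto simp: edge_of_def)
qed

text \<open>Makes the infimum in \<open>min_edge_length\<close> range over a nonempty set and bounds
  it by the diameter of each element.\<close>

lemma element_edge_exists:
  fixes K :: "'a::euclidean_space set"
  assumes el: "is_element k K" and dim: "shape_in_dim DIM('a) k"
  shows "\<exists>E\<in>element_edges k K. E \<subseteq> K"
  using el dim
proof (cases rule: shape_in_dim_cases)
  case (simplex C)
  have "finite C" using aff_independent_finite simplex(2) by blast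
  then have "polytope K" using simplex(4) by (simp add: polytope_convex_hull)
  moreover obtain m where "DIM('a) = Suc m" using DIM_positive[where 'a='a] by (metis Suc_pred)
  ultimately obtain E where "E edge_of K" using polytope_edge_exists[of K m] simplex(5) by auto
  then show ?thesis
    using simplex(1) edge_of_imp_subset by (auto simp: element_edges_def)
next
  case quad
  then obtain a b c d where q: "quadrilateral a b c d K" by blast
  then have "closed_segment a b \<in> quad_edges K" by (auto simp: quad_edges_def)
  moreover have "closed_segment a b \<subseteq> convex hull {a, b, c}"
    unfolding segment_convex_hull by (intro hull_mono) auto
  then have "closed_segment a b \<subseteq> K" using q by (auto simp: quadrilateral_def)
  ultimately show ?thesis using quad(1) by (auto simp: element_edges_def)
next
  case hex
  then obtain E where "E edge_of K" using polytope_edge_exists[of K 2] by (auto simp: hexahedron_def)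
  then show ?thesis
    using hex(1) edge_of_imp_subset by (auto simp: element_edges_def)
qed

subsection \<open>The number of faces of an element\<close>

text \<open>If \<open>a\<close> is reflex, the hull of \<open>K\<close> is the triangle
  \<open>bcd\<close>, and the pocket left out by \<open>K\<close> is the triangle \<open>abd\<close>
  without two of its sides. The left-hand side depends on \<open>K\<close> alone, so the reflex
  vertex is recovered without reference to a labelling.\<close>

lemma closure_hull_minus_quadrilateral:
  assumes q: "quadrilateral a b c d K" and a: "\<not> a extreme_point_of (convex hull {a, b, c, d})"
  shows "closure (convex hull K - K) = convex hull {a, b, d}"
proof -
  have nc: "\<not> collinear {d, a, b}" "\<not> collinear {b, c, d}"
    and K: "K = convex hull {a, b, c} \<union> convex hull {a, c, d}"
    using q by (auto simp: quadrilateral_def)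
  have ind: "\<not> affine_dependent {b, c, d}" "\<not> affine_dependent {a, b, d}"
    using nc by (auto simp: collinear_3_eq_affine_dependent insert_commute)
  have abcd: "a \<in> convex hull {b, c, d}"
    using extreme_point_of_convex_hull_insert[of "{b, c, d}" a] a by auto
  have hullK: "convex hull K = convex hull {b, c, d}"
  proof
    have "{a, b, c, d} \<subseteq> convex hull {b, c, d}" using abcd by (auto intro: hull_inc)
    then have "convex hull {a, b, c} \<subseteq> convex hull {b, c, d}" "convex hull {a, c, d} \<subseteq> convex hull {b, c, d}"
      by (intro hull_minimal; simp)+
    then show "convex hull K \<subseteq> convex hull {b, c, d}"
      unfolding K by (intro hull_minimal) auto
    have "b \<in> K" "c \<in> K" "d \<in> K" unfolding K by (auto intro: hull_inc)
    then show "convex hull {b, c, d} \<subseteq> convex hull K" by (intro hull_mono) auto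
  qed
  have ne: "b \<noteq> c" "b \<noteq> d" "c \<noteq> d"
    using nc by (auto simp: collinear_3_eq_affine_dependent)
  define Tr where "Tr = convex hull {a, b, d}"
  have Un: "convex hull {b, c, d} = K \<union> Tr"
  proof -
    have "{b, c, d} - {b} = {c, d}" "{b, c, d} - {c} = {b, d}" "{b, c, d} - {d} = {b, c}" using ne by auto
    then show ?thesis
      unfolding convex_hull_exchange_Union[OF abcd] K Tr_def by auto
  qed
  have "convex hull (insert a {b, d}) \<inter> convex hull (insert a {b, c}) = convex hull (insert a ({b, d} \<inter> {b, c}))"
    "convex hull (insert a {b, d}) \<inter> convex hull (insert a {c, d}) = convex hull (insert a ({b, d} \<inter> {c, d}))"
    by (rule convex_hull_exchange_Int[OF ind(1) abcd]; blast)+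
  moreover have "{b, d} \<inter> {b, c} = {b}" "{b, d} \<inter> {c, d} = {d}" using ne by auto
  ultimately have Int: "Tr \<inter> K = convex hull {a, b} \<union> convex hull {a, d}"
    unfolding K Tr_def Int_Un_distrib by (simp only:)
  have D: "convex hull K - K = Tr - (convex hull {a, b} \<union> convex hull {a, d})"
    unfolding hullK Un using Int by blast
  have "rel_interior Tr \<subseteq> convex hull K - K"
  proof -
    have face: "convex hull {a, b} face_of Tr" "convex hull {a, d} face_of Tr"
      unfolding Tr_def face_of_convex_hull_affine_independent[OF ind(2)]
      by (rule exI[of _ "{a, b}"], simp) (rule exI[of _ "{a, d}"], simp)
    have "convex hull {a, x} \<noteq> Tr" if "x \<in> {b, d}" for x
    proof
      assume "convex hull {a, x} = Tr"
      then have "{a, b, d} \<subseteq> closed_segment a x"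
        unfolding Tr_def segment_convex_hull using hull_subset[of "{a, b, d}" convex] by blast
      then have "collinear {a, b, d}" by (rule collinear_subset[OF collinear_closed_segment])
      then show False using nc(1) by (simp add: insert_commute)
    qed
    then have "convex hull {a, b} \<inter> rel_interior Tr = {}" "convex hull {a, d} \<inter> rel_interior Tr = {}"
      using face_of_disjoint_rel_interior face by blast+
    then show ?thesis unfolding D using rel_interior_subset by blast
  qed
  then have "closure (rel_interior Tr) \<subseteq> closure (convex hull K - K)" by (rule closure_mono)
  moreover have "closure (rel_interior Tr) = Tr"
    unfolding Tr_def by (simp add: convex_closure_rel_interior finite_imp_compact_convex_hull compact_imp_closed)
  moreover have "closure (convex hull K - K) \<subseteq> Tr"
    unfolding D Tr_def by (intro closure_minimal) (auto simp: finite_imp_compact_convex_hull compact_imp_closed)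
  ultimately show ?thesis unfolding Tr_def by blast
qed

lemma quadrilateral_swap:
  assumes "quadrilateral a b c d K"
  shows "quadrilateral c b a d K" "quadrilateral a d c b K"
proof -
  have eqs: "{d, c, b} = {b, c, d}" "{c, b, a} = {a, b, c}" "{b, a, d} = {d, a, b}" "{a, d, c} = {c, d, a}"
    "{c, a, d} = {a, c, d}" "{c, d, a} = {a, c, d}" "{a, c, b} = {a, b, c}" by auto
  show "quadrilateral c b a d K"
    using assms unfolding quadrilateral_def eqs closed_segment_commute[of c a] by blast
  show "quadrilateral a d c b K"
    using assms unfolding quadrilateral_def eqs
    by (simp only: Int_commute Un_commute) simp
qed

text \<open>Every labelling draws its vertices from one set: the at most 4 extreme points of the
  hull and, if some vertex is not extreme, the 3 corners of the pocket. The crude 7 spares a proof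
  that labellings agree up to symmetry.\<close>

lemma quadrilateral_vertices:
  fixes K :: "'a::euclidean_space set"
  obtains W where "finite W" "card W \<le> 7" "\<And>a b c d. quadrilateral a b c d K \<Longrightarrow> {a, b, c, d} \<subseteq> W"
proof (cases "\<exists>a b c d. quadrilateral a b c d K")
  case False
  then show ?thesis using that[of "{}"] by auto
next
  case True
  define E where "E = {x. x extreme_point_of (convex hull K)}"
  define G where "G = {x. x extreme_point_of (closure (convex hull K - K))}"
  have hullK: "convex hull K = convex hull {a, b, c, d}" if "quadrilateral a b c d K" for a b c d
  proof
    have K: "K = convex hull {a, b, c} \<union> convex hull {a, c, d}" using that by (simp add: quadrilateral_def)
    have "convex hull {a, b, c} \<subseteq> convex hull {a, b, c, d}" "convex hull {a, c, d} \<subseteq> convex hull {a, b, c, d}"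
      by (intro hull_mono; blast)+
    then show "convex hull K \<subseteq> convex hull {a, b, c, d}"
      unfolding K by (intro hull_minimal) auto
    have "{a, b, c, d} \<subseteq> K" unfolding K by (auto intro: hull_inc)
    then show "convex hull {a, b, c, d} \<subseteq> convex hull K" by (rule hull_mono)
  qed
  have non: "x \<in> G \<and> finite G \<and> card G \<le> 3"
    if q: "quadrilateral a b c d K" and x: "x \<in> {a, b, c, d}" "x \<notin> E" for a b c d x
  proof -
    have *: "a \<in> G \<and> finite G \<and> card G \<le> 3" if q: "quadrilateral a b c d K" and a: "a \<notin> E" for a b c d
    proof -
      have cl: "closure (convex hull K - K) = convex hull {a, b, d}"
        using closure_hull_minus_quadrilateral[OF q] a hullK[OF q] by (simp add: E_def)
      have "\<not> collinear {d, a, b}" using q by (simp add: quadrilateral_def)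
      then have "\<not> affine_dependent {a, b, d}"
        by (auto simp: collinear_3_eq_affine_dependent insert_commute)
      then have "G = {a, b, d}"
        unfolding G_def cl by (auto simp: extreme_point_of_convex_hull_affine_independent)
      then show ?thesis using card_insert_le_m1[of 3 "{b, d}" a] card_insert_le_m1[of 2 "{d}" b] by auto
    qed
    \<comment> \<open>A vertex off the diagonal is always extreme: otherwise it would lie in both
      triangles, hence on the diagonal.\<close>
    have b: "b \<in> E" if q: "quadrilateral a b c d K" for a b c d
    proof (rule ccontr)
      assume "b \<notin> E"
      then have "\<not> b extreme_point_of (convex hull (insert b {a, c, d}))"
        using hullK[OF q] by (simp add: E_def insert_commute)
      then have "b \<in> convex hull {a, c, d}"
        using extreme_point_of_convex_hull_insert[of "{a, c, d}" b] by auto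
      moreover have "b \<in> convex hull {a, b, c}" by (auto intro: hull_inc)
      ultimately have "b \<in> closed_segment a c" using q by (auto simp: quadrilateral_def)
      then have "collinear {a, b, c}"
        by (intro collinear_subset[OF collinear_closed_segment[of a c]]) auto
      then show False using q by (simp add: quadrilateral_def)
    qed
    have "x = a \<or> x = c"
      using x b[OF q] b[OF quadrilateral_swap(2)[OF q]] by auto
    then show ?thesis
      using *[OF q] *[OF quadrilateral_swap(1)[OF q]] x(2) by auto
  qed
  have E: "finite E" "card E \<le> 4"
  proof -
    obtain a b c d where "quadrilateral a b c d K" using True by blast
    then have sub: "E \<subseteq> {a, b, c, d}"
      using extreme_points_of_convex_hull[of "{a, b, c, d}"] hullK by (auto simp: E_def)
    then show "finite E" by (rule finite_subset) simp
    have "card {a, b, c, d} \<le> 4"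
      using card_length[of "[a, b, c, d]"] by simp
    then show "card E \<le> 4" using card_mono[OF _ sub] by simp
  qed
  show ?thesis
  proof (cases "\<exists>a b c d. quadrilateral a b c d K \<and> \<not> {a, b, c, d} \<subseteq> E")
    case True
    then have "finite G" "card G \<le> 3" using non by blast+
    then have "finite (E \<union> G)" "card (E \<union> G) \<le> 7"
      using E card_Un_le[of E G] by auto
    then show ?thesis using that[of "E \<union> G"] non by blast
  next
    case False
    then show ?thesis using that[of E] E by auto
  qed
qed

text \<open>49 counts the pairs of the 7 candidate vertices of a quadrilateral; a simplex has at
  most 4 faces here and a hexahedron 6.\<close>

lemma element_faces_card:
  fixes K :: "'a::euclidean_space set"
  assumes el: "is_element k K" and dim: "shape_in_dim DIM('a) k"
  shows "finite (element_faces k K)" "card (element_faces k K) \<le> 49"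
proof -
  have "finite (element_faces k K) \<and> card (element_faces k K) \<le> 49"
    using el dim
  proof (cases rule: shape_in_dim_cases)
    case (simplex C)
    have fin: "finite C" using aff_independent_finite simplex(2) by blast
    have "element_faces k K \<subseteq> (\<lambda>u. convex hull (C - {u})) ` C"
      using simplex facets_of_simplex[OF _ simplex(2)] by (auto simp: element_faces_def)
    moreover have "card C \<le> 4" using simplex(3) dim by (auto simp: shape_in_dim_def)
    ultimately show ?thesis
      using fin card_mono[of "(\<lambda>u. convex hull (C - {u})) ` C" "element_faces k K"]
        card_image_le[of C "\<lambda>u. convex hull (C - {u})"] finite_subset[of "element_faces k K"] by force
  next
    case quad
    obtain W where W: "finite W" "card W \<le> 7" "\<And>a b c d. quadrilateral a b c d K \<Longrightarrow> {a, b, c, d} \<subseteq> W"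
      using quadrilateral_vertices[of K] by metis
    have sub: "element_faces k K \<subseteq> (\<lambda>(x, y). closed_segment x y) ` (W \<times> W)"
      using W(3) quad(1) by (fastforce simp: element_faces_def quad_edges_def)
    have "card (W \<times> W) \<le> 7 * 7"
      unfolding card_cartesian_product using W(2) by (intro mult_mono) auto
    then show ?thesis
      using W(1) card_mono[OF _ sub] card_image_le[of "W \<times> W" "\<lambda>(x, y). closed_segment x y"] finite_subset[OF sub]
      by auto
  next
    case hex
    then have "card (element_faces k K) = 6" by (simp add: element_faces_def hexahedron_def)
    then show ?thesis using card_ge_0_finite[of "element_faces k K"] by auto
  qed
  then show "finite (element_faces k K)" "card (element_faces k K) \<le> 49" by auto
qed

subsection \<open>Inscribed balls\<close>

lemma insphere_bdd_above:
  fixes S :: "'a::euclidean_space set"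
  assumes "bounded S"
  shows "bdd_above {2 * r | r c. 0 \<le> r \<and> cball c r \<subseteq> S}"
proof (rule bdd_aboveI)
  fix y assume "y \<in> {2 * r | r c. 0 \<le> r \<and> cball c r \<subseteq> S}"
  then obtain r c where rc: "y = 2 * r" "0 \<le> r" "cball c r \<subseteq> S" by blast
  then show "y \<le> diameter S"
    using diameter_subset[OF rc(3) assms] by simp
qed

lemma insphere_nonneg:
  fixes S :: "'a::euclidean_space set"
  assumes "bounded S" "S \<noteq> {}"
  shows "0 \<le> insphere_diameter S"
proof -
  obtain x where "x \<in> S" using assms(2) by blast
  then have "0 \<in> {2 * r | r c. 0 \<le> r \<and> cball c r \<subseteq> S}"
    by (intro CollectI exI[of _ 0] exI[of _ x]) auto
  then show ?thesis
    unfolding insphere_diameter_def using insphere_bdd_above[OF assms(1)] by (rule cSup_upper)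
qed

lemma corner_simplices_bounded:
  fixes K :: "'a::euclidean_space set"
  assumes el: "is_element k K" and dim: "shape_in_dim DIM('a) k" and S: "S \<in> corner_simplices k K"
  shows "bounded S" "S \<noteq> {}"
proof -
  have "bounded S \<and> S \<noteq> {}"
    using el dim
  proof (cases rule: shape_in_dim_cases)
    case (simplex C)
    then have "S = K" using S by auto
    moreover have "C \<noteq> {}" using simplex(3) by auto
    ultimately show ?thesis
      using simplex element_compact_frontier(1)[OF el dim] by (auto intro: compact_imp_bounded)
  next
    case quad
    then show ?thesis
      using S by (auto simp: finite_imp_bounded_convex_hull)
  next
    case hex
    then obtain v where v: "v extreme_point_of K" "S = convex hull (insert v (neighbours K v))"
      using S by auto
    then have "finite (neighbours K v)"
      using hex(3) by (auto simp: hexahedron_def intro: card_ge_0_finite)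
    then show ?thesis using v(2) by (auto simp: finite_imp_bounded_convex_hull)
  qed
  then show "bounded S" "S \<noteq> {}" by auto
qed

text \<open>For every shape \<open>rho\<close> is at most twice the insphere diameter of each corner
  simplex, which is therefore at least \<open>diameter K / (2 * \<sigma>)\<close>. Halving once more
  makes the inequality strict and yields an actual ball without attainment of the supremum; passing
  from diameter to radius gives the 8.\<close>

lemma inscribed_ball:
  fixes K :: "'a::euclidean_space set"
  assumes el: "is_element k K" and dim: "shape_in_dim DIM('a) k" and C: "C \<in> corner_simplices k K"
    and reg: "diameter K \<le> \<sigma> * rho k K" and pos: "0 < \<sigma>" "0 < diameter K"
  obtains c r where "cball c r \<subseteq> C" "diameter K / (8 * \<sigma>) \<le> r"
proof -
  note C_bdd = corner_simplices_bounded[OF el dim C]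
  have "rho k K \<le> 2 * insphere_diameter C"
  proof (cases "k \<in> {Triangle, Tetrahedron}")
    case True
    then have "C = K" using C by auto
    then show ?thesis using True insphere_nonneg[OF C_bdd] by (auto simp: rho_def)
  next
    case False
    have "bdd_below (insphere_diameter ` corner_simplices k K)"
      using insphere_nonneg corner_simplices_bounded[OF el dim] by (intro bdd_belowI2[of _ 0]) blast
    then have "(INF S\<in>corner_simplices k K. insphere_diameter S) \<le> insphere_diameter C"
      using C by (rule cINF_lower)
    then show ?thesis using False by (simp add: rho_def)
  qed
  then have "\<sigma> * rho k K \<le> \<sigma> * (2 * insphere_diameter C)"
    using pos by (intro mult_left_mono) auto
  then have "diameter K \<le> \<sigma> * (2 * insphere_diameter C)" using reg by linarith
  then have "diameter K / (2 * \<sigma>) \<le> insphere_diameter C"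
    using pos by (simp add: pos_divide_le_eq mult_ac)
  moreover have "diameter K / (4 * \<sigma>) < diameter K / (2 * \<sigma>)"
    using pos by (intro divide_strict_left_mono) auto
  ultimately have lt: "diameter K / (4 * \<sigma>) < insphere_diameter C" by linarith
  have ne: "{2 * r | r c. 0 \<le> r \<and> cball c r \<subseteq> C} \<noteq> {}"
  proof -
    obtain x where "x \<in> C" using C_bdd by blast
    then have "0 \<in> {2 * r | r c. 0 \<le> r \<and> cball c r \<subseteq> C}"
      by (intro CollectI exI[of _ 0] exI[of _ x]) auto
    then show ?thesis by blast
  qed
  obtain z where "z \<in> {2 * r | r c. 0 \<le> r \<and> cball c r \<subseteq> C}" "diameter K / (4 * \<sigma>) < z"
    using less_cSupD[OF ne lt[unfolded insphere_diameter_def]] by (elim bexE)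
  then obtain r c where rc: "diameter K / (4 * \<sigma>) < 2 * r" "cball c r \<subseteq> C" by blast
  have "diameter K / (8 * \<sigma>) \<le> r"
  proof -
    have "0 < 4 * \<sigma>" "0 < 8 * \<sigma>" using pos(1) by auto
    note p = pos_divide_less_eq[OF this(1)] pos_divide_le_eq[OF this(2)]
    show ?thesis using rc(1) unfolding p by linarith
  qed
  then show ?thesis using that rc(2) by blast
qed

lemma element_diameter_pos:
  fixes K :: "'a::euclidean_space set"
  assumes el: "is_element k K" and dim: "shape_in_dim DIM('a) k"
  shows "0 < diameter K"
proof -
  have dim2: "2 \<le> DIM('a)" using dim by (auto simp: shape_in_dim_def)
  have "\<exists>x\<in>K. \<exists>y\<in>K. x \<noteq> y"
  proof (rule ccontr)
    assume "\<not> ?thesis"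
    then have sing: "\<exists>a. K \<subseteq> {a}" by blast
    show False
      using el dim
    proof (cases rule: shape_in_dim_cases)
      case (simplex C)
      then show False using sing dim2 aff_dim_subset[of K "{_}"] by fastforce
    next
      case quad
      then obtain a b c d where q: "quadrilateral a b c d K" by blast
      then have "{a, b, c} \<subseteq> K" by (auto simp: quadrilateral_def intro: hull_inc)
      then have "a = b" using sing by blast
      then show False using q by (auto simp: quadrilateral_def)
    next
      case hex
      then show False using sing aff_dim_subset[of K "{_}"] by (fastforce simp: hexahedron_def)
    qed
  qed
  then obtain x y where "x \<in> K" "y \<in> K" "x \<noteq> y" by blast
  then have "0 < dist x y" "dist x y \<le> diameter K"
    using element_compact_frontier(1)[OF el dim]
    by (auto intro!: diameter_bounded_bound compact_imp_bounded)
  then show ?thesis by linarith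
qed

text \<open>With quasi-uniformity this bounds the mesh size by a multiple of each single diameter,
  so that every element contains balls of radius comparable to \<open>h\<close>.\<close>

lemma min_edge_length_le:
  fixes K :: "'a::euclidean_space set"
  assumes K: "K \<in> T" and el: "\<And>K. K \<in> T \<Longrightarrow> is_element k K" and dim: "shape_in_dim DIM('a) k"
  shows "0 \<le> min_edge_length k T" "min_edge_length k T \<le> diameter K"
proof -
  let ?E = "\<Union>K\<in>T. element_edges k K"
  have bdd: "bounded E" if E: "E \<in> ?E" for E
  proof (cases "k = Quadrilateral")
    case True
    then show ?thesis using E by (auto simp: element_edges_def quad_edges_def intro: compact_imp_bounded)
  next
    case False
    then obtain K' where "K' \<in> T" "E edge_of K'" using E by (auto simp: element_edges_def)
    then show ?thesis
      using element_compact_frontier(1)[OF el dim, of K'] edge_of_imp_subset[of E K']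
        bounded_subset compact_imp_bounded by blast
  qed
  obtain E where E: "E \<in> element_edges k K" "E \<subseteq> K"
    using element_edge_exists[OF el[OF K] dim] by blast
  show "0 \<le> min_edge_length k T"
    unfolding min_edge_length_def using K E(1) bdd by (intro cINF_greatest diameter_ge_0) auto
  have "bdd_below (diameter ` ?E)"
    using bdd diameter_ge_0 by (intro bdd_belowI2[of _ 0]) blast
  then have "min_edge_length k T \<le> diameter E"
    unfolding min_edge_length_def using K E(1) by (intro cINF_lower) auto
  also have "\<dots> \<le> diameter K"
    using E(2) element_compact_frontier(1)[OF el[OF K] dim] by (intro diameter_subset compact_imp_bounded)
  finally show "min_edge_length k T \<le> diameter K" .
qed

lemma unit_normal:
  fixes F :: "'a::euclidean_space set"
  assumes "aff_dim F < DIM('a)"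
  obtains n b where "norm n = 1" "F \<subseteq> {x. n \<bullet> x = b}"
proof -
  obtain a c where a: "a \<noteq> 0" "F \<subseteq> {x. a \<bullet> x = c}"
    using aff_lowdim_subset_hyperplane[OF assms] by blast
  have "F \<subseteq> {x. (a /\<^sub>R norm a) \<bullet> x = c / norm a}"
    using a by (auto simp: divide_inverse mult.commute)
  then show ?thesis using that[of "a /\<^sub>R norm a"] a(1) by simp
qed

lemma face_point_mem:
  fixes K :: "'a::euclidean_space set"
  assumes el: "is_element k K" and F: "F \<in> element_faces k K" and dim: "shape_in_dim DIM('a) k"
    and reg: "diameter K \<le> \<sigma> * rho k K" and pos: "0 < \<sigma>"
  shows "face_point F \<in> F"
proof (cases "DIM('a) = 2")
  case True
  then obtain a b where F: "F = closed_segment a b"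
    using element_face_props(5)[OF el F dim] by blast
  \<comment> \<open>The endpoints of a segment are unique up to order, and the midpoint is symmetric
    in them.\<close>
  have "face_point F = midpoint a b"
    unfolding face_point_def if_P[OF True]
    by (rule the_equality) (auto simp: F closed_segment_eq doubleton_eq_iff midpoint_sym)
  then show ?thesis by (simp add: F)
next
  case False
  note props = element_face_props[OF el F dim]
  obtain S A w where S: "convex A" "A \<subseteq> F" "convex hull (insert w A) \<in> corner_simplices k K"
    using element_face_structure[OF el F dim] by metis
  obtain c r where ball: "cball c r \<subseteq> convex hull (insert w A)" "diameter K / (8 * \<sigma>) \<le> r"
    using inscribed_ball[OF el dim S(3) reg pos element_diameter_pos[OF el dim]] .
  have r: "0 < r"
    using ball(2) divide_pos_pos[OF element_diameter_pos[OF el dim], of "8 * \<sigma>"] pos by linarith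
  obtain n b where n: "norm n = 1" "F \<subseteq> {x. n \<bullet> x = b}"
    using unit_normal[OF props(4)] .
  obtain y where "y \<in> A" "{z. n \<bullet> z = b} \<inter> cball y r \<subseteq> A"
    using cone_contains_disc[OF S(1) order_trans[OF S(2) n(2)] n(1) ball(1) r] .
  then have "barycenter F \<in> F"
    using slab.barycenter_mem[of F n b y r] props(1,2) n r S(2) by (auto simp: slab_def)
  then show ?thesis using False by (simp add: face_point_def)
qed

subsection \<open>One-sided derivatives of piecewise polynomials\<close>

lemma partial_cong_open:
  assumes "open U" "\<And>x. x \<in> U \<Longrightarrow> f x = g x" "x \<in> U"
  shows "partial i f x = partial i g x"
proof -
  have "open ((\<lambda>t. x + t *\<^sub>R axis i 1) -` U)"
    by (intro open_vimage assms continuous_intros)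
  then have "\<forall>\<^sub>F t in nhds 0. t \<in> (\<lambda>t. x + t *\<^sub>R axis i 1) -` U"
    using assms(3) by (intro eventually_nhds_in_open) auto
  then have "\<forall>\<^sub>F t in nhds 0. f (x + t *\<^sub>R axis i 1) = g (x + t *\<^sub>R axis i 1)"
    by eventually_elim (use assms(2) in auto)
  then show ?thesis
    unfolding partial_def by (rule deriv_cong_ev) simp
qed

lemma mderiv_cong_open:
  fixes f :: "real^'n::finite \<Rightarrow> real"
  assumes "open U" "\<And>x. x \<in> U \<Longrightarrow> f x = g x" "x \<in> U"
  shows "mderiv \<alpha> f x = mderiv \<alpha> g x"
proof -
  have pow: "(partial i ^^ k) f' x = (partial i ^^ k) g' x"
    if "\<And>x. x \<in> U \<Longrightarrow> f' x = g' x" "x \<in> U" for i k x and f' g' :: "real^'n \<Rightarrow> real"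
    using that by (induction k arbitrary: x) (auto intro: partial_cong_open[OF assms(1)])
  have "\<forall>x\<in>U. foldr (\<lambda>i. partial i ^^ \<alpha> i) xs f x = foldr (\<lambda>i. partial i ^^ \<alpha> i) xs g x" for xs
    using assms(2) by (induction xs) (auto intro: pow)
  then show ?thesis using assms(3) unfolding mderiv_def by blast
qed

text \<open>\<open>w\<close> agrees with a polynomial only on the open interior, which suffices
  because iterated partial derivatives are local. Membership of \<open>x\<close> in the closure of
  the interior makes the limit nontrivial and hence unique.\<close>

lemma Lim_mderiv:
  fixes w :: "real^'n::finite \<Rightarrow> real"
  assumes \<Phi>: "deriv_family \<Phi>" "\<And>y. y \<in> interior K \<Longrightarrow> w y = \<Phi> (\<lambda>_. 0) y" and x: "x \<in> closure (interior K)"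
  shows "Lim (at x within interior K) (mderiv \<alpha> w) = \<Phi> \<alpha> x"
proof (rule tendsto_Lim)
  show "at x within interior K \<noteq> bot"
    using x by (auto simp: trivial_limit_within closure_def interior_limit_point)
  have "mderiv \<alpha> w y = \<Phi> \<alpha> y" if "y \<in> interior K" for y
    using mderiv_cong_open[OF open_interior \<Phi>(2) that, where \<alpha> = \<alpha>] deriv_family_mderiv[OF \<Phi>(1)] by simp
  then have "\<forall>\<^sub>F y in at x within interior K. \<Phi> \<alpha> y = mderiv \<alpha> w y"
    by (auto simp: eventually_at_filter)
  moreover have "(\<Phi> \<alpha> \<longlongrightarrow> \<Phi> \<alpha> x) (at x within interior K)"
    using has_derivative_continuous[OF deriv_familyD[OF \<Phi>(1), of \<alpha> x]]
    by (simp add: continuous_at Lim_at_imp_Lim_at_within)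
  ultimately show "(mderiv \<alpha> w \<longlongrightarrow> \<Phi> \<alpha> x) (at x within interior K)"
    by (rule Lim_transform_eventually[rotated])
qed

subsection \<open>The jump at a single face\<close>

text \<open>The open half balls lie in the interiors; what remains of the ball is on the hyperplane
  through \<open>y\<close>, a null set.\<close>

lemma integral_indicator_split:
  fixes f :: "real^'n::finite \<Rightarrow> real"
  assumes \<Omega>: "\<Omega> \<in> sets lebesgue" and f: "integrable (lebesgue_on \<Omega>) f" "\<And>x. 0 \<le> f x" and e: "norm e = 1"
    and K: "{x \<in> cball y \<rho>. 0 \<le> e \<bullet> (x - y)} \<subseteq> K" and L: "{x \<in> cball y \<rho>. e \<bullet> (x - y) \<le> 0} \<subseteq> L"
  shows "(LINT x|lebesgue_on \<Omega>. indicator (ball y \<rho>) x * f x)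
    \<le> (LINT x|lebesgue_on \<Omega>. indicator (interior K) x * f x) + (LINT x|lebesgue_on \<Omega>. indicator (interior L) x * f x)"
proof -
  note ind = indicator_integrable[OF f(1)]
  have half: "{x \<in> ball y \<rho>. 0 < e \<bullet> (x - y)} \<subseteq> interior K" "{x \<in> ball y \<rho>. e \<bullet> (x - y) < 0} \<subseteq> interior L"
  proof -
    have "open (ball y \<rho> \<inter> {x. 0 < e \<bullet> (x - y)})" "open (ball y \<rho> \<inter> {x. e \<bullet> (x - y) < 0})"
      by (intro open_Int open_ball open_Collect_less continuous_intros)+
    then have "ball y \<rho> \<inter> {x. 0 < e \<bullet> (x - y)} \<subseteq> interior K" "ball y \<rho> \<inter> {x. e \<bullet> (x - y) < 0} \<subseteq> interior L"
      using K L by (intro interior_maximal; force)+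
    then show "{x \<in> ball y \<rho>. 0 < e \<bullet> (x - y)} \<subseteq> interior K" "{x \<in> ball y \<rho>. e \<bullet> (x - y) < 0} \<subseteq> interior L"
      by auto
  qed
  have "negligible {x. e \<bullet> x = e \<bullet> y}"
    using e by (intro negligible_hyperplane) auto
  then have "AE x in lebesgue. x \<notin> {x. e \<bullet> x = e \<bullet> y}"
    by (intro AE_not_in) (simp add: negligible_iff_null_sets)
  then have ae: "AE x in lebesgue_on \<Omega>. e \<bullet> x \<noteq> e \<bullet> y"
    using \<Omega> by (subst AE_restrict_space_iff) auto
  have "(LINT x|lebesgue_on \<Omega>. indicator (ball y \<rho>) x * f x)
    \<le> (LINT x|lebesgue_on \<Omega>. indicator (interior K) x * f x + indicator (interior L) x * f x)"
  proof (rule integral_mono_AE)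
    show "AE x in lebesgue_on \<Omega>. indicator (ball y \<rho>) x * f x \<le> indicator (interior K) x * f x + indicator (interior L) x * f x"
      using ae
    proof eventually_elim
      case (elim x)
      then have "e \<bullet> (x - y) \<noteq> 0" by (simp add: inner_diff_right)
      then have "x \<in> interior K \<or> x \<in> interior L" if "x \<in> ball y \<rho>"
        using half that by (cases "e \<bullet> (x - y) > 0") (blast, force)
      then show ?case using f(2)[of x] by (auto simp: indicator_def)
    qed
  qed (intro ind Bochner_Integration.integrable_add; simp)+
  then show ?thesis using ind by simp
qed

text \<open>The error is divided by h^(p+1) so that, under the assumed approximation order, the
  integrand is bounded in L^s uniformly in \<open>h\<close>.\<close>

definition local_error where
  "local_error \<Omega> p h u w v K = (LINT x|lebesgue_on \<Omega>. indicator (interior K) x *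
     (\<bar>u x - w x\<bar> / h ^ Suc p + (\<Sum>\<beta> | mi_order \<beta> = Suc p. \<bar>v \<beta> x\<bar>)))"

text \<open>The constant is obtained before mesh, functions and face are introduced; this is its
  uniformity. Each side contributes only through its own interior, which is what makes the bound
  summable over faces.\<close>

lemma face_jump_bound:
  fixes p :: nat and \<sigma> \<kappa> :: real
  assumes \<sigma>: "0 < \<sigma>" and \<kappa>: "0 < \<kappa>"
  obtains C where "0 \<le> C"
    "\<And>\<Omega> u v k T K L F w \<alpha>. \<lbrakk>open \<Omega>; bounded \<Omega>; integrable (lebesgue_on \<Omega>) u;
      \<And>\<beta>. mi_order \<beta> = Suc p \<Longrightarrow> integrable (lebesgue_on \<Omega>) (v \<beta>) \<and> weak_derivative \<beta> \<Omega> u (v \<beta>);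
      shape_in_dim CARD('n) k; mesh k \<Omega> T; K \<in> T; L \<in> T; K \<noteq> L; F \<in> element_faces k K; F \<in> element_faces k L;
      \<And>K. K \<in> T \<Longrightarrow> diameter K \<le> \<sigma> * rho k K; mesh_size T \<le> \<kappa> * min_edge_length k T;
      piecewise_polynomial p T w; mi_order \<alpha> \<le> p\<rbrakk>
     \<Longrightarrow> \<bar>jump \<alpha> w K L (face_point F)\<bar> / mesh_size T ^ (p + 1 - mi_order \<alpha>) \<le> C / mesh_size T ^ CARD('n) *
           (local_error \<Omega> p (mesh_size T) u w v K + local_error \<Omega> p (mesh_size T) u w v (L :: (real^'n::finite) set))"
proof -
  obtain \<Theta> :: "'n multi_index \<Rightarrow> real^'n \<Rightarrow> real" and c0 M where bk: "bump_kernel \<Theta> c0 M"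
    using bump_kernel_exists by blast
  interpret bump_kernel \<Theta> c0 M by (rule bk)
  define N where "N = real CARD('n)"
  have N: "1 \<le> N" by (simp add: N_def Suc_le_eq)
  \<comment> \<open>The ratio of \<open>h\<close> to the inscribed radius \<open>r0\<close>:
    \<open>8 * \<sigma>\<close> is from \<open>inscribed_ball\<close>, \<kappa> compares
    \<open>h\<close> with the single element, and the 1 ensures \<open>1 \<le> B\<close>.\<close>
  define B where "B = 8 * \<sigma> * \<kappa> + 1"
  have B: "1 \<le> B" using \<sigma> \<kappa> by (simp add: B_def)
  \<comment> \<open>The ratio \<open>h / r\<close>, accumulated through \<open>r0 = h / B\<close>,
    the radius \<open>\<rho> = r0 / (2 + 2 * B)\<close> of the ball across the face, and
    \<open>r = \<rho> / (4 * N)\<close>.\<close>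
  define D where "D = B * (2 + 2 * B) * (4 * N)"
  have D: "1 \<le> D"
  proof -
    have "1 * 1 * 1 \<le> B * (2 + 2 * B) * (4 * N)" using B N by (intro mult_mono) auto
    then show ?thesis by (simp add: D_def)
  qed
  \<comment> \<open>From the kernel centre to the face point: \<open>2 * N * r\<close> to
    \<open>y\<close>, then at most \<open>h = D * r\<close> within the element.\<close>
  define \<Lambda> where "\<Lambda> = 2 * N + D"
  define C0 where "C0 = M (Suc p) * (2 * (1 + 4 * N\<^sup>2) ^ Suc p) / c0 * (1 + 2 * N * \<Lambda>) ^ Suc p"
  have C0: "0 \<le> C0"
    using M_nonneg c0(1) N D by (simp add: C0_def \<Lambda>_def)
  \<comment> \<open>The factor \<open>D\<close> pays for replacing \<open>r\<close> by
    \<open>h\<close> in at most \<open>CARD('n) + p\<close> powers.\<close>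
  define C where "C = C0 * D ^ (CARD('n) + p)"
  have C: "0 \<le> C" using C0 D by (simp add: C_def)
  have "\<bar>jump \<alpha> w K L (face_point F)\<bar> / mesh_size T ^ (p + 1 - mi_order \<alpha>) \<le> C / mesh_size T ^ CARD('n) *
           (local_error \<Omega> p (mesh_size T) u w v K + local_error \<Omega> p (mesh_size T) u w v L)"
    if \<Omega>: "open \<Omega>" "bounded \<Omega>" and u: "integrable (lebesgue_on \<Omega>) u"
      and v: "\<And>\<beta>. mi_order \<beta> = Suc p \<Longrightarrow> integrable (lebesgue_on \<Omega>) (v \<beta>) \<and> weak_derivative \<beta> \<Omega> u (v \<beta>)"
      and shape: "shape_in_dim CARD('n) k" and mesh: "mesh k \<Omega> T"
      and KL: "K \<in> T" "L \<in> T" "K \<noteq> L" and F: "F \<in> element_faces k K" "F \<in> element_faces k L"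
      and reg: "\<And>K. K \<in> T \<Longrightarrow> diameter K \<le> \<sigma> * rho k K" and qu: "mesh_size T \<le> \<kappa> * min_edge_length k T"
      and w: "piecewise_polynomial p T w" and \<alpha>: "mi_order \<alpha> \<le> p"
    for \<Omega> u v k T K and L F :: "(real^'n) set" and w \<alpha>
  proof -
    define h where "h = mesh_size T"
    have dim: "shape_in_dim DIM(real^'n) k" using shape by simp
    have fin: "finite T" and el: "\<And>K. K \<in> T \<Longrightarrow> is_element k K" and \<Omega>_eq: "\<Omega> = interior (\<Union>T)"
      and disj: "interior K \<inter> interior L = {}"
      using mesh KL by (auto simp: mesh_def pairwise_def)
    have diam: "diameter J \<le> h" if "J \<in> T" for J
      unfolding h_def mesh_size_def using fin that by (intro Max_ge) auto
    have h: "0 < h" using diam[OF KL(1)] element_diameter_pos[OF el[OF KL(1)] dim] by linarith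
    define r0 where "r0 = h / B"
    have r0: "0 < r0" using h B by (simp add: r0_def)
    have inball: "\<exists>c. cball c r0 \<subseteq> S" if J: "J \<in> T" and S: "S \<in> corner_simplices k J" for J S
    proof -
      obtain c r where cr: "cball c r \<subseteq> S" "diameter J / (8 * \<sigma>) \<le> r"
        using inscribed_ball[OF el[OF J] dim S reg[OF J] \<sigma> element_diameter_pos[OF el[OF J] dim]] .
      have "h \<le> \<kappa> * diameter J"
        unfolding h_def using \<kappa>
        by (intro order_trans[OF qu] mult_left_mono min_edge_length_le(2)[OF J el dim]) auto
      then have "h / (8 * \<sigma> * \<kappa>) \<le> diameter J / (8 * \<sigma>)"
        using \<sigma> \<kappa> by (simp add: field_simps)
      moreover have "r0 \<le> h / (8 * \<sigma> * \<kappa>)"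
        unfolding r0_def B_def using h \<sigma> \<kappa> by (intro divide_left_mono mult_pos_pos add_pos_pos) auto
      ultimately have "cball c r0 \<subseteq> cball c r" using cr(2) by (intro subset_cball) linarith
      then show ?thesis using cr(1) by blast
    qed
    obtain S A a where S: "convex S" "compact S" "F \<subseteq> S" "S \<subseteq> K" "convex A" "A \<subseteq> F"
      "convex hull (insert a A) \<in> corner_simplices k K" "convex hull (insert a A) \<subseteq> S"
      by (rule element_face_structure[OF el[OF KL(1)] F(1) dim])
    obtain S' A' a' where S': "convex S'" "compact S'" "F \<subseteq> S'" "S' \<subseteq> L" "convex A'" "A' \<subseteq> F"
      "convex hull (insert a' A') \<in> corner_simplices k L" "convex hull (insert a' A') \<subseteq> S'"
      by (rule element_face_structure[OF el[OF KL(2)] F(2) dim])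
    obtain c where c: "cball c r0 \<subseteq> convex hull (insert a A)" using inball[OF KL(1) S(7)] by blast
    obtain c' where c': "cball c' r0 \<subseteq> convex hull (insert a' A')" using inball[OF KL(2) S'(7)] by blast
    obtain n b where n: "norm n = 1" "F \<subseteq> {x. n \<bullet> x = b}"
      using unit_normal[OF element_face_props(4)[OF el[OF KL(1)] F(1) dim]] .
    have bdd: "bounded J" if "J \<in> T" for J
      using element_compact_frontier(1)[OF el[OF that] dim] compact_imp_bounded by blast
    have dist_le: "dist x y \<le> B * r0" if "J \<in> T" "x \<in> J" "y \<in> J" for J x y
      using diameter_bounded_bound[OF bdd[OF that(1)] that(2,3)] diam[OF that(1)] B by (simp add: r0_def)
    obtain y e where y: "y \<in> F" "norm e = 1"
      "{x \<in> cball y (r0 / (2 + 2 * B)). 0 \<le> e \<bullet> (x - y)} \<subseteq> K"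
      "{x \<in> cball y (r0 / (2 + 2 * B)). e \<bullet> (x - y) \<le> 0} \<subseteq> L"
    proof (rule ball_across_face[OF S(1,3,4) S'(1,3,4) disj S(5,6) _ n(1) c _ _ r0 B])
      show "A \<subseteq> {x. n \<bullet> x = b}" using S(6) n(2) by blast
      show "cball c r0 \<subseteq> S" "cball c' r0 \<subseteq> S'" using c c' S(8) S'(8) by auto
      show "dist x y \<le> B * r0" if "x \<in> S" "y \<in> S" for x y using dist_le[OF KL(1)] S(4) that by blast
      show "dist x y \<le> B * r0" if "x \<in> S'" "y \<in> S'" for x y using dist_le[OF KL(2)] S'(4) that by blast
    qed
    define \<rho> where "\<rho> = r0 / (2 + 2 * B)"
    define r where "r = \<rho> / (4 * N)"
    have \<rho>: "0 < \<rho>" using r0 B by (simp add: \<rho>_def)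
    have r: "0 < r" using \<rho> N by (simp add: r_def)
    have \<rho>_eq: "\<rho> = 4 * (N * r)" using N by (simp add: r_def)
    have hD: "h = D * r" using N B by (simp add: D_def r_def \<rho>_def r0_def)
    have rh: "r \<le> h" unfolding hD using D r mult_right_mono[of 1 D r] by simp
    have halfK: "{x \<in> cball y \<rho>. 0 \<le> e \<bullet> (x - y)} \<subseteq> K" and halfL: "{x \<in> cball y \<rho>. e \<bullet> (x - y) \<le> 0} \<subseteq> L"
      using y by (auto simp: \<rho>_def)
    have U: "ball (y + (\<rho> / 2) *\<^sub>R e) (\<rho> / 2) \<subseteq> interior K"
      using ball_in_half_ball[OF y(2) \<rho>, of y] halfK by (intro interior_maximal) auto
    have V: "ball (y - (\<rho> / 2) *\<^sub>R e) (\<rho> / 2) \<subseteq> interior L"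
      using ball_in_half_ball[of "- e" \<rho> y] y(2) \<rho> halfL by (intro interior_maximal) auto
    have ball\<Omega>: "ball y \<rho> \<subseteq> \<Omega>"
      unfolding \<Omega>_eq
    proof (rule interior_maximal)
      show "ball y \<rho> \<subseteq> \<Union>T"
      proof
        fix x assume "x \<in> ball y \<rho>"
        then have "x \<in> {x \<in> cball y \<rho>. 0 \<le> e \<bullet> (x - y)} \<or> x \<in> {x \<in> cball y \<rho>. e \<bullet> (x - y) \<le> 0}"
          by auto
        then have "x \<in> K \<or> x \<in> L" using halfK halfL by blast
        then show "x \<in> \<Union>T" using KL by blast
      qed
    qed simp
    obtain qK qL where q: "polynomial_le p qK" "\<And>x. x \<in> interior K \<Longrightarrow> w x = qK x"
        "polynomial_le p qL" "\<And>x. x \<in> interior L \<Longrightarrow> w x = qL x"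
      using w KL unfolding piecewise_polynomial_def by metis
    obtain \<Phi> where \<Phi>: "deriv_family \<Phi>" "\<Phi> (\<lambda>_. 0) = qK" "\<And>\<gamma> x. p < mi_order \<gamma> \<Longrightarrow> \<Phi> \<gamma> x = 0"
      using polynomial_deriv_family[OF q(1)] by blast
    obtain \<Psi> where \<Psi>: "deriv_family \<Psi>" "\<Psi> (\<lambda>_. 0) = qL" "\<And>\<gamma> x. p < mi_order \<gamma> \<Longrightarrow> \<Psi> \<gamma> x = 0"
      using polynomial_deriv_family[OF q(3)] by blast
    define x where "x = face_point F"
    have xF: "x \<in> F"
      unfolding x_def by (rule face_point_mem[OF el[OF KL(1)] F(1) dim reg[OF KL(1)] \<sigma>])
    \<comment> \<open>The element may be non-convex, so the face point is approached inside the
      convex part \<open>S\<close>, where closure of the interior and closure coincide.\<close>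
    have clos: "x \<in> closure (interior J)" if "convex S" "compact S" "F \<subseteq> S" "S \<subseteq> J" "cball c r0 \<subseteq> S" for S J c
    proof -
      have "ball c r0 \<subseteq> interior S" using that(5) by (intro interior_maximal) auto
      then have "interior S \<noteq> {}" using r0 by force
      then have "closure (interior S) = closure S" by (rule convex_closure_interior[OF that(1)])
      then have "x \<in> closure (interior S)" using xF that(3) closure_subset by blast
      then show ?thesis using closure_mono[OF interior_mono[OF that(4)]] by blast
    qed
    have jump: "jump \<alpha> w K L x = \<Phi> \<alpha> x - \<Psi> \<alpha> x"
      unfolding jump_def
      using Lim_mderiv[OF \<Phi>(1), of K w x \<alpha>] Lim_mderiv[OF \<Psi>(1), of L w x \<alpha>] q \<Phi>(2) \<Psi>(2)
        clos[OF S(1-4)] clos[OF S'(1-4)] c c' S(8) S'(8) by force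
    have half_eq: "\<rho> / 2 = 2 * (N * r)" using \<rho>_eq by simp
    let ?X1 = "LINT x|lebesgue_on \<Omega>. indicator (ball (y + (2 * (N * r)) *\<^sub>R e) (2 * (N * r))) x * \<bar>u x - \<Phi> (\<lambda>_. 0) x\<bar>"
    let ?X0 = "LINT x|lebesgue_on \<Omega>. indicator (ball (y - (2 * (N * r)) *\<^sub>R e) (2 * (N * r))) x * \<bar>u x - \<Psi> (\<lambda>_. 0) x\<bar>"
    let ?V = "\<Sum>\<beta> | mi_order \<beta> = Suc p. LINT x|lebesgue_on \<Omega>. indicator (ball y (4 * (N * r))) x * \<bar>v \<beta> x\<bar>"
    have main: "\<bar>\<Phi> \<alpha> x - \<Psi> \<alpha> x\<bar> \<le> C0 / (r ^ CARD('n) * r ^ mi_order \<alpha>) * (?X1 + ?X0 + r ^ Suc p * ?V)"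
      unfolding C0_def N_def
    proof (rule difference_of_approximants[OF \<Phi>(1,3) \<Psi>(1,3) \<Omega> u v r y(2)])
      show "ball y (4 * (real CARD('n) * r)) \<subseteq> \<Omega>" using ball\<Omega> \<rho>_eq by (simp add: N_def)
      show "real CARD('n) \<le> \<Lambda>" using N D by (simp add: \<Lambda>_def N_def)
      have "dist (y + (2 * (N * r)) *\<^sub>R e) x \<le> dist (y + (2 * (N * r)) *\<^sub>R e) y + dist y x" by (rule dist_triangle)
      also have "dist (y + (2 * (N * r)) *\<^sub>R e) y = 2 * (N * r)" using y(2) N r by (simp add: dist_norm)
      also have "dist y x \<le> h"
        using dist_le[OF KL(1), of y x] y(1) xF S(3,4) B by (auto simp: r0_def)
      also have "2 * (N * r) + h = \<Lambda> * r" by (simp add: \<Lambda>_def hD algebra_simps)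
      finally show "x \<in> cball (y + (2 * (real CARD('n) * r)) *\<^sub>R e) (\<Lambda> * r)" by (simp add: N_def)
    qed (use \<alpha> in auto)
    have \<Omega>s: "\<Omega> \<in> sets lebesgue" using \<Omega>(1) by auto
    note ind = indicator_integrable
    have intq: "integrable (lebesgue_on \<Omega>) (\<lambda>x. \<bar>u x - \<Phi> (\<lambda>_. 0) x\<bar>)" "integrable (lebesgue_on \<Omega>) (\<lambda>x. \<bar>u x - \<Psi> (\<lambda>_. 0) x\<bar>)"
      by (intro integrable_abs Bochner_Integration.integrable_diff u integrable_continuous_bounded_domain
          deriv_family_continuous[OF \<Phi>(1)] deriv_family_continuous[OF \<Psi>(1)] \<Omega> \<Omega>s)+
    have near: "(LINT x|lebesgue_on \<Omega>. indicator E x * \<bar>u x - q x\<bar>) \<le> (LINT x|lebesgue_on \<Omega>. indicator (interior J) x * \<bar>u x - w x\<bar>)"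
      and near_int: "integrable (lebesgue_on \<Omega>) (\<lambda>x. indicator (interior J) x * \<bar>u x - w x\<bar>)"
      if "integrable (lebesgue_on \<Omega>) (\<lambda>x. \<bar>u x - q x\<bar>)" "\<And>x. x \<in> interior J \<Longrightarrow> w x = q x" "E \<subseteq> interior J" "open E"
      for E J q
    proof -
      have eq: "indicator (interior J) x * \<bar>u x - w x\<bar> = indicator (interior J) x * \<bar>u x - q x\<bar>" for x
        using that(2) by (auto simp: indicator_def)
      show "integrable (lebesgue_on \<Omega>) (\<lambda>x. indicator (interior J) x * \<bar>u x - w x\<bar>)"
        unfolding eq using that(1) by (intro ind) auto
      show "(LINT x|lebesgue_on \<Omega>. indicator E x * \<bar>u x - q x\<bar>) \<le> (LINT x|lebesgue_on \<Omega>. indicator (interior J) x * \<bar>u x - w x\<bar>)"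
        unfolding eq using that(1,3,4) by (intro integral_mono ind) (auto simp: indicator_def)
    qed
    let ?E = "\<lambda>J. LINT x|lebesgue_on \<Omega>. indicator (interior J) x * \<bar>u x - w x\<bar>"
    let ?W = "\<lambda>J. \<Sum>\<beta> | mi_order \<beta> = Suc p. LINT x|lebesgue_on \<Omega>. indicator (interior J) x * \<bar>v \<beta> x\<bar>"
    have le: "local_error \<Omega> p h u w v J = ?E J / h ^ Suc p + ?W J"
      if "integrable (lebesgue_on \<Omega>) (\<lambda>x. indicator (interior J) x * \<bar>u x - w x\<bar>)" for J
    proof -
      have "local_error \<Omega> p h u w v J = (LINT x|lebesgue_on \<Omega>. indicator (interior J) x * \<bar>u x - w x\<bar> / h ^ Suc p
        + (\<Sum>\<beta> | mi_order \<beta> = Suc p. indicator (interior J) x * \<bar>v \<beta> x\<bar>))"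
        unfolding local_error_def by (simp add: distrib_left sum_distrib_left)
      also have "\<dots> = (LINT x|lebesgue_on \<Omega>. indicator (interior J) x * \<bar>u x - w x\<bar> / h ^ Suc p)
        + (LINT x|lebesgue_on \<Omega>. (\<Sum>\<beta> | mi_order \<beta> = Suc p. indicator (interior J) x * \<bar>v \<beta> x\<bar>))"
        using v by (intro Bochner_Integration.integral_add integrable_divide that
            Bochner_Integration.integrable_sum ind integrable_abs) auto
      also have "(LINT x|lebesgue_on \<Omega>. (\<Sum>\<beta> | mi_order \<beta> = Suc p. indicator (interior J) x * \<bar>v \<beta> x\<bar>)) = ?W J"
        using v by (intro Bochner_Integration.integral_sum ind integrable_abs) auto
      also have "(LINT x|lebesgue_on \<Omega>. indicator (interior J) x * \<bar>u x - w x\<bar> / h ^ Suc p) = ?E J / h ^ Suc p"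
        by (rule integral_divide_zero)
      finally show ?thesis .
    qed
    have X1: "?X1 \<le> ?E K" "integrable (lebesgue_on \<Omega>) (\<lambda>x. indicator (interior K) x * \<bar>u x - w x\<bar>)"
      using near[OF intq(1), of K] near_int[OF intq(1), of K "{}"] U q(2) \<Phi>(2) half_eq by auto
    have X0: "?X0 \<le> ?E L" "integrable (lebesgue_on \<Omega>) (\<lambda>x. indicator (interior L) x * \<bar>u x - w x\<bar>)"
      using near[OF intq(2), of L] near_int[OF intq(2), of L "{}"] V q(4) \<Psi>(2) half_eq by auto
    have V_le: "?V \<le> ?W K + ?W L"
      unfolding sum.distrib[symmetric] \<rho>_eq[symmetric]
      using v by (intro sum_mono integral_indicator_split[OF \<Omega>s _ _ y(2) halfK halfL]) auto
    have V0: "0 \<le> ?V" by (intro sum_nonneg integral_nonneg_AE AE_I2) auto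
    have X00: "0 \<le> ?X0" "0 \<le> ?X1" by (intro integral_nonneg_AE AE_I2; simp)+
    define Q where "Q = local_error \<Omega> p h u w v K + local_error \<Omega> p h u w v L"
    have "?X1 + ?X0 + r ^ Suc p * ?V \<le> ?E K + ?E L + h ^ Suc p * (?W K + ?W L)"
      using X1(1) X0(1) V_le V0 r rh h by (intro add_mono mult_mono power_mono) auto
    also have "\<dots> = h ^ Suc p * Q"
      unfolding Q_def le[OF X1(2)] le[OF X0(2)] using h by (simp add: field_simps)
    finally have bound: "?X1 + ?X0 + r ^ Suc p * ?V \<le> h ^ Suc p * Q" .
    have nonneg: "0 \<le> ?X1 + ?X0 + r ^ Suc p * ?V" using V0 X00 r by simp
    have "h ^ Suc p * 0 \<le> h ^ Suc p * Q" using order_trans[OF nonneg bound] by simp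
    then have Q0: "0 \<le> Q" using zero_less_power[OF h] by (rule mult_left_le_imp_le)
    define m where "m = CARD('n) + mi_order \<alpha>"
    have "\<bar>jump \<alpha> w K L x\<bar> \<le> C0 / (r ^ CARD('n) * r ^ mi_order \<alpha>) * (h ^ Suc p * Q)"
      unfolding jump using main mult_left_mono[OF bound, of "C0 / (r ^ CARD('n) * r ^ mi_order \<alpha>)"] C0 r by simp
    also have "C0 / (r ^ CARD('n) * r ^ mi_order \<alpha>) = C0 * D ^ m / h ^ m"
      unfolding hD m_def power_add[symmetric] using D r by (simp add: power_mult_distrib)
    also have "C0 * D ^ m / h ^ m * (h ^ Suc p * Q) \<le> C / h ^ m * (h ^ Suc p * Q)"
      unfolding C_def m_def using C0 D h Q0 \<alpha>
      by (intro mult_right_mono divide_right_mono mult_left_mono power_increasing) auto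
    finally have "\<bar>jump \<alpha> w K L x\<bar> / h ^ (p + 1 - mi_order \<alpha>) \<le> C / h ^ m * (h ^ Suc p * Q) / h ^ (p + 1 - mi_order \<alpha>)"
      using h by (intro divide_right_mono) auto
    also have "\<dots> = C / h ^ CARD('n) * Q"
    proof -
      have "h ^ Suc p = h ^ mi_order \<alpha> * h ^ (p + 1 - mi_order \<alpha>)"
        unfolding power_add[symmetric] using \<alpha> by simp
      then show ?thesis unfolding m_def power_add using h by simp
    qed
    finally show ?thesis by (simp add: Q_def h_def x_def)
  qed
  then show ?thesis using that[OF C] by blast
qed

subsection \<open>Lebesgue spaces on a bounded domain\<close>

lemma borel_measurable_lebesgue_on_spike:
  fixes f g :: "real^'n::finite \<Rightarrow> real"
  assumes "f \<in> borel_measurable (lebesgue_on \<Omega>)" "\<Omega> \<in> sets lebesgue" "negligible N"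
    and "\<And>x. x \<in> \<Omega> - N \<Longrightarrow> f x = g x"
  shows "g \<in> borel_measurable (lebesgue_on \<Omega>)"
proof -
  have "(\<lambda>x. if x \<in> \<Omega> then f x else 0) \<in> borel_measurable lebesgue"
    using assms(1,2) by (simp add: borel_measurable_if)
  moreover have "AE x in lebesgue. x \<notin> N"
    using assms(3) by (intro AE_not_in) (simp add: negligible_iff_null_sets)
  then have "AE x in lebesgue. (if x \<in> \<Omega> then f x else 0) = (if x \<in> \<Omega> then g x else 0)"
    by eventually_elim (use assms(4) in auto)
  ultimately have "(\<lambda>x. if x \<in> \<Omega> then g x else 0) \<in> borel_measurable lebesgue"
    by (rule borel_measurable_AE)
  then show ?thesis using assms(2) by (simp add: borel_measurable_if)
qed

text \<open>The values of \<open>w\<close> on the element frontiers are arbitrary, but these are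
  null and Lebesgue measure is complete. Off them \<open>w\<close> is a finite sum of polynomials
  cut off to the interiors.\<close>

lemma piecewise_polynomial_measurable_bounded:
  fixes w :: "real^'n::finite \<Rightarrow> real"
  assumes mesh: "mesh k \<Omega> T" and shape: "shape_in_dim CARD('n) k" and w: "piecewise_polynomial p T w"
    and \<Omega>: "open \<Omega>" "bounded \<Omega>"
  shows "w \<in> borel_measurable (lebesgue_on \<Omega>)" "\<exists>B. AE x in lebesgue_on \<Omega>. \<bar>w x\<bar> \<le> B"
proof -
  have dim: "shape_in_dim DIM(real^'n) k" using shape by simp
  have fin: "finite T" and el: "\<And>K. K \<in> T \<Longrightarrow> is_element k K" and \<Omega>_eq: "\<Omega> = interior (\<Union>T)"
    and disj: "\<And>K L. K \<in> T \<Longrightarrow> L \<in> T \<Longrightarrow> K \<noteq> L \<Longrightarrow> interior K \<inter> interior L = {}"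
    using mesh by (auto simp: mesh_def pairwise_def)
  define N where "N = (\<Union>K\<in>T. frontier K)"
  have N: "negligible N"
    unfolding N_def using fin element_compact_frontier(2)[OF el dim] by (intro negligible_Union) auto
  have cover: "\<exists>K\<in>T. x \<in> interior K" if "x \<in> \<Omega> - N" for x
  proof -
    have "x \<in> \<Union>T" using that interior_subset unfolding \<Omega>_eq by blast
    then obtain K where K: "K \<in> T" "x \<in> K" by blast
    then have "x \<notin> frontier K" using that by (auto simp: N_def)
    then show ?thesis using K closure_subset by (auto simp: frontier_def)
  qed
  have "\<forall>K\<in>T. \<exists>q. polynomial_le p q \<and> (\<forall>x\<in>interior K. w x = q x)"
    using w unfolding piecewise_polynomial_def .
  then obtain q where q: "\<And>K. K \<in> T \<Longrightarrow> polynomial_le p (q K)" "\<And>K x. K \<in> T \<Longrightarrow> x \<in> interior K \<Longrightarrow> w x = q K x"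
    by metis
  have cont: "continuous_on UNIV (q K)" if K: "K \<in> T" for K
  proof -
    obtain \<Phi> where \<Phi>: "deriv_family \<Phi>" "\<Phi> (\<lambda>_. 0) = q K" using polynomial_deriv_family[OF q(1)[OF K]] by metis
    then show ?thesis using deriv_family_continuous[OF \<Phi>(1)] by metis
  qed
  define f where "f x = (\<Sum>K\<in>T. indicator (interior K) x * q K x)" for x
  have "f \<in> borel_measurable (lebesgue_on \<Omega>)"
    unfolding f_def
  proof (intro borel_measurable_sum borel_measurable_times)
    show "(indicator (interior K) :: _ \<Rightarrow> real) \<in> borel_measurable (lebesgue_on \<Omega>)" for K
      by (intro measurable_restrict_space1 borel_measurable_indicator) auto
  qed (intro continuous_imp_measurable_lebesgue_on cont)
  moreover have "f x = w x" if x: "x \<in> \<Omega> - N" for x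
  proof -
    obtain K where K: "K \<in> T" "x \<in> interior K" using cover[OF x] by blast
    then have "f x = (\<Sum>L\<in>{K}. indicator (interior L) x * q L x)"
      unfolding f_def using fin disj by (intro sum.mono_neutral_right) (auto simp: indicator_def)
    then show ?thesis using K q(2) by simp
  qed
  moreover have "\<Omega> \<in> sets lebesgue" using \<Omega>(1) by auto
  ultimately show "w \<in> borel_measurable (lebesgue_on \<Omega>)"
    using N borel_measurable_lebesgue_on_spike[of f \<Omega> N w] by blast
  have "\<exists>B\<ge>0. \<forall>x\<in>\<Omega>. \<bar>q K x\<bar> \<le> B" if K: "K \<in> T" for K
  proof -
    have "bounded (q K ` closure \<Omega>)"
      using \<Omega>(2) by (intro compact_imp_bounded compact_continuous_image continuous_on_subset[OF cont[OF K]])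
        (auto simp: compact_closure)
    then obtain B where "\<forall>y\<in>q K ` closure \<Omega>. norm y \<le> B" unfolding bounded_iff by blast
    then show ?thesis using closure_subset[of \<Omega>] by (intro exI[of _ "max B 0"]) (auto simp: le_max_iff_disj)
  qed
  then obtain B where B: "\<And>K. K \<in> T \<Longrightarrow> 0 \<le> B K" "\<And>K x. K \<in> T \<Longrightarrow> x \<in> \<Omega> \<Longrightarrow> \<bar>q K x\<bar> \<le> B K"
    by metis
  have "AE x in lebesgue. x \<notin> N"
    using N by (intro AE_not_in) (simp add: negligible_iff_null_sets)
  then have "AE x in lebesgue. x \<in> \<Omega> \<longrightarrow> \<bar>w x\<bar> \<le> (\<Sum>K\<in>T. B K)"
  proof eventually_elim
    case (elim x)
    show ?case
    proof
      assume x: "x \<in> \<Omega>"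
      then obtain K where K: "K \<in> T" "x \<in> interior K" using cover elim by blast
      then have "\<bar>w x\<bar> \<le> B K" using q(2) B(2) x by auto
      also have "\<dots> \<le> (\<Sum>K\<in>T. B K)" using K fin B(1) by (intro member_le_sum) auto
      finally show "\<bar>w x\<bar> \<le> (\<Sum>K\<in>T. B K)" .
    qed
  qed
  then have "AE x in lebesgue_on \<Omega>. \<bar>w x\<bar> \<le> (\<Sum>K\<in>T. B K)"
    using \<Omega>(1) by (subst AE_restrict_space_iff) auto
  then show "\<exists>B. AE x in lebesgue_on \<Omega>. \<bar>w x\<bar> \<le> B" by blast
qed

section \<open>The exponents 1, 2 and infinity made explicit\<close>

lemma in_Lp_1_iff: "in_Lp 1 \<Omega> f \<longleftrightarrow> integrable (lebesgue_on \<Omega>) f"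
proof -
  have "integrable (lebesgue_on \<Omega>) (\<lambda>x. \<bar>f x\<bar>) \<Longrightarrow> f \<in> borel_measurable (lebesgue_on \<Omega>) \<Longrightarrow> integrable (lebesgue_on \<Omega>) f"
    by (rule Bochner_Integration.integrable_bound) auto
  then show ?thesis by (auto simp: in_Lp_def)
qed

lemma in_Lp_2_iff:
  "in_Lp 2 \<Omega> f \<longleftrightarrow> f \<in> borel_measurable (lebesgue_on \<Omega>) \<and> integrable (lebesgue_on \<Omega>) (\<lambda>x. (f x)\<^sup>2)"
  by (simp add: in_Lp_def)

lemma in_Lp_top_iff:
  "in_Lp \<infinity> \<Omega> f \<longleftrightarrow> f \<in> borel_measurable (lebesgue_on \<Omega>) \<and> (\<exists>B. AE x in lebesgue_on \<Omega>. \<bar>f x\<bar> \<le> B)"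
proof safe
  assume f: "in_Lp \<infinity> \<Omega> f"
  then show "f \<in> borel_measurable (lebesgue_on \<Omega>)" by (simp add: in_Lp_def)
  have "esssup (lebesgue_on \<Omega>) (\<lambda>x. ereal \<bar>f x\<bar>) < \<infinity>" using f by (simp add: in_Lp_def)
  then obtain B where B: "esssup (lebesgue_on \<Omega>) (\<lambda>x. ereal \<bar>f x\<bar>) \<le> ereal B"
    by (cases "esssup (lebesgue_on \<Omega>) (\<lambda>x. ereal \<bar>f x\<bar>)") auto
  have "AE x in lebesgue_on \<Omega>. \<bar>f x\<bar> \<le> B"
    using esssup_AE[of "\<lambda>x. ereal \<bar>f x\<bar>" "lebesgue_on \<Omega>"]
  proof eventually_elim
    case (elim x)
    then have "ereal \<bar>f x\<bar> \<le> ereal B" using B by (rule order_trans)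
    then show ?case by simp
  qed
  then show "\<exists>B. AE x in lebesgue_on \<Omega>. \<bar>f x\<bar> \<le> B" by blast
next
  fix B assume "f \<in> borel_measurable (lebesgue_on \<Omega>)" "AE x in lebesgue_on \<Omega>. \<bar>f x\<bar> \<le> B"
  then have "esssup (lebesgue_on \<Omega>) (\<lambda>x. ereal \<bar>f x\<bar>) \<le> ereal B"
    by (intro esssup_I) auto
  then show "in_Lp \<infinity> \<Omega> f"
    using \<open>f \<in> borel_measurable (lebesgue_on \<Omega>)\<close> by (auto simp: in_Lp_def intro: le_less_trans)
qed

lemma Lp_norm_1: "Lp_norm 1 \<Omega> f = (LINT x|lebesgue_on \<Omega>. \<bar>f x\<bar>)"
proof -
  have "0 \<le> (LINT x|lebesgue_on \<Omega>. \<bar>f x\<bar>)" by (intro integral_nonneg_AE) auto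
  then show ?thesis by (simp add: Lp_norm_def)
qed

lemma Lp_norm_2: "(Lp_norm 2 \<Omega> f)\<^sup>2 = (LINT x|lebesgue_on \<Omega>. (f x)\<^sup>2)"
proof -
  have nonneg: "0 \<le> (LINT x|lebesgue_on \<Omega>. (f x)\<^sup>2)" by (intro integral_nonneg_AE) auto
  then have "Lp_norm 2 \<Omega> f = sqrt (LINT x|lebesgue_on \<Omega>. (f x)\<^sup>2)"
    by (simp add: Lp_norm_def powr_half_sqrt)
  then show ?thesis using nonneg by simp
qed

text \<open>\<open>real_of_ereal\<close> sends both infinities to 0, so the essential supremum must
  be finite: above by membership in the space, below because a nonempty open \<Omega> is not
  null.\<close>

lemma Lp_norm_top_AE:
  assumes "in_Lp \<infinity> \<Omega> f" "open \<Omega>" "\<Omega> \<noteq> {}"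
  shows "AE x in lebesgue_on \<Omega>. \<bar>f x\<bar> \<le> Lp_norm \<infinity> \<Omega> f"
proof -
  let ?S = "esssup (lebesgue_on \<Omega>) (\<lambda>x. ereal \<bar>f x\<bar>)"
  have ub: "?S < \<infinity>" using assms(1) by (simp add: in_Lp_def)
  have "emeasure (lebesgue_on \<Omega>) (space (lebesgue_on \<Omega>)) \<noteq> 0"
  proof
    assume "emeasure (lebesgue_on \<Omega>) (space (lebesgue_on \<Omega>)) = 0"
    then have "\<Omega> \<in> null_sets lebesgue"
      using assms(2) by (auto simp: emeasure_restrict_space space_restrict_space null_sets_def)
    then show False
      using open_not_negligible[OF assms(2,3)] by (simp add: negligible_iff_null_sets)
  qed
  then have "(0 :: ereal) = esssup (lebesgue_on \<Omega>) (\<lambda>x. 0 :: ereal)"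
    by (simp add: esssup_const)
  also have "\<dots> \<le> ?S" by (intro esssup_mono) auto
  finally have S: "?S = ereal (Lp_norm \<infinity> \<Omega> f)"
    using ub by (simp add: Lp_norm_def) (cases ?S; simp)
  show ?thesis
    using esssup_AE[of "\<lambda>x. ereal \<bar>f x\<bar>" "lebesgue_on \<Omega>"] by (simp add: S)
qed

lemma in_Lp_diff_bounded:
  fixes f w :: "real^'n::finite \<Rightarrow> real"
  assumes s: "s \<in> {1, 2, \<infinity>}" and f: "in_Lp s \<Omega> f" and fin: "finite_measure (lebesgue_on \<Omega>)"
    and w: "w \<in> borel_measurable (lebesgue_on \<Omega>)" "AE x in lebesgue_on \<Omega>. \<bar>w x\<bar> \<le> B"
  shows "in_Lp s \<Omega> (\<lambda>x. f x - w x)"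
proof -
  have "s = 1 \<or> s = 2 \<or> s = \<infinity>" using s by auto
  then show ?thesis
  proof (elim disjE)
    assume "s = 1"
    moreover have "integrable (lebesgue_on \<Omega>) w"
      using w by (intro finite_measure.integrable_const_bound[OF fin]) auto
    ultimately show ?thesis using f by (simp add: in_Lp_1_iff)
  next
    assume s2: "s = 2"
    have fm: "f \<in> borel_measurable (lebesgue_on \<Omega>)" "integrable (lebesgue_on \<Omega>) (\<lambda>x. (f x)\<^sup>2)"
      using f s2 by (auto simp: in_Lp_2_iff)
    have "integrable (lebesgue_on \<Omega>) (\<lambda>x. 2 * (f x)\<^sup>2 + 2 * B\<^sup>2)"
      using fm(2) finite_measure.integrable_const[OF fin] by (intro Bochner_Integration.integrable_add integrable_mult_right)
    then have "integrable (lebesgue_on \<Omega>) (\<lambda>x. (f x - w x)\<^sup>2)"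
    proof (rule Bochner_Integration.integrable_bound)
      show "AE x in lebesgue_on \<Omega>. norm ((f x - w x)\<^sup>2) \<le> norm (2 * (f x)\<^sup>2 + 2 * B\<^sup>2)"
        using w(2)
      proof eventually_elim
        case (elim x)
        have "(w x)\<^sup>2 \<le> B\<^sup>2" using power_mono[OF elim, of 2] by simp
        moreover have "(f x - w x)\<^sup>2 \<le> 2 * (f x)\<^sup>2 + 2 * (w x)\<^sup>2"
          using zero_le_power2[of "f x + w x"] by (simp add: power2_sum power2_diff)
        ultimately show ?case by simp
      qed
    qed (use fm(1) w(1) in measurable)
    then show ?thesis using fm(1) w(1) s2 by (simp add: in_Lp_2_iff)
  next
    assume st: "s = \<infinity>"
    then obtain A where A: "AE x in lebesgue_on \<Omega>. \<bar>f x\<bar> \<le> A" "f \<in> borel_measurable (lebesgue_on \<Omega>)"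
      using f unfolding st in_Lp_top_iff by blast
    have "AE x in lebesgue_on \<Omega>. \<bar>f x - w x\<bar> \<le> A + B"
      using A(1) w(2) by eventually_elim linarith
    then show ?thesis using A(2) w(1) unfolding st in_Lp_top_iff by auto
  qed
qed

lemma in_Lp_imp_integrable:
  assumes s: "s \<in> {1, 2, \<infinity>}" and f: "in_Lp s \<Omega> f" and fin: "finite_measure (lebesgue_on \<Omega>)"
  shows "integrable (lebesgue_on \<Omega>) f"
proof -
  have "s = 1 \<or> s = 2 \<or> s = \<infinity>" using s by auto
  then show ?thesis
  proof (elim disjE)
    assume "s = 2"
    then have fm: "f \<in> borel_measurable (lebesgue_on \<Omega>)" "integrable (lebesgue_on \<Omega>) (\<lambda>x. (f x)\<^sup>2)"
      using f by (auto simp: in_Lp_2_iff)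
    then show ?thesis
      by (rule finite_measure.square_integrable_imp_integrable[OF fin])
  next
    assume st: "s = \<infinity>"
    obtain B where "AE x in lebesgue_on \<Omega>. \<bar>f x\<bar> \<le> B" "f \<in> borel_measurable (lebesgue_on \<Omega>)"
      using f unfolding st in_Lp_top_iff by blast
    then show ?thesis
      by (intro finite_measure.integrable_const_bound[OF fin, of f B]) auto
  qed (use f in \<open>simp add: in_Lp_1_iff\<close>)
qed

lemma element_measure_le:
  fixes K \<Omega> :: "(real^'n::finite) set"
  assumes "bounded K" "K \<noteq> {}" "diameter K \<le> h" "interior K \<subseteq> \<Omega>" "open \<Omega>"
  shows "(LINT x|lebesgue_on \<Omega>. indicator (interior K) x) \<le> (2 * h) ^ CARD('n)"
proof -
  obtain a where a: "a \<in> K" using assms(2) by blast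
  have h: "0 \<le> h" using diameter_ge_0[OF assms(1)] assms(3) by linarith
  have sub: "interior K \<subseteq> cbox (\<chi> i. a $ i - h) (\<chi> i. a $ i + h)"
  proof
    fix x assume "x \<in> interior K"
    then have "dist x a \<le> h"
      using diameter_bounded_bound[OF assms(1) _ a, of x] assms(3) interior_subset by fastforce
    then have "\<bar>(x - a) $ i\<bar> \<le> h" for i
      using component_le_norm_cart[of "x - a" i] by (simp add: dist_norm)
    then show "x \<in> cbox (\<chi> i. a $ i - h) (\<chi> i. a $ i + h)"
      by (auto simp: mem_box_cart abs_le_iff algebra_simps)
  qed
  have "(LINT x|lebesgue_on \<Omega>. indicator (interior K) x) = (LINT x|lebesgue. indicator \<Omega> x *\<^sub>R indicator (interior K) x :: real)"
    using assms(5) by (subst integral_restrict_space) auto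
  also have "\<dots> = (LINT x|lebesgue. indicator (interior K) x :: real)"
    using assms(4) by (intro Bochner_Integration.integral_cong) (auto simp: indicator_def)
  also have "\<dots> = measure lebesgue (interior K)" by simp
  also have "\<dots> \<le> measure lebesgue (cbox (\<chi> i. a $ i - h) (\<chi> i. a $ i + h))"
    by (intro measure_mono_fmeasurable sub) auto
  also have "\<dots> = measure lborel (cbox (\<chi> i. a $ i - h) (\<chi> i. a $ i + h))" by simp
  also have "\<dots> = (2 * h) ^ CARD('n)"
    using h by (subst content_cbox_cart) (auto simp: interval_ne_empty_cart)
  finally show ?thesis .
qed

text \<open>Cauchy-Schwarz by expanding the nonnegative integral of \<open>(f x - t)^2\<close> over
  \<open>E\<close> at \<open>t = a / m\<close>. An upper bound \<open>m\<close> of the measure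
  suffices, as the measure appears with coefficient \<open>t^2\<close>.\<close>

lemma indicator_integral_square_le:
  fixes f :: "real^'n::finite \<Rightarrow> real"
  assumes fin: "finite_measure (lebesgue_on \<Omega>)" and f: "integrable (lebesgue_on \<Omega>) f" "integrable (lebesgue_on \<Omega>) (\<lambda>x. (f x)\<^sup>2)"
    and E: "E \<in> sets lebesgue" and m: "(LINT x|lebesgue_on \<Omega>. indicator E x) \<le> m" "0 < m"
  shows "(LINT x|lebesgue_on \<Omega>. indicator E x * f x)\<^sup>2 \<le> m * (LINT x|lebesgue_on \<Omega>. indicator E x * (f x)\<^sup>2)"
proof -
  define a where "a = (LINT x|lebesgue_on \<Omega>. indicator E x * f x)"
  define b where "b = (LINT x|lebesgue_on \<Omega>. indicator E x * (f x)\<^sup>2)"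
  define c where "c = (LINT x|lebesgue_on \<Omega>. indicator E x * (1 :: real))"
  define t where "t = a / m"
  have int: "integrable (lebesgue_on \<Omega>) (\<lambda>x. indicator E x * f x)"
    "integrable (lebesgue_on \<Omega>) (\<lambda>x. indicator E x * (f x)\<^sup>2)"
    "integrable (lebesgue_on \<Omega>) (\<lambda>x. indicator E x * (1 :: real))"
    by (intro indicator_integrable f E finite_measure.integrable_const[OF fin])+
  have "0 \<le> (LINT x|lebesgue_on \<Omega>. indicator E x * (f x - t)\<^sup>2)"
    by (intro integral_nonneg_AE) auto
  also have "\<dots> = (LINT x|lebesgue_on \<Omega>. indicator E x * (f x)\<^sup>2 - (2 * t) * (indicator E x * f x)
      + t\<^sup>2 * (indicator E x * 1))"
    by (intro Bochner_Integration.integral_cong) (auto simp: power2_diff algebra_simps)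
  also have "\<dots> = b - 2 * t * a + t\<^sup>2 * c"
    unfolding a_def b_def c_def using int
    by (simp only: Bochner_Integration.integral_add Bochner_Integration.integral_diff integral_mult_right_zero
        integrable_mult_right Bochner_Integration.integrable_diff)
  also have "t\<^sup>2 * c \<le> t\<^sup>2 * m"
    using m(1) by (intro mult_left_mono) (auto simp: c_def)
  also have "b - 2 * t * a + t\<^sup>2 * m = b - a\<^sup>2 / m"
    using m(2) by (simp add: t_def power2_eq_square)
  finally have "a\<^sup>2 / m \<le> b" by simp
  then show ?thesis
    using m(2) by (simp add: a_def b_def pos_divide_le_eq mult.commute)
qed

subsection \<open>Summation over the faces\<close>

text \<open>Group the faces by the element on the chosen side; an element is chosen by no more faces
  than it has.\<close>

lemma sum_over_faces_le:
  fixes T :: "'a::euclidean_space set set" and I :: "'a set \<Rightarrow> real"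
  assumes mesh: "mesh k \<Omega> T" and shape: "shape_in_dim DIM('a) k" and I: "\<And>K. 0 \<le> I K"
    and P: "\<And>F. F \<in> interior_faces k T \<Longrightarrow> P F \<in> T \<and> F \<in> element_faces k (P F)"
  shows "(\<Sum>F\<in>interior_faces k T. I (P F)) \<le> 49 * (\<Sum>K\<in>T. I K)"
proof -
  have fin: "finite T" and el: "\<And>K. K \<in> T \<Longrightarrow> is_element k K"
    using mesh by (auto simp: mesh_def)
  have "interior_faces k T \<subseteq> (\<Union>K\<in>T. element_faces k K)"
    by (auto simp: interior_faces_def)
  then have finF: "finite (interior_faces k T)"
    using fin element_faces_card(1)[OF el shape] by (auto intro: finite_subset)
  have "(\<Sum>F\<in>interior_faces k T. I (P F)) = (\<Sum>K\<in>T. \<Sum>F | F \<in> interior_faces k T \<and> P F = K. I (P F))"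
    using P finF fin by (intro sum.group[symmetric]) auto
  also have "\<dots> \<le> (\<Sum>K\<in>T. 49 * I K)"
  proof (rule sum_mono)
    fix K assume K: "K \<in> T"
    have "card {F. F \<in> interior_faces k T \<and> P F = K} \<le> card (element_faces k K)"
      using element_faces_card(1)[OF el[OF K] shape] P by (intro card_mono) auto
    also have "\<dots> \<le> 49" by (rule element_faces_card(2)[OF el[OF K] shape])
    finally have "real (card {F. F \<in> interior_faces k T \<and> P F = K}) * I K \<le> 49 * I K"
      using I by (intro mult_right_mono) auto
    then show "(\<Sum>F | F \<in> interior_faces k T \<and> P F = K. I (P F)) \<le> 49 * I K" by simp
  qed
  finally show ?thesis by (simp add: sum_distrib_left)
qed

lemma sum_over_elements_le:
  fixes G :: "real^'n::finite \<Rightarrow> real"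
  assumes mesh: "mesh k \<Omega> T" and G: "integrable (lebesgue_on \<Omega>) G" "\<And>x. 0 \<le> G x"
  shows "(\<Sum>K\<in>T. LINT x|lebesgue_on \<Omega>. indicator (interior K) x * G x) \<le> (LINT x|lebesgue_on \<Omega>. G x)"
proof -
  have fin: "finite T" and disj: "\<And>K L. K \<in> T \<Longrightarrow> L \<in> T \<Longrightarrow> K \<noteq> L \<Longrightarrow> interior K \<inter> interior L = {}"
    using mesh by (auto simp: mesh_def pairwise_def)
  have ind: "(\<Sum>K\<in>T. indicator (interior K) x) \<le> (1 :: real)" for x
  proof (cases "\<exists>K\<in>T. x \<in> interior K")
    case True
    then obtain K where K: "K \<in> T" "x \<in> interior K" by blast
    then have "(\<Sum>L\<in>T. indicator (interior L) x :: real) = (\<Sum>L\<in>{K}. indicator (interior L) x)"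
      using fin disj by (intro sum.mono_neutral_right) (auto simp: indicator_def)
    then show ?thesis by simp
  next
    case False
    then have "(\<Sum>L\<in>T. indicator (interior L) x :: real) = 0"
      by (intro sum.neutral) auto
    then show ?thesis by simp
  qed
  have "(\<Sum>K\<in>T. LINT x|lebesgue_on \<Omega>. indicator (interior K) x * G x)
    = (LINT x|lebesgue_on \<Omega>. (\<Sum>K\<in>T. indicator (interior K) x * G x))"
    by (intro Bochner_Integration.integral_sum[symmetric] indicator_integrable G) auto
  also have "\<dots> \<le> (LINT x|lebesgue_on \<Omega>. G x)"
  proof (intro integral_mono Bochner_Integration.integrable_sum indicator_integrable G)
    show "(\<Sum>K\<in>T. indicator (interior K) x * G x) \<le> G x" for x
      unfolding sum_distrib_right[symmetric] using ind[of x] G(2)[of x] by (intro mult_left_le_one_le sum_nonneg) auto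
  qed auto
  finally show ?thesis .
qed

subsection \<open>The theorem\<close>

lemma D_norm_le_sum:
  "D_norm p h w K L x \<le> (\<Sum>\<alpha> | mi_order \<alpha> \<le> p. \<bar>jump \<alpha> w K L x\<bar> / \<bar>h\<bar> ^ (p + 1 - mi_order \<alpha>))"
  using L2_set_le_sum_abs[of "\<lambda>\<alpha>. jump \<alpha> w K L x / h ^ (p + 1 - mi_order \<alpha>)" "{\<alpha>. mi_order \<alpha> \<le> p}"]
  by (simp add: D_norm_def L2_set_def power_abs)

lemma jump_le_D_norm:
  assumes "mi_order \<alpha> \<le> p"
  shows "\<bar>jump \<alpha> w K L x\<bar> / \<bar>h\<bar> ^ (p + 1 - mi_order \<alpha>) \<le> D_norm p h w K L x"
proof -
  let ?f = "\<lambda>\<alpha>. (jump \<alpha> w K L x / h ^ (p + 1 - mi_order \<alpha>))\<^sup>2"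
  have "sqrt (?f \<alpha>) \<le> sqrt (\<Sum>\<alpha> | mi_order \<alpha> \<le> p. ?f \<alpha>)"
    using assms finite_mi_order_le[of p] by (intro real_sqrt_le_mono member_le_sum) auto
  then show ?thesis
    by (simp add: D_norm_def power_abs)
qed

theorem theorem3p3:
  fixes \<Omega> :: "(real^'n::finite) set"
    and p :: nat and s :: ennreal
    and u :: "real^'n \<Rightarrow> real"
    and k :: "'i \<Rightarrow> shape"
    and T :: "'i \<Rightarrow> (real^'n) set set"
    and Kp Km :: "'i \<Rightarrow> (real^'n) set \<Rightarrow> (real^'n) set"
    and uR :: "'i \<Rightarrow> real^'n \<Rightarrow> real"
  assumes s: "s \<in> {1, 2, \<infinity>}"
    and domain: "open \<Omega>" "connected \<Omega>" "bounded \<Omega>" "\<Omega> \<noteq> {}"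
    and u: "u \<in> sobolev (p + 1) s \<Omega>"
    and shapes: "CARD('n) = 2 \<and> (\<forall>i. k i \<in> {Triangle, Quadrilateral}) \<or>
                 CARD('n) = 3 \<and> (\<forall>i. k i \<in> {Tetrahedron, Hexahedron})"
    and meshes: "\<And>i. mesh (k i) \<Omega> (T i)"
    and quasi_uniform: "quasi_uniform_family k T"
    and sides: "\<And>i. is_orientation (k i) (T i) (Kp i) (Km i)"
    and uR: "\<And>i. piecewise_polynomial p (T i) (uR i)"
    and error: "\<exists>C. \<forall>i. Lp_norm s \<Omega> (\<lambda>x. u x - uR i x) \<le> C * mesh_size (T i) ^ (p + 1)"
  shows "smooth_type_A p s k T Kp Km uR \<and>
    (s = \<infinity> \<longrightarrow>
      (\<exists>C. \<forall>i. \<forall>F\<in>interior_faces (k i) (T i). \<forall>\<alpha>. mi_order \<alpha> \<le> p \<longrightarrow>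
        \<bar>jump \<alpha> (uR i) (Kp i F) (Km i F) (face_point F)\<bar>
          \<le> C * mesh_size (T i) ^ (p + 1 - mi_order \<alpha>)))"
proof -
  define h where "h i = mesh_size (T i)" for i
  define n where "n = CARD('n)"
  have shape: "shape_in_dim CARD('n) (k i)" for i
    using shapes by (auto simp: shape_in_dim_def)
  have dim: "shape_in_dim DIM(real^'n) (k i)" for i using shape by simp
  have fin: "finite (T i)" and el: "K \<in> T i \<Longrightarrow> is_element (k i) K" and \<Omega>_eq: "\<Omega> = interior (\<Union>(T i))" for i K
    using meshes[of i] by (auto simp: mesh_def)
  have diam: "diameter K \<le> h i" if "K \<in> T i" for i K
    unfolding h_def mesh_size_def using fin that by (intro Max_ge) auto
  have ne: "\<exists>K. K \<in> T i" for i using domain(4) \<Omega>_eq[of i] by (cases "T i = {}") auto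
  have h: "0 < h i" for i
  proof -
    obtain K where K: "K \<in> T i" using ne by blast
    then show ?thesis using diam[OF K] element_diameter_pos[OF el[OF K] dim] by linarith
  qed
  have K_props: "bounded K" "K \<noteq> {}" "interior K \<subseteq> \<Omega>" if K: "K \<in> T i" for i K
  proof -
    show "bounded K" using element_compact_frontier(1)[OF el[OF K] dim] by (rule compact_imp_bounded)
    show "K \<noteq> {}" using element_diameter_pos[OF el[OF K] dim] by auto
    show "interior K \<subseteq> \<Omega>" unfolding \<Omega>_eq[of i] using K by (intro interior_mono) auto
  qed
  have \<Omega>s: "\<Omega> \<in> sets lebesgue" using domain(1) by auto
  have finM: "finite_measure (lebesgue_on \<Omega>)"
    by (intro finite_measure_lebesgue_on bounded_set_imp_lmeasurable domain(3) \<Omega>s)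
  have ints: "interior K \<in> sets lebesgue" for K :: "(real^'n) set" by auto
  obtain \<sigma> where \<sigma>: "0 < \<sigma>" "\<And>i K. K \<in> T i \<Longrightarrow> diameter K \<le> \<sigma> * rho (k i) K"
    using quasi_uniform by (auto simp: quasi_uniform_family_def regular_family_def)
  obtain \<kappa>0 where \<kappa>0: "\<And>i. mesh_size (T i) \<le> \<kappa>0 * min_edge_length (k i) (T i)"
    using quasi_uniform by (auto simp: quasi_uniform_family_def)
  define \<kappa> where "\<kappa> = max \<kappa>0 1"
  have \<kappa>: "0 < \<kappa>" "mesh_size (T i) \<le> \<kappa> * min_edge_length (k i) (T i)" for i
  proof -
    show "0 < \<kappa>" by (simp add: \<kappa>_def)
    obtain K where K: "K \<in> T i" using ne by blast
    have "0 \<le> min_edge_length (k i) (T i)" by (rule min_edge_length_le(1)[OF K el dim])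
    then have "\<kappa>0 * min_edge_length (k i) (T i) \<le> \<kappa> * min_edge_length (k i) (T i)"
      by (intro mult_right_mono) (auto simp: \<kappa>_def)
    then show "mesh_size (T i) \<le> \<kappa> * min_edge_length (k i) (T i)" using \<kappa>0[of i] by linarith
  qed
  have "\<exists>v. in_Lp s \<Omega> v \<and> weak_derivative \<beta> \<Omega> u v" if "mi_order \<beta> = Suc p" for \<beta>
    using u that by (auto simp: sobolev_def)
  then obtain v where v: "\<And>\<beta>. mi_order \<beta> = Suc p \<Longrightarrow> in_Lp s \<Omega> (v \<beta>)"
    "\<And>\<beta>. mi_order \<beta> = Suc p \<Longrightarrow> weak_derivative \<beta> \<Omega> u (v \<beta>)"
    by metis
  have uLp: "in_Lp s \<Omega> u" using u by (simp add: sobolev_def)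
  \<comment> \<open>\<open>Lp_norm\<close> is total and returns a default outside the space, so
    membership must be established before the error bound carries information.\<close>
  have dLp: "in_Lp s \<Omega> (\<lambda>x. u x - uR i x)" for i
  proof -
    obtain B where "AE x in lebesgue_on \<Omega>. \<bar>uR i x\<bar> \<le> B"
      using piecewise_polynomial_measurable_bounded(2)[OF meshes shape uR domain(1,3)] by blast
    then show ?thesis
      using in_Lp_diff_bounded[OF s uLp finM] piecewise_polynomial_measurable_bounded(1)[OF meshes shape uR domain(1,3)]
      by blast
  qed
  have int_v: "integrable (lebesgue_on \<Omega>) (v \<beta>)" if "mi_order \<beta> = Suc p" for \<beta>
    using in_Lp_imp_integrable[OF s v(1)[OF that] finM] .
  have int_d: "integrable (lebesgue_on \<Omega>) (\<lambda>x. u x - uR i x)" for i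
    using in_Lp_imp_integrable[OF s dLp finM] .
  obtain E0 where E0: "\<And>i. Lp_norm s \<Omega> (\<lambda>x. u x - uR i x) \<le> E0 * h i ^ (p + 1)"
    using error unfolding h_def by blast
  define g where "g i x = \<bar>u x - uR i x\<bar> / h i ^ Suc p + (\<Sum>\<beta> | mi_order \<beta> = Suc p. \<bar>v \<beta> x\<bar>)" for i x
  define LE where "LE i K = (LINT x|lebesgue_on \<Omega>. indicator (interior K) x * g i x)" for i K
  have g0: "0 \<le> g i x" for i x
    unfolding g_def using h[of i] by (intro add_nonneg_nonneg sum_nonneg) auto
  have int_g: "integrable (lebesgue_on \<Omega>) (g i)" for i
    unfolding g_def using int_v int_d
    by (intro Bochner_Integration.integrable_add Bochner_Integration.integrable_sum integrable_divide integrable_abs) auto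
  obtain C0 where C0: "0 \<le> C0"
    and jump_bound: "\<And>i K L F \<alpha>. \<lbrakk>K \<in> T i; L \<in> T i; K \<noteq> L; F \<in> element_faces (k i) K; F \<in> element_faces (k i) L;
      mi_order \<alpha> \<le> p\<rbrakk> \<Longrightarrow> \<bar>jump \<alpha> (uR i) K L (face_point F)\<bar> / h i ^ (p + 1 - mi_order \<alpha>)
        \<le> C0 / h i ^ n * (LE i K + LE i L)"
  proof -
    have LE_eq: "local_error \<Omega> p (mesh_size (T i)) u (uR i) v K = LE i K" for i K
      by (simp add: local_error_def LE_def g_def h_def)
    show ?thesis
    proof (rule face_jump_bound[where p = p and 'n = 'n, OF \<sigma>(1) \<kappa>(1)], goal_cases)
      case (1 C)
      note bound = 1(2)
      show ?case
      proof (rule that[OF 1(1)])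
        fix i K L F and \<alpha> :: "'n multi_index"
        assume KL: "K \<in> T i" "L \<in> T i" "K \<noteq> L" "F \<in> element_faces (k i) K" "F \<in> element_faces (k i) L" "mi_order \<alpha> \<le> p"
        have "\<bar>jump \<alpha> (uR i) K L (face_point F)\<bar> / mesh_size (T i) ^ (p + 1 - mi_order \<alpha>) \<le> C / mesh_size (T i) ^ CARD('n) *
           (local_error \<Omega> p (mesh_size (T i)) u (uR i) v K + local_error \<Omega> p (mesh_size (T i)) u (uR i) v L)"
        proof (rule bound[OF domain(1,3) in_Lp_imp_integrable[OF s uLp finM] _ shape meshes KL(1-5) \<sigma>(2) \<kappa>(2) uR KL(6)])
          show "integrable (lebesgue_on \<Omega>) (v \<beta>) \<and> weak_derivative \<beta> \<Omega> u (v \<beta>)" if "mi_order \<beta> = Suc p" for \<beta>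
            using int_v[OF that] v(2)[OF that] by blast
        qed
        then show "\<bar>jump \<alpha> (uR i) K L (face_point F)\<bar> / h i ^ (p + 1 - mi_order \<alpha>) \<le> C / h i ^ n * (LE i K + LE i L)"
          unfolding LE_eq h_def n_def .
      qed
    qed
  qed
  \<comment> \<open>The Euclidean norm of the scaled jumps is at most the sum of their absolute
    values, one term for each multi-index.\<close>
  define A where "A = real (card {\<alpha> :: 'n multi_index. mi_order \<alpha> \<le> p}) * C0"
  have A: "0 \<le> A" using C0 by (simp add: A_def)
  define D where "D i F = D_norm p (h i) (uR i) (Kp i F) (Km i F) (face_point F)" for i F
  have D0: "0 \<le> D i F" for i F by (simp add: D_def D_norm_def sum_nonneg)
  have sidesD: "Kp i F \<in> T i" "Km i F \<in> T i" "Kp i F \<noteq> Km i F"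
    "F \<in> element_faces (k i) (Kp i F)" "F \<in> element_faces (k i) (Km i F)"
    if "F \<in> interior_faces (k i) (T i)" for i F
    using sides[of i] that unfolding is_orientation_def by blast+
  have D_le: "D i F \<le> A / h i ^ n * (LE i (Kp i F) + LE i (Km i F))" if F: "F \<in> interior_faces (k i) (T i)" for i F
  proof -
    have "D i F \<le> (\<Sum>\<alpha> | mi_order \<alpha> \<le> p. \<bar>jump \<alpha> (uR i) (Kp i F) (Km i F) (face_point F)\<bar> / \<bar>h i\<bar> ^ (p + 1 - mi_order \<alpha>))"
      unfolding D_def by (rule D_norm_le_sum)
    also have "\<dots> \<le> (\<Sum>\<alpha> :: 'n multi_index | mi_order \<alpha> \<le> p. C0 / h i ^ n * (LE i (Kp i F) + LE i (Km i F)))"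
    proof (rule sum_mono)
      fix \<alpha> :: "'n multi_index" assume "\<alpha> \<in> {\<alpha>. mi_order \<alpha> \<le> p}"
      then show "\<bar>jump \<alpha> (uR i) (Kp i F) (Km i F) (face_point F)\<bar> / \<bar>h i\<bar> ^ (p + 1 - mi_order \<alpha>)
          \<le> C0 / h i ^ n * (LE i (Kp i F) + LE i (Km i F))"
        using jump_bound[OF sidesD[OF F]] h[of i] by simp
    qed
    finally show ?thesis by (simp add: A_def)
  qed
  have vol: "(LINT x|lebesgue_on \<Omega>. indicator (interior K) x) \<le> (2 * h i) ^ n" if K: "K \<in> T i" for i K
    unfolding n_def using K_props[OF K] diam[OF K] domain(1) by (intro element_measure_le)
  have "s = 1 \<or> s = 2 \<or> s = \<infinity>" using s by auto
  then consider (fin) "s \<noteq> \<infinity>" "s = 1 \<or> s = 2" | (top) "s = \<infinity>" by auto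
  then show ?thesis
  proof cases
    case top
    have "\<exists>B. AE x in lebesgue_on \<Omega>. \<bar>v \<beta> x\<bar> \<le> B" if "mi_order \<beta> = Suc p" for \<beta>
      using v(1)[OF that] unfolding top in_Lp_top_iff by blast
    then obtain B where B: "\<And>\<beta>. mi_order \<beta> = Suc p \<Longrightarrow> AE x in lebesgue_on \<Omega>. \<bar>v \<beta> x\<bar> \<le> B \<beta>" by metis
    define G where "G = E0 + (\<Sum>\<beta> | mi_order \<beta> = Suc p. B \<beta>)"
    have g_le: "AE x in lebesgue_on \<Omega>. g i x \<le> G" for i
    proof -
      have "AE x in lebesgue_on \<Omega>. \<forall>\<beta>\<in>{\<beta>. mi_order \<beta> = Suc p}. \<bar>v \<beta> x\<bar> \<le> B \<beta>"
        using B finite_mi_order_eq by (intro AE_finite_allI) auto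
      moreover have "AE x in lebesgue_on \<Omega>. \<bar>u x - uR i x\<bar> \<le> Lp_norm \<infinity> \<Omega> (\<lambda>x. u x - uR i x)"
        using dLp[of i] unfolding top by (intro Lp_norm_top_AE domain)
      ultimately show ?thesis
      proof eventually_elim
        case (elim x)
        have "\<bar>u x - uR i x\<bar> \<le> E0 * h i ^ Suc p"
          using elim(2) E0[of i] unfolding top by simp
        then have "\<bar>u x - uR i x\<bar> / h i ^ Suc p \<le> E0"
          using h[of i] by (simp add: pos_divide_le_eq del: power_Suc)
        then show ?case unfolding g_def G_def using elim(1) by (intro add_mono sum_mono) auto
      qed
    qed
    \<comment> \<open>Nonnegativity is needed when the volume bound is multiplied by the
      constant.\<close>
    define G' where "G' = max G 0"
    \<comment> \<open>The volume of an element supplies the h^n that cancels the h^-n in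
      \<open>D_le\<close>.\<close>
    have LE_le: "LE i K \<le> G' * (2 * h i) ^ n" if K: "K \<in> T i" for i K
    proof -
      have "LE i K \<le> (LINT x|lebesgue_on \<Omega>. indicator (interior K) x * G')"
        unfolding LE_def
      proof (rule integral_mono_AE)
        show "AE x in lebesgue_on \<Omega>. indicator (interior K) x * g i x \<le> indicator (interior K) x * G'"
          using g_le[of i] by eventually_elim (auto simp: indicator_def G'_def)
      qed (intro indicator_integrable int_g ints finite_measure.integrable_const[OF finM])+
      also have "\<dots> = (LINT x|lebesgue_on \<Omega>. indicator (interior K) x) * G'" by simp
      also have "\<dots> \<le> (2 * h i) ^ n * G'" using vol[OF K] by (intro mult_right_mono) (auto simp: G'_def)
      finally show ?thesis by (simp add: mult.commute)
    qed
    have D_bound: "D i F \<le> A * (2 * G' * 2 ^ n)" if F: "F \<in> interior_faces (k i) (T i)" for i F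
    proof -
      have "D i F \<le> A / h i ^ n * (LE i (Kp i F) + LE i (Km i F))" by (rule D_le[OF F])
      also have "\<dots> \<le> A / h i ^ n * (G' * (2 * h i) ^ n + G' * (2 * h i) ^ n)"
        using LE_le[OF sidesD(1)[OF F]] LE_le[OF sidesD(2)[OF F]] A h[of i]
        by (intro mult_left_mono add_mono) auto
      also have "\<dots> = A * (2 * G' * 2 ^ n)" using h[of i] by (simp add: power_mult_distrib)
      finally show ?thesis .
    qed
    have "smooth_type_A p s k T Kp Km uR"
      unfolding smooth_type_A_def if_P[OF top] using D_bound unfolding D_def h_def by blast
    moreover have "\<bar>jump \<alpha> (uR i) (Kp i F) (Km i F) (face_point F)\<bar>
          \<le> A * (2 * G' * 2 ^ n) * mesh_size (T i) ^ (p + 1 - mi_order \<alpha>)"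
      if F: "F \<in> interior_faces (k i) (T i)" and \<alpha>: "mi_order \<alpha> \<le> p" for i F \<alpha>
    proof -
      have "\<bar>jump \<alpha> (uR i) (Kp i F) (Km i F) (face_point F)\<bar> / h i ^ (p + 1 - mi_order \<alpha>) \<le> A * (2 * G' * 2 ^ n)"
        using jump_le_D_norm[OF \<alpha>, of "uR i" "Kp i F" "Km i F" "face_point F" "h i"] D_bound[OF F] h[of i]
        by (simp add: D_def)
      then show ?thesis using h[of i] by (simp add: pos_divide_le_eq h_def del: power_Suc)
    qed
    ultimately show ?thesis by blast
  next
    case fin
    have "\<exists>C. \<forall>i. (\<Sum>F\<in>interior_faces (k i) (T i). h i ^ n * D i F powr enn2real s) \<le> C"
    proof -
      \<comment> \<open>98 is twice 49, one count for each side of the faces.\<close>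
      have sum_bound: "(\<Sum>F\<in>interior_faces (k i) (T i). h i ^ n * D i F powr enn2real s) \<le> B * (98 * R)"
        if G: "integrable (lebesgue_on \<Omega>) G" "\<And>x. 0 \<le> G x" "(LINT x|lebesgue_on \<Omega>. G x) \<le> R" and B: "0 \<le> B"
          and face: "\<And>F. F \<in> interior_faces (k i) (T i) \<Longrightarrow> h i ^ n * D i F powr enn2real s \<le> B *
            ((LINT x|lebesgue_on \<Omega>. indicator (interior (Kp i F)) x * G x) + (LINT x|lebesgue_on \<Omega>. indicator (interior (Km i F)) x * G x))"
        for i B R G
      proof -
        define I where "I K = (LINT x|lebesgue_on \<Omega>. indicator (interior K) x * G x)" for K
        have I0: "0 \<le> I K" for K unfolding I_def using G(2) by (intro integral_nonneg_AE AE_I2) auto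
        have "(\<Sum>F\<in>interior_faces (k i) (T i). h i ^ n * D i F powr enn2real s)
          \<le> (\<Sum>F\<in>interior_faces (k i) (T i). B * (I (Kp i F) + I (Km i F)))"
          unfolding I_def by (intro sum_mono face)
        also have "\<dots> = B * ((\<Sum>F\<in>interior_faces (k i) (T i). I (Kp i F)) + (\<Sum>F\<in>interior_faces (k i) (T i). I (Km i F)))"
          by (simp add: sum_distrib_left sum.distrib distrib_left)
        also have "\<dots> \<le> B * (49 * (\<Sum>K\<in>T i. I K) + 49 * (\<Sum>K\<in>T i. I K))"
          using sidesD B I0 by (intro mult_left_mono add_mono sum_over_faces_le[OF meshes dim]) auto
        also have "\<dots> = B * (98 * (\<Sum>K\<in>T i. I K))" by simp
        also have "\<dots> \<le> B * (98 * R)"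
        proof -
          have "(\<Sum>K\<in>T i. I K) \<le> R"
            unfolding I_def using sum_over_elements_le[OF meshes G(1,2)] G(3) by (rule order_trans)
          then show ?thesis using B by (intro mult_left_mono) auto
        qed
        finally show ?thesis .
      qed
      from fin(2) show ?thesis
      proof
        assume s1: "s = 1"
        define R where "R = E0 + (\<Sum>\<beta> | mi_order \<beta> = Suc p. LINT x|lebesgue_on \<Omega>. \<bar>v \<beta> x\<bar>)"
        have R: "(LINT x|lebesgue_on \<Omega>. g i x) \<le> R" for i
        proof -
          have "(LINT x|lebesgue_on \<Omega>. g i x) = (LINT x|lebesgue_on \<Omega>. \<bar>u x - uR i x\<bar> / h i ^ Suc p)
            + (LINT x|lebesgue_on \<Omega>. (\<Sum>\<beta> | mi_order \<beta> = Suc p. \<bar>v \<beta> x\<bar>))"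
            unfolding g_def using int_v int_d
            by (intro Bochner_Integration.integral_add Bochner_Integration.integrable_sum integrable_divide integrable_abs) auto
          also have "(LINT x|lebesgue_on \<Omega>. (\<Sum>\<beta> | mi_order \<beta> = Suc p. \<bar>v \<beta> x\<bar>))
            = (\<Sum>\<beta> | mi_order \<beta> = Suc p. LINT x|lebesgue_on \<Omega>. \<bar>v \<beta> x\<bar>)"
            using int_v by (intro Bochner_Integration.integral_sum integrable_abs) auto
          also have "(LINT x|lebesgue_on \<Omega>. \<bar>u x - uR i x\<bar> / h i ^ Suc p) = Lp_norm 1 \<Omega> (\<lambda>x. u x - uR i x) / h i ^ Suc p"
            unfolding Lp_norm_1 by (rule integral_divide_zero)
          also have "\<dots> \<le> E0"
            using E0[of i] h[of i] unfolding s1 by (simp add: pos_divide_le_eq)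
          finally show ?thesis by (simp add: R_def)
        qed
        have face: "h i ^ n * D i F powr enn2real s \<le> A * (LE i (Kp i F) + LE i (Km i F))"
          if F: "F \<in> interior_faces (k i) (T i)" for i F
        proof -
          have "h i ^ n * D i F powr enn2real s = h i ^ n * D i F" using D0[of i F] by (simp add: s1)
          also have "\<dots> \<le> h i ^ n * (A / h i ^ n * (LE i (Kp i F) + LE i (Km i F)))"
            using D_le[OF F] h[of i] by (intro mult_left_mono) auto
          finally show ?thesis using h[of i] by simp
        qed
        show ?thesis
          using sum_bound[OF int_g g0 R A face[unfolded LE_def]] by blast
      next
        assume s2: "s = 2"
        define V where "V x = (\<Sum>\<beta> | mi_order \<beta> = Suc p. \<bar>v \<beta> x\<bar>)" for x
        have int_d2: "integrable (lebesgue_on \<Omega>) (\<lambda>x. (u x - uR i x)\<^sup>2)" for i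
          using dLp[of i] unfolding s2 in_Lp_2_iff by blast
        have int_V2: "integrable (lebesgue_on \<Omega>) (\<lambda>x. (V x)\<^sup>2)"
        proof (rule Bochner_Integration.integrable_bound)
          show "integrable (lebesgue_on \<Omega>) (\<lambda>x. (\<Sum>\<beta> | mi_order \<beta> = Suc p. (v \<beta> x)\<^sup>2)
              * card {\<beta> :: 'n multi_index. mi_order \<beta> = Suc p})"
            using v(1) unfolding s2 in_Lp_2_iff
            by (intro integrable_mult_left Bochner_Integration.integrable_sum) auto
          have "V \<in> borel_measurable (lebesgue_on \<Omega>)"
            unfolding V_def using int_v
            by (intro borel_measurable_integrable Bochner_Integration.integrable_sum integrable_abs) auto
          then show "(\<lambda>x. (V x)\<^sup>2) \<in> borel_measurable (lebesgue_on \<Omega>)" by measurable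
          show "AE x in lebesgue_on \<Omega>. norm ((V x)\<^sup>2) \<le> norm ((\<Sum>\<beta> | mi_order \<beta> = Suc p. (v \<beta> x)\<^sup>2)
              * card {\<beta> :: 'n multi_index. mi_order \<beta> = Suc p})"
          proof (rule AE_I2)
            fix x
            have "(V x)\<^sup>2 \<le> (\<Sum>\<beta> | mi_order \<beta> = Suc p. (v \<beta> x)\<^sup>2) * card {\<beta> :: 'n multi_index. mi_order \<beta> = Suc p}"
              using sum_squared_le_sum_of_squares[of "\<lambda>\<beta>. \<bar>v \<beta> x\<bar>" "{\<beta>. mi_order \<beta> = Suc p}"] by (simp add: V_def)
            then show "norm ((V x)\<^sup>2) \<le> norm ((\<Sum>\<beta> | mi_order \<beta> = Suc p. (v \<beta> x)\<^sup>2)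
              * card {\<beta> :: 'n multi_index. mi_order \<beta> = Suc p})"
              unfolding real_norm_def abs_power2 by (rule order_trans[OF _ abs_ge_self])
          qed
        qed
        have g2_le: "(g i x)\<^sup>2 \<le> 2 / (h i ^ Suc p)\<^sup>2 * (u x - uR i x)\<^sup>2 + 2 * (V x)\<^sup>2" for i x
        proof -
          have "(a + b)\<^sup>2 \<le> 2 * a\<^sup>2 + 2 * b\<^sup>2" for a b :: real
            using zero_le_power2[of "a - b"] by (simp add: power2_sum power2_diff)
          from this[of "\<bar>u x - uR i x\<bar> / h i ^ Suc p" "V x"] show ?thesis
            by (simp add: g_def V_def power_divide)
        qed
        have int_bd: "integrable (lebesgue_on \<Omega>) (\<lambda>x. 2 / (h i ^ Suc p)\<^sup>2 * (u x - uR i x)\<^sup>2 + 2 * (V x)\<^sup>2)" for i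
          by (intro Bochner_Integration.integrable_add integrable_mult_right int_d2 int_V2)
        have int_g2: "integrable (lebesgue_on \<Omega>) (\<lambda>x. (g i x)\<^sup>2)" for i
          using int_bd[of i]
        proof (rule Bochner_Integration.integrable_bound)
          show "(\<lambda>x. (g i x)\<^sup>2) \<in> borel_measurable (lebesgue_on \<Omega>)"
            using borel_measurable_integrable[OF int_g[of i]] by measurable
          show "AE x in lebesgue_on \<Omega>. norm ((g i x)\<^sup>2) \<le> norm (2 / (h i ^ Suc p)\<^sup>2 * (u x - uR i x)\<^sup>2 + 2 * (V x)\<^sup>2)"
          proof (rule AE_I2)
            fix x
            show "norm ((g i x)\<^sup>2) \<le> norm (2 / (h i ^ Suc p)\<^sup>2 * (u x - uR i x)\<^sup>2 + 2 * (V x)\<^sup>2)"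
              unfolding real_norm_def abs_power2 by (rule order_trans[OF g2_le abs_ge_self])
          qed
        qed
        define R where "R = 2 * E0\<^sup>2 + 2 * (LINT x|lebesgue_on \<Omega>. (V x)\<^sup>2)"
        have R: "(LINT x|lebesgue_on \<Omega>. (g i x)\<^sup>2) \<le> R" for i
        proof -
          have "(LINT x|lebesgue_on \<Omega>. (g i x)\<^sup>2)
            \<le> (LINT x|lebesgue_on \<Omega>. 2 / (h i ^ Suc p)\<^sup>2 * (u x - uR i x)\<^sup>2 + 2 * (V x)\<^sup>2)"
            by (intro integral_mono int_g2 int_bd g2_le)
          also have "\<dots> = 2 / (h i ^ Suc p)\<^sup>2 * (LINT x|lebesgue_on \<Omega>. (u x - uR i x)\<^sup>2) + 2 * (LINT x|lebesgue_on \<Omega>. (V x)\<^sup>2)"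
            using int_d2[of i] int_V2
            by (simp only: Bochner_Integration.integral_add integral_mult_right_zero integrable_mult_right)
          also have "(LINT x|lebesgue_on \<Omega>. (u x - uR i x)\<^sup>2) \<le> (E0 * h i ^ Suc p)\<^sup>2"
          proof -
            have "0 \<le> Lp_norm 2 \<Omega> (\<lambda>x. u x - uR i x)" by (simp add: Lp_norm_def)
            then show ?thesis
              unfolding Lp_norm_2[symmetric] using E0[of i] unfolding s2 by (intro power_mono) auto
          qed
          also have "2 / (h i ^ Suc p)\<^sup>2 * (E0 * h i ^ Suc p)\<^sup>2 = 2 * E0\<^sup>2"
            using h[of i] by (simp add: power_mult_distrib)
          finally show ?thesis by (simp add: R_def divide_right_mono)
        qed
        \<comment> \<open>Squaring \<open>D_le\<close> produces h^-2n: one h^-n is absorbed by the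
          weight h^n of the sum, the other by the volume in Cauchy-Schwarz, which leaves 2^n; the 2
          comes from the square of the sum over the two sides.\<close>
        define Q where "Q = 2 * A\<^sup>2 * 2 ^ n"
        have face: "h i ^ n * D i F powr enn2real s \<le> Q *
            ((LINT x|lebesgue_on \<Omega>. indicator (interior (Kp i F)) x * (g i x)\<^sup>2) + (LINT x|lebesgue_on \<Omega>. indicator (interior (Km i F)) x * (g i x)\<^sup>2))"
          if F: "F \<in> interior_faces (k i) (T i)" for i F
        proof -
          let ?I = "\<lambda>K. LINT x|lebesgue_on \<Omega>. indicator (interior K) x * (g i x)\<^sup>2"
          have sq: "(LE i K)\<^sup>2 \<le> (2 * h i) ^ n * ?I K" if K: "K \<in> T i" for K
            unfolding LE_def using vol[OF K] h[of i]
            by (intro indicator_integral_square_le[OF finM int_g int_g2 ints]) auto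
          have "h i ^ n * D i F powr enn2real s = h i ^ n * (D i F)\<^sup>2"
            using D0[of i F] by (simp add: s2)
          also have "\<dots> \<le> h i ^ n * (A / h i ^ n * (LE i (Kp i F) + LE i (Km i F)))\<^sup>2"
            using D_le[OF F] D0 h[of i] by (intro mult_left_mono power_mono) auto
          also have "\<dots> = A\<^sup>2 / h i ^ n * (LE i (Kp i F) + LE i (Km i F))\<^sup>2"
            using h[of i] by (simp add: power_mult_distrib power_divide power2_eq_square)
          also have "\<dots> \<le> A\<^sup>2 / h i ^ n * (2 * (LE i (Kp i F))\<^sup>2 + 2 * (LE i (Km i F))\<^sup>2)"
          proof (rule mult_left_mono)
            show "(LE i (Kp i F) + LE i (Km i F))\<^sup>2 \<le> 2 * (LE i (Kp i F))\<^sup>2 + 2 * (LE i (Km i F))\<^sup>2"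
              using zero_le_power2[of "LE i (Kp i F) - LE i (Km i F)"] by (simp add: power2_sum power2_diff)
          qed (use h[of i] in auto)
          also have "\<dots> \<le> A\<^sup>2 / h i ^ n * (2 * ((2 * h i) ^ n * ?I (Kp i F)) + 2 * ((2 * h i) ^ n * ?I (Km i F)))"
            using sq[OF sidesD(1)[OF F]] sq[OF sidesD(2)[OF F]] h[of i]
            by (intro mult_left_mono add_mono) auto
          also have "\<dots> = Q * (?I (Kp i F) + ?I (Km i F))"
            using h[of i] by (simp add: Q_def power_mult_distrib distrib_left)
          finally show ?thesis .
        qed
        have Q0: "0 \<le> Q" by (simp add: Q_def)
        show ?thesis
          using sum_bound[OF int_g2 zero_le_power2 R Q0 face] by blast
      qed
    qed
    then have "smooth_type_A p s k T Kp Km uR"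
      unfolding smooth_type_A_def if_not_P[OF fin(1)] D_def h_def n_def .
    then show ?thesis using fin(1) by blast
  qed
qed

end
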